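(* Let $\mathcal{A}$ be an abelian Bénabou cosmos and let $\mathcal{C}$ be a small $\mathcal{A}$-category. Then the category of $\mathcal{C}$-modules $\mathrm{Mod}(\mathcal{C})$ is an abelian category satisfying Grothendieck's axioms (AB4) and (AB4* ).
   Context: A Bénabou cosmos is a complete and cocomplete symmetric closed monoidal category. A Bénabou cosmos $\mathcal{A}$ is called abelian if its underlying category is an abelian category satisfying (AB4) and (AB4* ), i.e. small coproducts, resp. products, of short exact sequences are short exact. A $\mathcal{C}$-module is an $\mathcal{A}$-functor $\mathcal{C}\to\mathcal{A}$ ($\mathcal{A}$ being enriched in itself by its inner hom); $\mathrm{Mod}(\mathcal{C})$ is the ordinary category of $\mathcal{C}$-modules and $\mathcal{A}$-natural transformations. *)

theory Defs
  imports "HOL-Algebra.Group"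
begin

no_notation monoid.mult (infixl "\<otimes>\<index>" 70)

section \<open>Smallness\<close>

text \<open>
  The universe of small sets is given by a type \<open>'u\<close>: a set, of whatever type, is small if its
  cardinality is less than that of \<open>'u\<close>. The cardinality of \<open>'u\<close> is required to be infinite,
  regular and a strong limit, as it is for a Grothendieck universe. Uncountability is not required,
  so countably infinite types are also admitted, with \<open>small\<close> meaning \<open>finite\<close>. Up to bijection
  every small set is a small subset of \<open>'u\<close>, so small families and diagrams may be indexed by
  elements of \<open>'u\<close>.
\<close>

definition small :: "'u itself \<Rightarrow> 'a set \<Rightarrow> bool" where
  "small U S \<longleftrightarrow> (card_of S, card_of (UNIV :: 'u set)) \<in> ordLess"

definition universe :: "'u itself \<Rightarrow> bool" where
  "universe U \<longleftrightarrow>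
     infinite (UNIV :: 'u set) \<and>
     regularCard (card_of (UNIV :: 'u set)) \<and>
     (\<forall>S :: 'u set. small U S \<longrightarrow> small U (Pow S))"


section \<open>Categories\<close>

record ('o, 'm) cat =
  Obj :: "'o set"
  Arr :: "'m set"
  Dom :: "'m \<Rightarrow> 'o"
  Cod :: "'m \<Rightarrow> 'o"
  Ident :: "'o \<Rightarrow> 'm"
  Comp :: "'m \<Rightarrow> 'm \<Rightarrow> 'm" (infixr "\<cdot>\<index>" 65)

definition Hom :: "('o, 'm, 'z) cat_scheme \<Rightarrow> 'o \<Rightarrow> 'o \<Rightarrow> 'm set" where
  "Hom C X Y = {f \<in> Arr C. Dom C f = X \<and> Cod C f = Y}"

locale category =
  fixes C :: "('o, 'm, 'z) cat_scheme" (structure)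
  assumes Dom_Obj: "f \<in> Arr C \<Longrightarrow> Dom C f \<in> Obj C"
    and Cod_Obj: "f \<in> Arr C \<Longrightarrow> Cod C f \<in> Obj C"
    and Ident_Hom: "X \<in> Obj C \<Longrightarrow> Ident C X \<in> Hom C X X"
    and Comp_Hom: "\<lbrakk>f \<in> Hom C X Y; g \<in> Hom C Y Z\<rbrakk> \<Longrightarrow> g \<cdot> f \<in> Hom C X Z"
    and Comp_Ident: "f \<in> Hom C X Y \<Longrightarrow> f \<cdot> Ident C X = f"
    and Ident_Comp: "f \<in> Hom C X Y \<Longrightarrow> Ident C Y \<cdot> f = f"
    and Comp_assoc: "\<lbrakk>f \<in> Hom C W X; g \<in> Hom C X Y; h \<in> Hom C Y Z\<rbrakk>
      \<Longrightarrow> (h \<cdot> g) \<cdot> f = h \<cdot> (g \<cdot> f)"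

definition op_cat :: "('o, 'm, 'z) cat_scheme \<Rightarrow> ('o, 'm) cat" where
  "op_cat C = \<lparr>Obj = Obj C, Arr = Arr C, Dom = Cod C, Cod = Dom C, Ident = Ident C,
     Comp = (\<lambda>g f. f \<cdot>\<^bsub>C\<^esub> g)\<rparr>"

definition locally_small :: "'u itself \<Rightarrow> ('o, 'm, 'z) cat_scheme \<Rightarrow> bool" where
  "locally_small U C \<longleftrightarrow> (\<forall>X\<in>Obj C. \<forall>Y\<in>Obj C. small U (Hom C X Y))"

definition inverse_arrows :: "('o, 'm, 'z) cat_scheme \<Rightarrow> 'm \<Rightarrow> 'm \<Rightarrow> bool" where
  "inverse_arrows C f g \<longleftrightarrow> f \<in> Arr C \<and> g \<in> Hom C (Cod C f) (Dom C f) \<and>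
     g \<cdot>\<^bsub>C\<^esub> f = Ident C (Dom C f) \<and> f \<cdot>\<^bsub>C\<^esub> g = Ident C (Cod C f)"

definition iso_arrow :: "('o, 'm, 'z) cat_scheme \<Rightarrow> 'm \<Rightarrow> bool" where
  "iso_arrow C f \<longleftrightarrow> (\<exists>g. inverse_arrows C f g)"

definition inv_arrow :: "('o, 'm, 'z) cat_scheme \<Rightarrow> 'm \<Rightarrow> 'm" where
  "inv_arrow C f = (THE g. inverse_arrows C f g)"

definition mono_arrow :: "('o, 'm, 'z) cat_scheme \<Rightarrow> 'm \<Rightarrow> bool" where
  "mono_arrow C f \<longleftrightarrow> f \<in> Arr C \<and>
     (\<forall>W\<in>Obj C. \<forall>g\<in>Hom C W (Dom C f). \<forall>h\<in>Hom C W (Dom C f).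
        f \<cdot>\<^bsub>C\<^esub> g = f \<cdot>\<^bsub>C\<^esub> h \<longrightarrow> g = h)"

definition epi_arrow :: "('o, 'm, 'z) cat_scheme \<Rightarrow> 'm \<Rightarrow> bool" where
  "epi_arrow C f \<longleftrightarrow> mono_arrow (op_cat C) f"


section \<open>Limits and colimits\<close>

definition diagram ::
  "('j, 'k, 'y) cat_scheme \<Rightarrow> ('o, 'm, 'z) cat_scheme \<Rightarrow> ('j \<Rightarrow> 'o) \<Rightarrow> ('k \<Rightarrow> 'm) \<Rightarrow> bool" where
  "diagram J C Do Da \<longleftrightarrow>
     (\<forall>j\<in>Obj J. Do j \<in> Obj C) \<and>
     (\<forall>u\<in>Arr J. Da u \<in> Hom C (Do (Dom J u)) (Do (Cod J u))) \<and>
     (\<forall>j\<in>Obj J. Da (Ident J j) = Ident C (Do j)) \<and>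
     (\<forall>u\<in>Arr J. \<forall>v\<in>Arr J. Cod J u = Dom J v \<longrightarrow> Da (v \<cdot>\<^bsub>J\<^esub> u) = Da v \<cdot>\<^bsub>C\<^esub> Da u)"

definition is_cone ::
  "('j, 'k, 'y) cat_scheme \<Rightarrow> ('o, 'm, 'z) cat_scheme \<Rightarrow> ('j \<Rightarrow> 'o) \<Rightarrow> ('k \<Rightarrow> 'm) \<Rightarrow>
   'o \<Rightarrow> ('j \<Rightarrow> 'm) \<Rightarrow> bool" where
  "is_cone J C Do Da L p \<longleftrightarrow> L \<in> Obj C \<and>
     (\<forall>j\<in>Obj J. p j \<in> Hom C L (Do j)) \<and>
     (\<forall>u\<in>Arr J. Da u \<cdot>\<^bsub>C\<^esub> p (Dom J u) = p (Cod J u))"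

definition is_limit ::
  "('j, 'k, 'y) cat_scheme \<Rightarrow> ('o, 'm, 'z) cat_scheme \<Rightarrow> ('j \<Rightarrow> 'o) \<Rightarrow> ('k \<Rightarrow> 'm) \<Rightarrow>
   'o \<Rightarrow> ('j \<Rightarrow> 'm) \<Rightarrow> bool" where
  "is_limit J C Do Da L p \<longleftrightarrow> is_cone J C Do Da L p \<and>
     (\<forall>W q. is_cone J C Do Da W q \<longrightarrow>
        (\<exists>!h. h \<in> Hom C W L \<and> (\<forall>j\<in>Obj J. p j \<cdot>\<^bsub>C\<^esub> h = q j)))"

definition complete :: "'u itself \<Rightarrow> ('o, 'm, 'z) cat_scheme \<Rightarrow> bool" where
  "complete U C \<longleftrightarrow>
     (\<forall>(J :: ('u, 'u) cat) Do Da.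
        category J \<and> small U (Obj J) \<and> small U (Arr J) \<and> diagram J C Do Da \<longrightarrow>
        (\<exists>L p. is_limit J C Do Da L p))"

definition cocomplete :: "'u itself \<Rightarrow> ('o, 'm, 'z) cat_scheme \<Rightarrow> bool" where
  "cocomplete U C \<longleftrightarrow> complete U (op_cat C)"

definition is_product ::
  "('o, 'm, 'z) cat_scheme \<Rightarrow> 'i set \<Rightarrow> ('i \<Rightarrow> 'o) \<Rightarrow> 'o \<Rightarrow> ('i \<Rightarrow> 'm) \<Rightarrow> bool" where
  "is_product C I X P p \<longleftrightarrow> P \<in> Obj C \<and> (\<forall>i\<in>I. p i \<in> Hom C P (X i)) \<and>
     (\<forall>W\<in>Obj C. \<forall>q. (\<forall>i\<in>I. q i \<in> Hom C W (X i)) \<longrightarrow>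
        (\<exists>!h. h \<in> Hom C W P \<and> (\<forall>i\<in>I. p i \<cdot>\<^bsub>C\<^esub> h = q i)))"

definition is_coproduct ::
  "('o, 'm, 'z) cat_scheme \<Rightarrow> 'i set \<Rightarrow> ('i \<Rightarrow> 'o) \<Rightarrow> 'o \<Rightarrow> ('i \<Rightarrow> 'm) \<Rightarrow> bool" where
  "is_coproduct C = is_product (op_cat C)"


section \<open>Abelian categories\<close>

definition zero_object :: "('o, 'm, 'z) cat_scheme \<Rightarrow> 'o \<Rightarrow> bool" where
  "zero_object C Z \<longleftrightarrow> Z \<in> Obj C \<and>
     (\<forall>X\<in>Obj C. (\<exists>!f. f \<in> Hom C X Z) \<and> (\<exists>!f. f \<in> Hom C Z X))"

definition zero_arrow :: "('o, 'm, 'z) cat_scheme \<Rightarrow> 'm \<Rightarrow> bool" where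
  "zero_arrow C f \<longleftrightarrow> f \<in> Arr C \<and>
     (\<exists>Z g h. zero_object C Z \<and> g \<in> Hom C (Dom C f) Z \<and> h \<in> Hom C Z (Cod C f) \<and>
        f = h \<cdot>\<^bsub>C\<^esub> g)"

definition is_kernel :: "('o, 'm, 'z) cat_scheme \<Rightarrow> 'm \<Rightarrow> 'm \<Rightarrow> bool" where
  "is_kernel C k f \<longleftrightarrow> f \<in> Arr C \<and> k \<in> Arr C \<and> Cod C k = Dom C f \<and>
     zero_arrow C (f \<cdot>\<^bsub>C\<^esub> k) \<and>
     (\<forall>W\<in>Obj C. \<forall>h\<in>Hom C W (Dom C f). zero_arrow C (f \<cdot>\<^bsub>C\<^esub> h) \<longrightarrow>
        (\<exists>!g. g \<in> Hom C W (Dom C k) \<and> k \<cdot>\<^bsub>C\<^esub> g = h))"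

definition is_cokernel :: "('o, 'm, 'z) cat_scheme \<Rightarrow> 'm \<Rightarrow> 'm \<Rightarrow> bool" where
  "is_cokernel C = is_kernel (op_cat C)"

text \<open>Only existence of the additive structure is asserted: in the presence of a zero object and
  binary products it is unique.\<close>

definition preadditive :: "('o, 'm, 'z) cat_scheme \<Rightarrow> bool" where
  "preadditive C \<longleftrightarrow> (\<exists>(plus :: 'm \<Rightarrow> 'm \<Rightarrow> 'm) (zero :: 'o \<Rightarrow> 'o \<Rightarrow> 'm).
     (\<forall>X\<in>Obj C. \<forall>Y\<in>Obj C.
        comm_group \<lparr>carrier = Hom C X Y, monoid.mult = plus, one = zero X Y\<rparr>) \<and>
     (\<forall>X\<in>Obj C. \<forall>Y\<in>Obj C. \<forall>Z\<in>Obj C. \<forall>f\<in>Hom C X Y. \<forall>g\<in>Hom C Y Z.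
        (\<forall>f'\<in>Hom C X Y. g \<cdot>\<^bsub>C\<^esub> plus f f' = plus (g \<cdot>\<^bsub>C\<^esub> f) (g \<cdot>\<^bsub>C\<^esub> f')) \<and>
        (\<forall>g'\<in>Hom C Y Z. plus g g' \<cdot>\<^bsub>C\<^esub> f = plus (g \<cdot>\<^bsub>C\<^esub> f) (g' \<cdot>\<^bsub>C\<^esub> f))))"

locale abelian_category = category +
  assumes preadditive: "preadditive C"
    and ex_zero_object: "\<exists>Z. zero_object C Z"
    and ex_binary_product: "\<lbrakk>X \<in> Obj C; Y \<in> Obj C\<rbrakk>
      \<Longrightarrow> \<exists>P p. is_product C (UNIV :: bool set) (case_bool X Y) P p"
    and ex_kernel: "f \<in> Arr C \<Longrightarrow> \<exists>k. is_kernel C k f"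
    and ex_cokernel: "f \<in> Arr C \<Longrightarrow> \<exists>q. is_cokernel C q f"
    and mono_normal: "mono_arrow C f \<Longrightarrow> \<exists>g. is_kernel C f g"
    and epi_normal: "epi_arrow C f \<Longrightarrow> \<exists>g. is_cokernel C f g"

definition short_exact :: "('o, 'm, 'z) cat_scheme \<Rightarrow> 'm \<Rightarrow> 'm \<Rightarrow> bool" where
  "short_exact C f g \<longleftrightarrow> is_kernel C f g \<and> is_cokernel C g f"

definition AB4 :: "'u itself \<Rightarrow> ('o, 'm, 'z) cat_scheme \<Rightarrow> bool" where
  "AB4 U C \<longleftrightarrow>
     (\<forall>(I :: 'u set) X. small U I \<and> (\<forall>i\<in>I. X i \<in> Obj C) \<longrightarrow> (\<exists>P \<iota>. is_coproduct C I X P \<iota>)) \<and>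
     (\<forall>(I :: 'u set) X Y Z f g PX \<iota>X PY \<iota>Y PZ \<iota>Z f' g'.
        small U I \<and>
        (\<forall>i\<in>I. f i \<in> Hom C (X i) (Y i) \<and> g i \<in> Hom C (Y i) (Z i) \<and> short_exact C (f i) (g i)) \<and>
        is_coproduct C I X PX \<iota>X \<and> is_coproduct C I Y PY \<iota>Y \<and> is_coproduct C I Z PZ \<iota>Z \<and>
        f' \<in> Hom C PX PY \<and> (\<forall>i\<in>I. f' \<cdot>\<^bsub>C\<^esub> \<iota>X i = \<iota>Y i \<cdot>\<^bsub>C\<^esub> f i) \<and>
        g' \<in> Hom C PY PZ \<and> (\<forall>i\<in>I. g' \<cdot>\<^bsub>C\<^esub> \<iota>Y i = \<iota>Z i \<cdot>\<^bsub>C\<^esub> g i) \<longrightarrow>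
        short_exact C f' g')"

definition AB4_star :: "'u itself \<Rightarrow> ('o, 'm, 'z) cat_scheme \<Rightarrow> bool" where
  "AB4_star U C \<longleftrightarrow>
     (\<forall>(I :: 'u set) X. small U I \<and> (\<forall>i\<in>I. X i \<in> Obj C) \<longrightarrow> (\<exists>P p. is_product C I X P p)) \<and>
     (\<forall>(I :: 'u set) X Y Z f g PX pX PY pY PZ pZ f' g'.
        small U I \<and>
        (\<forall>i\<in>I. f i \<in> Hom C (X i) (Y i) \<and> g i \<in> Hom C (Y i) (Z i) \<and> short_exact C (f i) (g i)) \<and>
        is_product C I X PX pX \<and> is_product C I Y PY pY \<and> is_product C I Z PZ pZ \<and>
        f' \<in> Hom C PX PY \<and> (\<forall>i\<in>I. pY i \<cdot>\<^bsub>C\<^esub> f' = f i \<cdot>\<^bsub>C\<^esub> pX i) \<and>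
        g' \<in> Hom C PY PZ \<and> (\<forall>i\<in>I. pZ i \<cdot>\<^bsub>C\<^esub> g' = g i \<cdot>\<^bsub>C\<^esub> pY i) \<longrightarrow>
        short_exact C f' g')"


section \<open>Symmetric closed monoidal categories\<close>

text \<open>
  Types of the structure maps:
  \<open>Assoc X Y Z : (X \<otimes> Y) \<otimes> Z \<rightarrow> X \<otimes> (Y \<otimes> Z)\<close>,
  \<open>LUnit X : I \<otimes> X \<rightarrow> X\<close>, \<open>RUnit X : X \<otimes> I \<rightarrow> X\<close>, \<open>Braid X Y : X \<otimes> Y \<rightarrow> Y \<otimes> X\<close>;
  \<open>IHom X Y\<close> is the inner hom \<open>[X, Y]\<close>, and \<open>Ev X Y : [X, Y] \<otimes> X \<rightarrow> Y\<close> is the counit of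
  the adjunction between \<open>- \<otimes> X\<close> and \<open>[X, -]\<close>.
\<close>

record ('o, 'm) moncat = "('o, 'm) cat" +
  TensorO :: "'o \<Rightarrow> 'o \<Rightarrow> 'o" (infixr "\<otimes>\<index>" 70)
  TensorA :: "'m \<Rightarrow> 'm \<Rightarrow> 'm" (infixr "\<boxtimes>\<index>" 75)
  UnitO :: "'o"
  Assoc :: "'o \<Rightarrow> 'o \<Rightarrow> 'o \<Rightarrow> 'm"
  LUnit :: "'o \<Rightarrow> 'm"
  RUnit :: "'o \<Rightarrow> 'm"
  Braid :: "'o \<Rightarrow> 'o \<Rightarrow> 'm"
  IHom :: "'o \<Rightarrow> 'o \<Rightarrow> 'o"
  Ev :: "'o \<Rightarrow> 'o \<Rightarrow> 'm"

locale monoidal_category = category A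
  for A :: "('o, 'm, 'z) moncat_scheme" (structure) +
  assumes UnitO_Obj: "UnitO A \<in> Obj A"
    and TensorO_Obj: "\<lbrakk>X \<in> Obj A; Y \<in> Obj A\<rbrakk> \<Longrightarrow> X \<otimes> Y \<in> Obj A"
    and TensorA_Hom: "\<lbrakk>f \<in> Hom A X X'; g \<in> Hom A Y Y'\<rbrakk>
      \<Longrightarrow> f \<boxtimes> g \<in> Hom A (X \<otimes> Y) (X' \<otimes> Y')"
    and TensorA_Ident: "\<lbrakk>X \<in> Obj A; Y \<in> Obj A\<rbrakk>
      \<Longrightarrow> Ident A X \<boxtimes> Ident A Y = Ident A (X \<otimes> Y)"
    and TensorA_Comp: "\<lbrakk>f \<in> Hom A X X'; f' \<in> Hom A X' X''; g \<in> Hom A Y Y'; g' \<in> Hom A Y' Y''\<rbrakk>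
      \<Longrightarrow> (f' \<cdot> f) \<boxtimes> (g' \<cdot> g) = (f' \<boxtimes> g') \<cdot> (f \<boxtimes> g)"
    and Assoc_Hom: "\<lbrakk>X \<in> Obj A; Y \<in> Obj A; Z \<in> Obj A\<rbrakk>
      \<Longrightarrow> Assoc A X Y Z \<in> Hom A ((X \<otimes> Y) \<otimes> Z) (X \<otimes> (Y \<otimes> Z))"
    and Assoc_iso: "\<lbrakk>X \<in> Obj A; Y \<in> Obj A; Z \<in> Obj A\<rbrakk> \<Longrightarrow> iso_arrow A (Assoc A X Y Z)"
    and Assoc_natural: "\<lbrakk>f \<in> Hom A X X'; g \<in> Hom A Y Y'; h \<in> Hom A Z Z'\<rbrakk>
      \<Longrightarrow> Assoc A X' Y' Z' \<cdot> ((f \<boxtimes> g) \<boxtimes> h) = (f \<boxtimes> (g \<boxtimes> h)) \<cdot> Assoc A X Y Z"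
    and LUnit_Hom: "X \<in> Obj A \<Longrightarrow> LUnit A X \<in> Hom A (UnitO A \<otimes> X) X"
    and LUnit_iso: "X \<in> Obj A \<Longrightarrow> iso_arrow A (LUnit A X)"
    and LUnit_natural: "f \<in> Hom A X X'
      \<Longrightarrow> LUnit A X' \<cdot> (Ident A (UnitO A) \<boxtimes> f) = f \<cdot> LUnit A X"
    and RUnit_Hom: "X \<in> Obj A \<Longrightarrow> RUnit A X \<in> Hom A (X \<otimes> UnitO A) X"
    and RUnit_iso: "X \<in> Obj A \<Longrightarrow> iso_arrow A (RUnit A X)"
    and RUnit_natural: "f \<in> Hom A X X'
      \<Longrightarrow> RUnit A X' \<cdot> (f \<boxtimes> Ident A (UnitO A)) = f \<cdot> RUnit A X"
    and pentagon: "\<lbrakk>W \<in> Obj A; X \<in> Obj A; Y \<in> Obj A; Z \<in> Obj A\<rbrakk>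
      \<Longrightarrow> (Ident A W \<boxtimes> Assoc A X Y Z) \<cdot> Assoc A W (X \<otimes> Y) Z \<cdot> (Assoc A W X Y \<boxtimes> Ident A Z)
          = Assoc A W X (Y \<otimes> Z) \<cdot> Assoc A (W \<otimes> X) Y Z"
    and triangle: "\<lbrakk>X \<in> Obj A; Y \<in> Obj A\<rbrakk>
      \<Longrightarrow> (Ident A X \<boxtimes> LUnit A Y) \<cdot> Assoc A X (UnitO A) Y = RUnit A X \<boxtimes> Ident A Y"

locale symmetric_monoidal_category = monoidal_category +
  assumes Braid_Hom: "\<lbrakk>X \<in> Obj A; Y \<in> Obj A\<rbrakk> \<Longrightarrow> Braid A X Y \<in> Hom A (X \<otimes> Y) (Y \<otimes> X)"
    and Braid_natural: "\<lbrakk>f \<in> Hom A X X'; g \<in> Hom A Y Y'\<rbrakk>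
      \<Longrightarrow> Braid A X' Y' \<cdot> (f \<boxtimes> g) = (g \<boxtimes> f) \<cdot> Braid A X Y"
    and Braid_symmetric: "\<lbrakk>X \<in> Obj A; Y \<in> Obj A\<rbrakk>
      \<Longrightarrow> Braid A Y X \<cdot> Braid A X Y = Ident A (X \<otimes> Y)"
    and hexagon: "\<lbrakk>X \<in> Obj A; Y \<in> Obj A; Z \<in> Obj A\<rbrakk>
      \<Longrightarrow> Assoc A Y Z X \<cdot> Braid A X (Y \<otimes> Z) \<cdot> Assoc A X Y Z
          = (Ident A Y \<boxtimes> Braid A X Z) \<cdot> Assoc A Y X Z \<cdot> (Braid A X Y \<boxtimes> Ident A Z)"

locale symmetric_closed_monoidal_category = symmetric_monoidal_category +
  assumes IHom_Obj: "\<lbrakk>X \<in> Obj A; Y \<in> Obj A\<rbrakk> \<Longrightarrow> IHom A X Y \<in> Obj A"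
    and Ev_Hom: "\<lbrakk>X \<in> Obj A; Y \<in> Obj A\<rbrakk> \<Longrightarrow> Ev A X Y \<in> Hom A (IHom A X Y \<otimes> X) Y"
    and Ev_universal: "\<lbrakk>W \<in> Obj A; X \<in> Obj A; Y \<in> Obj A; f \<in> Hom A (W \<otimes> X) Y\<rbrakk>
      \<Longrightarrow> \<exists>!g. g \<in> Hom A W (IHom A X Y) \<and> Ev A X Y \<cdot> (g \<boxtimes> Ident A X) = f"

definition curry_arrow :: "('o, 'm, 'z) moncat_scheme \<Rightarrow> 'o \<Rightarrow> 'o \<Rightarrow> 'o \<Rightarrow> 'm \<Rightarrow> 'm" where
  "curry_arrow A W X Y f =
     (THE g. g \<in> Hom A W (IHom A X Y) \<and> Ev A X Y \<cdot>\<^bsub>A\<^esub> (g \<boxtimes>\<^bsub>A\<^esub> Ident A X) = f)"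

definition benabou_cosmos :: "'u itself \<Rightarrow> ('o, 'm, 'z) moncat_scheme \<Rightarrow> bool" where
  "benabou_cosmos U A \<longleftrightarrow> symmetric_closed_monoidal_category A \<and>
     locally_small U A \<and> complete U A \<and> cocomplete U A"

definition abelian_benabou_cosmos :: "'u itself \<Rightarrow> ('o, 'm, 'z) moncat_scheme \<Rightarrow> bool" where
  "abelian_benabou_cosmos U A \<longleftrightarrow>
     benabou_cosmos U A \<and> abelian_category A \<and> AB4 U A \<and> AB4_star U A"


section \<open>Enriched categories\<close>

text \<open>\<open>EComp a b c : EHom b c \<otimes> EHom a b \<rightarrow> EHom a c\<close> and \<open>EIdent a : I \<rightarrow> EHom a a\<close>.\<close>

record ('c, 'o, 'm) ecat =
  EObj :: "'c set"
  EHom :: "'c \<Rightarrow> 'c \<Rightarrow> 'o"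
  EComp :: "'c \<Rightarrow> 'c \<Rightarrow> 'c \<Rightarrow> 'm"
  EIdent :: "'c \<Rightarrow> 'm"

locale enriched_category =
  fixes A :: "('o, 'm, 'z) moncat_scheme" (structure)
    and C :: "('c, 'o, 'm, 'y) ecat_scheme"
  assumes EHom_Obj: "\<lbrakk>a \<in> EObj C; b \<in> EObj C\<rbrakk> \<Longrightarrow> EHom C a b \<in> Obj A"
    and EComp_Hom: "\<lbrakk>a \<in> EObj C; b \<in> EObj C; c \<in> EObj C\<rbrakk>
      \<Longrightarrow> EComp C a b c \<in> Hom A (EHom C b c \<otimes> EHom C a b) (EHom C a c)"
    and EIdent_Hom: "a \<in> EObj C \<Longrightarrow> EIdent C a \<in> Hom A (UnitO A) (EHom C a a)"
    and EComp_assoc: "\<lbrakk>a \<in> EObj C; b \<in> EObj C; c \<in> EObj C; d \<in> EObj C\<rbrakk>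
      \<Longrightarrow> EComp C a b d \<cdot> (EComp C b c d \<boxtimes> Ident A (EHom C a b))
          = EComp C a c d \<cdot> (Ident A (EHom C c d) \<boxtimes> EComp C a b c)
            \<cdot> Assoc A (EHom C c d) (EHom C b c) (EHom C a b)"
    and EIdent_EComp: "\<lbrakk>a \<in> EObj C; b \<in> EObj C\<rbrakk>
      \<Longrightarrow> EComp C a b b \<cdot> (EIdent C b \<boxtimes> Ident A (EHom C a b)) = LUnit A (EHom C a b)"
    and EComp_EIdent: "\<lbrakk>a \<in> EObj C; b \<in> EObj C\<rbrakk>
      \<Longrightarrow> EComp C a a b \<cdot> (Ident A (EHom C a b) \<boxtimes> EIdent C a) = RUnit A (EHom C a b)"

definition small_enriched_category ::
  "'u itself \<Rightarrow> ('o, 'm, 'z) moncat_scheme \<Rightarrow> ('c, 'o, 'm, 'y) ecat_scheme \<Rightarrow> bool" where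
  "small_enriched_category U A C \<longleftrightarrow> enriched_category A C \<and> small U (EObj C)"

definition self_enriched :: "('o, 'm, 'z) moncat_scheme \<Rightarrow> ('o, 'o, 'm) ecat" where
  "self_enriched A =
     \<lparr>EObj = Obj A,
      EHom = IHom A,
      EComp = (\<lambda>X Y Z. curry_arrow A (IHom A Y Z \<otimes>\<^bsub>A\<^esub> IHom A X Y) X Z
        (Ev A Y Z \<cdot>\<^bsub>A\<^esub> (Ident A (IHom A Y Z) \<boxtimes>\<^bsub>A\<^esub> Ev A X Y)
          \<cdot>\<^bsub>A\<^esub> Assoc A (IHom A Y Z) (IHom A X Y) X)),
      EIdent = (\<lambda>X. curry_arrow A (UnitO A) X X (LUnit A X))\<rparr>"

record ('c, 'd, 'm) efunctor =
  FObj :: "'c \<Rightarrow> 'd"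
  FHom :: "'c \<Rightarrow> 'c \<Rightarrow> 'm"

text \<open>The last two conjuncts fix the junk values of the underlying HOL functions, so that HOL
  equality of enriched functors is equality on objects and hom-objects of the source.\<close>

definition enriched_functor ::
  "('o, 'm, 'z) moncat_scheme \<Rightarrow> ('c, 'o, 'm, 'y) ecat_scheme \<Rightarrow> ('d, 'o, 'm, 'x) ecat_scheme \<Rightarrow>
   ('c, 'd, 'm) efunctor \<Rightarrow> bool" where
  "enriched_functor A C D F \<longleftrightarrow>
     (\<forall>a\<in>EObj C. FObj F a \<in> EObj D) \<and>
     (\<forall>a\<in>EObj C. \<forall>b\<in>EObj C.
        FHom F a b \<in> Hom A (EHom C a b) (EHom D (FObj F a) (FObj F b))) \<and>
     (\<forall>a\<in>EObj C. \<forall>b\<in>EObj C. \<forall>c\<in>EObj C.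
        FHom F a c \<cdot>\<^bsub>A\<^esub> EComp C a b c
        = EComp D (FObj F a) (FObj F b) (FObj F c) \<cdot>\<^bsub>A\<^esub> (FHom F b c \<boxtimes>\<^bsub>A\<^esub> FHom F a b)) \<and>
     (\<forall>a\<in>EObj C. FHom F a a \<cdot>\<^bsub>A\<^esub> EIdent C a = EIdent D (FObj F a)) \<and>
     FObj F \<in> extensional (EObj C) \<and>
     case_prod (FHom F) \<in> extensional (EObj C \<times> EObj C)"

text \<open>An enriched natural transformation has as its components arrows
  \<open>\<alpha> a : I \<rightarrow> D(T a, S a)\<close> of \<open>A\<close>.\<close>

definition enriched_transformation ::
  "('o, 'm, 'z) moncat_scheme \<Rightarrow> ('c, 'o, 'm, 'y) ecat_scheme \<Rightarrow> ('d, 'o, 'm, 'x) ecat_scheme \<Rightarrow>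
   ('c, 'd, 'm) efunctor \<Rightarrow> ('c, 'd, 'm) efunctor \<Rightarrow> ('c \<Rightarrow> 'm) \<Rightarrow> bool" where
  "enriched_transformation A C D T S \<alpha> \<longleftrightarrow>
     (\<forall>a\<in>EObj C. \<alpha> a \<in> Hom A (UnitO A) (EHom D (FObj T a) (FObj S a))) \<and>
     (\<forall>a\<in>EObj C. \<forall>b\<in>EObj C.
        EComp D (FObj T a) (FObj T b) (FObj S b) \<cdot>\<^bsub>A\<^esub> (\<alpha> b \<boxtimes>\<^bsub>A\<^esub> FHom T a b)
          \<cdot>\<^bsub>A\<^esub> inv_arrow A (LUnit A (EHom C a b))
        = EComp D (FObj T a) (FObj S a) (FObj S b) \<cdot>\<^bsub>A\<^esub> (FHom S a b \<boxtimes>\<^bsub>A\<^esub> \<alpha> a)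
          \<cdot>\<^bsub>A\<^esub> inv_arrow A (RUnit A (EHom C a b))) \<and>
     \<alpha> \<in> extensional (EObj C)"

text \<open>An arrow of the ordinary category of enriched functors is a triple consisting of its domain,
  its codomain and a transformation.\<close>

definition enriched_functor_category ::
  "('o, 'm, 'z) moncat_scheme \<Rightarrow> ('c, 'o, 'm, 'y) ecat_scheme \<Rightarrow> ('d, 'o, 'm, 'x) ecat_scheme \<Rightarrow>
   (('c, 'd, 'm) efunctor,
    ('c, 'd, 'm) efunctor \<times> ('c, 'd, 'm) efunctor \<times> ('c \<Rightarrow> 'm)) cat" where
  "enriched_functor_category A C D =
     \<lparr>Obj = {F. enriched_functor A C D F},
      Arr = {(T, S, \<alpha>). enriched_functor A C D T \<and> enriched_functor A C D S \<and>
        enriched_transformation A C D T S \<alpha>},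
      Dom = (\<lambda>(T, S, \<alpha>). T),
      Cod = (\<lambda>(T, S, \<alpha>). S),
      Ident = (\<lambda>F. (F, F, restrict (\<lambda>a. EIdent D (FObj F a)) (EObj C))),
      Comp = (\<lambda>(S, R, \<beta>) (T, S', \<alpha>). (T, R,
        restrict (\<lambda>a. EComp D (FObj T a) (FObj S a) (FObj R a) \<cdot>\<^bsub>A\<^esub> (\<beta> a \<boxtimes>\<^bsub>A\<^esub> \<alpha> a)
          \<cdot>\<^bsub>A\<^esub> inv_arrow A (LUnit A (UnitO A))) (EObj C)))\<rparr>"

definition Mod_cat ::
  "('o, 'm, 'z) moncat_scheme \<Rightarrow> ('c, 'o, 'm, 'y) ecat_scheme \<Rightarrow>
   (('c, 'o, 'm) efunctor, ('c, 'o, 'm) efunctor \<times> ('c, 'o, 'm) efunctor \<times> ('c \<Rightarrow> 'm)) cat" where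
  "Mod_cat A C = enriched_functor_category A C (self_enriched A)"

end

theory Submission
  imports Defs
begin

text \<open>
  Transposing \<open>C(a, b) \<rightarrow> [T a, T b]\<close> to \<open>C(a, b) \<otimes> T a \<rightarrow> T b\<close> and \<open>I \<rightarrow> [T a, S a]\<close> to
  \<open>T a \<rightarrow> S a\<close> identifies modules with families of objects of \<open>A\<close> carrying an associative and
  unital action of \<open>C\<close>, and natural transformations with equivariant families of arrows. By the
  universal property a limit of the underlying families receives a unique action making the cone
  equivariant, and its axioms hold because the cone is jointly monic. The same works for colimits,
  since \<open>C(a, b) \<otimes> -\<close> is a left adjoint and so preserves colimits and jointly epic families; for
  the same reason it is additive. Thus limits and colimits of modules exist and are computed
  pointwise, and normality of monos and epis, (AB4) and (AB4*) are inherited from \<open>A\<close>.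
\<close>

section \<open>Categories and their opposites\<close>

text \<open>Duality cannot be used from the start. The actions have C(a, b) \<otimes> - in their
  domain, so reversing arrows turns them into coactions, and a module over \<open>A\<close> is not a
  module over \<open>op_cat A\<close>. Liftings of limits and of colimits are therefore proved
  separately (\<open>lift_source\<close>, \<open>lift_sink\<close>). Only their outcome is put into
  the form \<open>pointwise_limits\<close>, which holds for \<open>M\<close> over \<open>A\<close>
  as well as for \<open>op_cat M\<close> over \<open>op_cat A\<close>; from there on cokernels,
  normality of epis and AB4 are the duals of kernels, normality of monos and AB4_star. Another point
  is that kernels and products in \<open>M\<close> are arbitrary, hence known only up to
  isomorphism. Lifts are made to lie strictly over a prescribed pointwise choice, and an arbitrary
  kernel or product is compared with such a lift. Finally, the additive structure of
  \<open>A\<close> is only known to exist, and bilinearity of the tensor product is not among the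
  axioms of a cosmos; that C(a, b) \<otimes> - respects sums has to be extracted from the behaviour
  of biproduct injections under a left adjoint.\<close>

lemma HomI: "\<lbrakk>f \<in> Arr C; Dom C f = X; Cod C f = Y\<rbrakk> \<Longrightarrow> f \<in> Hom C X Y"
  by (simp add: Hom_def)

lemma HomD:
  assumes "f \<in> Hom C X Y"
  shows "f \<in> Arr C" "Dom C f = X" "Cod C f = Y"
  using assms by (simp_all add: Hom_def)

lemma Hom_self: "f \<in> Arr C \<Longrightarrow> f \<in> Hom C (Dom C f) (Cod C f)"
  by (simp add: Hom_def)

lemma op_cat_simps [simp]:
  "Obj (op_cat C) = Obj C"
  "Arr (op_cat C) = Arr C"
  "Dom (op_cat C) = Cod C"
  "Cod (op_cat C) = Dom C"
  "Ident (op_cat C) = Ident C"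
  "g \<cdot>\<^bsub>op_cat C\<^esub> f = f \<cdot>\<^bsub>C\<^esub> g"
  by (simp_all add: op_cat_def)

lemma Hom_op_cat [simp]: "Hom (op_cat C) X Y = Hom C Y X"
  by (auto simp: Hom_def)

lemma zero_object_op [simp]: "zero_object (op_cat C) Z = zero_object C Z"
  by (auto simp: zero_object_def)

lemma zero_arrow_op [simp]: "zero_arrow (op_cat C) f = zero_arrow C f"
  by (auto simp: zero_arrow_def)

lemma is_kernel_op_op [simp]: "is_kernel (op_cat (op_cat C)) = is_kernel C"
  by (intro ext) (simp add: is_kernel_def)

lemma mono_arrow_op_op [simp]: "mono_arrow (op_cat (op_cat C)) f = mono_arrow C f"
  by (simp add: mono_arrow_def)

lemma short_exact_op: "short_exact (op_cat C) g f = short_exact C f g"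
  by (auto simp: short_exact_def is_cokernel_def)

context category
begin

lemma Ident_simps [simp]:
  assumes "X \<in> Obj C"
  shows "Ident C X \<in> Arr C" "Dom C (Ident C X) = X" "Cod C (Ident C X) = X"
  using Ident_Hom[OF assms] by (simp_all add: Hom_def)

lemma Dom_Cod_Obj [simp]:
  assumes "f \<in> Arr C"
  shows "Dom C f \<in> Obj C" "Cod C f \<in> Obj C"
  using assms Dom_Obj Cod_Obj by auto

lemma Comp_simps [simp]:
  assumes "f \<in> Arr C" "g \<in> Arr C" "Dom C g = Cod C f"
  shows "g \<cdot> f \<in> Arr C" "Dom C (g \<cdot> f) = Dom C f" "Cod C (g \<cdot> f) = Cod C g"
  using Comp_Hom[of f "Dom C f" "Cod C f" g "Cod C g"] assms by (auto simp: Hom_def)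

lemma Comp_Ident_Arr [simp]: "\<lbrakk>f \<in> Arr C; X = Dom C f\<rbrakk> \<Longrightarrow> f \<cdot> Ident C X = f"
  using Comp_Ident by (simp add: Hom_def)

lemma Ident_Comp_Arr [simp]: "\<lbrakk>f \<in> Arr C; X = Cod C f\<rbrakk> \<Longrightarrow> Ident C X \<cdot> f = f"
  using Ident_Comp by (simp add: Hom_def)

lemma Comp_assoc_Arr:
  "\<lbrakk>f \<in> Arr C; g \<in> Arr C; h \<in> Arr C; Dom C g = Cod C f; Dom C h = Cod C g\<rbrakk>
    \<Longrightarrow> (h \<cdot> g) \<cdot> f = h \<cdot> (g \<cdot> f)"
  by (rule Comp_assoc) (auto intro!: HomI)

lemma Hom_Obj:
  assumes "f \<in> Hom C X Y"
  shows "X \<in> Obj C" "Y \<in> Obj C"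
  using assms by (auto simp: Hom_def)

lemma category_op: "category (op_cat C)"
  by unfold_locales (auto simp: Hom_def Comp_assoc_Arr)

lemma inverse_arrows_simps:
  assumes "inverse_arrows C f g"
  shows "f \<in> Arr C" "g \<in> Arr C" "Dom C g = Cod C f" "Cod C g = Dom C f"
    "g \<cdot> f = Ident C (Dom C f)" "f \<cdot> g = Ident C (Cod C f)"
  using assms by (auto simp: inverse_arrows_def Hom_def)

lemma inverse_arrows_unique:
  assumes "inverse_arrows C f g" "inverse_arrows C f h"
  shows "g = h"
proof -
  note [simp] = inverse_arrows_simps[OF assms(1)] inverse_arrows_simps[OF assms(2)]
  have "g = (h \<cdot> f) \<cdot> g" by simp
  also have "\<dots> = h" by (subst Comp_assoc_Arr) simp_all
  finally show ?thesis .
qed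

text \<open>Only a right inverse \<open>v\<close> of \<open>u\<close> is asked for: a split
  epimorphism is epi. In the proof of Kelly's lemma this saves computing the other
  composite.\<close>

lemma inverse_cancel_right:
  assumes "u \<in> Arr C" "v \<in> Arr C" "Cod C v = Dom C u" "u \<cdot> v = Ident C (Cod C u)"
    and "f \<in> Arr C" "g \<in> Arr C" "Dom C f = Cod C u" "Dom C g = Cod C u" "f \<cdot> u = g \<cdot> u"
  shows "f = g"
proof -
  have "f = (f \<cdot> u) \<cdot> v" using assms(1-8) Comp_assoc_Arr[of v u f] by simp
  also have "\<dots> = g" using assms Comp_assoc_Arr[of v u g] by simp
  finally show ?thesis .
qed

lemma inv_arrow_inverse: "iso_arrow C f \<Longrightarrow> inverse_arrows C f (inv_arrow C f)"
  unfolding iso_arrow_def inv_arrow_def using inverse_arrows_unique by (metis theI)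

section \<open>Monomorphisms, zero arrows and kernels\<close>

lemma mono_arrowD:
  assumes "mono_arrow C f" "g \<in> Hom C W (Dom C f)" "h \<in> Hom C W (Dom C f)" "f \<cdot> g = f \<cdot> h"
  shows "g = h"
  using assms Hom_Obj unfolding mono_arrow_def by blast

lemma is_kernel_factor:
  assumes "is_kernel C k f" "h \<in> Hom C W (Dom C f)" "zero_arrow C (f \<cdot> h)"
  obtains g where "g \<in> Hom C W (Dom C k)" "k \<cdot> g = h"
  using assms Hom_Obj[OF assms(2)] unfolding is_kernel_def by blast

lemma zero_arrowI:
  assumes "zero_object C Z" "u \<in> Hom C X Z" "v \<in> Hom C Z Y"
  shows "zero_arrow C (v \<cdot> u)"
  using assms Comp_Hom[OF assms(2,3)] by (auto simp: zero_arrow_def Hom_def)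

lemma zero_arrowE:
  assumes "zero_arrow C f" "f \<in> Hom C X Y"
  obtains Z u v where "zero_object C Z" "u \<in> Hom C X Z" "v \<in> Hom C Z Y" "f = v \<cdot> u"
  using assms unfolding zero_arrow_def by (auto simp: Hom_def)

lemma zero_arrow_comp_right:
  assumes "zero_arrow C f" "g \<in> Arr C" "Dom C f = Cod C g"
  shows "zero_arrow C (f \<cdot> g)"
proof -
  have "f \<in> Hom C (Cod C g) (Cod C f)"
    using assms by (auto simp: zero_arrow_def Hom_def)
  then obtain Z u v where Z: "zero_object C Z" "u \<in> Hom C (Cod C g) Z"
    "v \<in> Hom C Z (Cod C f)" "f = v \<cdot> u"
    using zero_arrowE[OF assms(1)] by blast
  have "f \<cdot> g = v \<cdot> (u \<cdot> g)"
    unfolding Z(4) by (rule Comp_assoc[OF Hom_self[OF assms(2)] Z(2,3)])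
  then show ?thesis using zero_arrowI[OF Z(1) Comp_Hom[OF Hom_self[OF assms(2)] Z(2)] Z(3)] by simp
qed

text \<open>Both \<open>g\<close> and \<open>h\<close> factor the arrow \<open>k \<cdot> g\<close>
  through the kernel, so the uniqueness in the universal property identifies them.\<close>

lemma mono_kernel:
  assumes "is_kernel C k f"
  shows "mono_arrow C k"
  unfolding mono_arrow_def
proof (intro conjI ballI impI)
  have k: "k \<in> Arr C" "f \<in> Arr C" "Cod C k = Dom C f" "zero_arrow C (f \<cdot> k)"
    using assms by (auto simp: is_kernel_def)
  then show "k \<in> Arr C" by simp
  fix W g h assume W: "W \<in> Obj C" "g \<in> Hom C W (Dom C k)" "h \<in> Hom C W (Dom C k)" "k \<cdot> g = k \<cdot> h"
  have "f \<cdot> k \<cdot> g = (f \<cdot> k) \<cdot> g"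
    using W k by (simp add: Hom_def Comp_assoc_Arr)
  then have "zero_arrow C (f \<cdot> k \<cdot> g)"
    using zero_arrow_comp_right[OF k(4), of g] k W by (simp add: Hom_def)
  moreover have "k \<cdot> g \<in> Hom C W (Dom C f)" using W k by (simp add: Hom_def)
  ultimately have "\<exists>!x. x \<in> Hom C W (Dom C k) \<and> k \<cdot> x = k \<cdot> g"
    using assms W(1) unfolding is_kernel_def by blast
  then show "g = h" using W by metis
qed

lemma is_kernelI:
  assumes "f \<in> Arr C" "mono_arrow C k" "Cod C k = Dom C f" "zero_arrow C (f \<cdot> k)"
    and "\<And>W h. \<lbrakk>W \<in> Obj C; h \<in> Hom C W (Dom C f); zero_arrow C (f \<cdot> h)\<rbrakk>
      \<Longrightarrow> \<exists>g. g \<in> Hom C W (Dom C k) \<and> k \<cdot> g = h"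
  shows "is_kernel C k f"
  unfolding is_kernel_def
proof (intro conjI ballI impI)
  fix W h assume "W \<in> Obj C" "h \<in> Hom C W (Dom C f)" "zero_arrow C (f \<cdot> h)"
  with assms(5) obtain g where "g \<in> Hom C W (Dom C k) \<and> k \<cdot> g = h" by blast
  then show "\<exists>!g. g \<in> Hom C W (Dom C k) \<and> k \<cdot> g = h"
    using mono_arrowD[OF assms(2)] by (intro ex1I[of _ g]) auto
qed (use assms in \<open>auto simp: mono_arrow_def\<close>)

lemma mono_inverse: "inverse_arrows C u v \<Longrightarrow> mono_arrow C u"
  unfolding mono_arrow_def
  by (auto simp: inverse_arrows_def Hom_def) (metis Comp_assoc_Arr Ident_Comp_Arr)

lemma mono_comp:
  assumes "mono_arrow C f" "mono_arrow C g" "Dom C f = Cod C g"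
  shows "mono_arrow C (f \<cdot> g)"
proof -
  have 1: "f \<in> Arr C" "g \<in> Arr C" using assms by (auto simp: mono_arrow_def)
  show ?thesis unfolding mono_arrow_def
  proof (intro conjI ballI impI)
    fix W x y assume "x \<in> Hom C W (Dom C (f \<cdot> g))" "y \<in> Hom C W (Dom C (f \<cdot> g))"
      "(f \<cdot> g) \<cdot> x = (f \<cdot> g) \<cdot> y"
    then have "x \<in> Hom C W (Dom C g)" "y \<in> Hom C W (Dom C g)" "f \<cdot> g \<cdot> x = f \<cdot> g \<cdot> y"
      "g \<cdot> x \<in> Hom C W (Dom C f)" "g \<cdot> y \<in> Hom C W (Dom C f)"
      using 1 assms(3) by (auto simp: Hom_def Comp_assoc_Arr)
    then show "x = y" using mono_arrowD assms by metis
  qed (use 1 assms in auto)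
qed

lemma kernel_unique:
  assumes "is_kernel C k f" "is_kernel C l f"
  obtains u v where "inverse_arrows C u v" "u \<in> Hom C (Dom C k) (Dom C l)" "l \<cdot> u = k"
proof -
  have k: "f \<in> Arr C" "k \<in> Arr C" "Cod C k = Dom C f" "zero_arrow C (f \<cdot> k)"
    and l: "l \<in> Arr C" "Cod C l = Dom C f" "zero_arrow C (f \<cdot> l)"
    using assms by (auto simp: is_kernel_def)
  obtain u where u: "u \<in> Hom C (Dom C k) (Dom C l)" "l \<cdot> u = k"
    using is_kernel_factor[OF assms(2), of k "Dom C k"] k by (auto simp: Hom_def)
  obtain v where v: "v \<in> Hom C (Dom C l) (Dom C k)" "k \<cdot> v = l"
    using is_kernel_factor[OF assms(1), of l "Dom C l"] l by (auto simp: Hom_def)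
  have 1: "k \<cdot> (v \<cdot> u) = k" "l \<cdot> (u \<cdot> v) = l"
    using k l u v by (auto simp: Hom_def Comp_assoc_Arr[symmetric])
  have "v \<cdot> u = Ident C (Dom C k)"
    by (rule mono_arrowD[OF mono_kernel[OF assms(1)], of _ "Dom C k"]) (use k l u v 1 in \<open>auto simp: Hom_def\<close>)
  moreover have "u \<cdot> v = Ident C (Dom C l)"
    by (rule mono_arrowD[OF mono_kernel[OF assms(2)], of _ "Dom C l"]) (use k l u v 1 in \<open>auto simp: Hom_def\<close>)
  ultimately have "inverse_arrows C u v" using u v by (auto simp: inverse_arrows_def Hom_def)
  then show ?thesis using that u by blast
qed

text \<open>Together with \<open>kernel_unique\<close> this turns a property of one well-chosen
  kernel into a property of all kernels: a lifted kernel is pointwise by construction, and an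
  arbitrary one differs from it by an isomorphism.\<close>

lemma kernel_transfer:
  assumes "is_kernel C l f" "inverse_arrows C u v" "u \<in> Hom C K (Dom C l)"
  shows "is_kernel C (l \<cdot> u) f"
proof -
  note iu = inverse_arrows_simps[OF assms(2)]
  have l: "f \<in> Arr C" "l \<in> Arr C" "Cod C l = Dom C f" "zero_arrow C (f \<cdot> l)"
    using assms by (auto simp: is_kernel_def)
  show ?thesis
  proof (rule is_kernelI)
    show "mono_arrow C (l \<cdot> u)"
      using mono_comp mono_kernel[OF assms(1)] mono_inverse[OF assms(2)] assms(3) by (auto simp: Hom_def)
    have "f \<cdot> l \<cdot> u = (f \<cdot> l) \<cdot> u" using l iu assms by (auto simp: Hom_def Comp_assoc_Arr)
    then show "zero_arrow C (f \<cdot> l \<cdot> u)"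
      using zero_arrow_comp_right[OF l(4), of u] assms iu l by (auto simp: Hom_def)
    fix W h assume W: "W \<in> Obj C" "h \<in> Hom C W (Dom C f)" "zero_arrow C (f \<cdot> h)"
    obtain g where g: "g \<in> Hom C W (Dom C l)" "l \<cdot> g = h" using is_kernel_factor[OF assms(1) W(2,3)] .
    have "(l \<cdot> u) \<cdot> (v \<cdot> g) = l \<cdot> (u \<cdot> v) \<cdot> g"
      using l iu(1-4) g assms by (auto simp: Hom_def Comp_assoc_Arr)
    also have "\<dots> = h" using g iu assms by (auto simp: Hom_def)
    finally show "\<exists>g. g \<in> Hom C W (Dom C (l \<cdot> u)) \<and> (l \<cdot> u) \<cdot> g = h"
      using l iu g assms by (intro exI[of _ "v \<cdot> g"]) (auto simp: Hom_def)
  qed (use l iu assms in \<open>auto simp: Hom_def\<close>)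
qed

section \<open>Products and their comparison isomorphisms\<close>

lemma is_productD:
  assumes "is_product C I X P p"
  shows "P \<in> Obj C" "\<And>i. i \<in> I \<Longrightarrow> p i \<in> Hom C P (X i)"
    "\<And>g h W. \<lbrakk>g \<in> Hom C W P; h \<in> Hom C W P; \<And>i. i \<in> I \<Longrightarrow> p i \<cdot> g = p i \<cdot> h\<rbrakk> \<Longrightarrow> g = h"
    "\<And>W q. \<lbrakk>W \<in> Obj C; \<And>i. i \<in> I \<Longrightarrow> q i \<in> Hom C W (X i)\<rbrakk>
      \<Longrightarrow> \<exists>h. h \<in> Hom C W P \<and> (\<forall>i\<in>I. p i \<cdot> h = q i)"
proof -
  show 1: "P \<in> Obj C" "\<And>i. i \<in> I \<Longrightarrow> p i \<in> Hom C P (X i)"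
    using assms by (auto simp: is_product_def)
  have 2: "\<exists>!h. h \<in> Hom C W P \<and> (\<forall>i\<in>I. p i \<cdot> h = q i)"
    if "W \<in> Obj C" "\<And>i. i \<in> I \<Longrightarrow> q i \<in> Hom C W (X i)" for W q
    using assms that by (auto simp: is_product_def)
  then show "\<And>W q. \<lbrakk>W \<in> Obj C; \<And>i. i \<in> I \<Longrightarrow> q i \<in> Hom C W (X i)\<rbrakk>
      \<Longrightarrow> \<exists>h. h \<in> Hom C W P \<and> (\<forall>i\<in>I. p i \<cdot> h = q i)"
    by blast
  fix g h W assume gh: "g \<in> Hom C W P" "h \<in> Hom C W P" "\<And>i. i \<in> I \<Longrightarrow> p i \<cdot> g = p i \<cdot> h"
  have "\<exists>!k. k \<in> Hom C W P \<and> (\<forall>i\<in>I. p i \<cdot> k = p i \<cdot> g)"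
    using gh(1) by (intro 2 Hom_Obj(1)[OF gh(1)] Comp_Hom[OF gh(1) 1(2)])
  with gh show "g = h" by metis
qed

lemma is_productI:
  assumes "P \<in> Obj C" "\<And>i. i \<in> I \<Longrightarrow> p i \<in> Hom C P (X i)"
    "\<And>g h W. \<lbrakk>g \<in> Hom C W P; h \<in> Hom C W P; \<And>i. i \<in> I \<Longrightarrow> p i \<cdot> g = p i \<cdot> h\<rbrakk> \<Longrightarrow> g = h"
    "\<And>W q. \<lbrakk>W \<in> Obj C; \<And>i. i \<in> I \<Longrightarrow> q i \<in> Hom C W (X i)\<rbrakk>
      \<Longrightarrow> \<exists>h. h \<in> Hom C W P \<and> (\<forall>i\<in>I. p i \<cdot> h = q i)"
  shows "is_product C I X P p"
  unfolding is_product_def using assms(1,2)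
proof (intro conjI ballI allI impI)
  fix W q assume "W \<in> Obj C" "\<forall>i\<in>I. q i \<in> Hom C W (X i)"
  with assms(4)[of W q] obtain h where "h \<in> Hom C W P" "\<forall>i\<in>I. p i \<cdot> h = q i" by blast
  then show "\<exists>!h. h \<in> Hom C W P \<and> (\<forall>i\<in>I. p i \<cdot> h = q i)"
    by (intro ex1I[of _ h]) (auto intro: assms(3))
qed

lemma product_unique:
  assumes "is_product C I X P p" "is_product C I X Q q"
  obtains u v where "inverse_arrows C u v" "u \<in> Hom C P Q" "\<And>i. i \<in> I \<Longrightarrow> q i \<cdot> u = p i"
proof -
  note P = is_productD[OF assms(1)] and Q = is_productD[OF assms(2)]
  obtain u where u: "u \<in> Hom C P Q" "\<And>i. i \<in> I \<Longrightarrow> q i \<cdot> u = p i" using Q(4)[of P p] P(1,2) by blast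
  obtain v where v: "v \<in> Hom C Q P" "\<And>i. i \<in> I \<Longrightarrow> p i \<cdot> v = q i" using P(4)[of Q q] Q(1,2) by blast
  have 1: "p i \<cdot> (v \<cdot> u) = p i" "q i \<cdot> (u \<cdot> v) = q i" if "i \<in> I" for i
    using P(2)[OF that] Q(2)[OF that] u v(1) v(2)[OF that] u(2)[OF that]
    by (auto simp: Hom_def Comp_assoc_Arr[symmetric])
  have "v \<cdot> u = Ident C P"
    by (rule P(3)[of _ P]) (use u v P(1) 1 P(2) in \<open>auto simp: Hom_def\<close>)
  moreover have "u \<cdot> v = Ident C Q"
    by (rule Q(3)[of _ Q]) (use u v Q(1) 1 Q(2) in \<open>auto simp: Hom_def\<close>)
  ultimately have "inverse_arrows C u v" using u v by (auto simp: inverse_arrows_def Hom_def)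
  then show ?thesis using that u by blast
qed

lemma product_transfer:
  assumes "is_product C I X Q q" "inverse_arrows C u v" "u \<in> Hom C P Q"
    "\<And>i. i \<in> I \<Longrightarrow> q i \<cdot> u = p i"
  shows "is_product C I X P p"
proof (rule is_productI)
  note Q = is_productD[OF assms(1)]
  note iu = inverse_arrows_simps[OF assms(2)]
  show "P \<in> Obj C" using assms Hom_Obj by auto
  show p: "p i \<in> Hom C P (X i)" if "i \<in> I" for i
    using Comp_Hom[OF assms(3) Q(2)[OF that]] assms(4)[OF that] by simp
  have pv: "p i \<cdot> v = q i" if "i \<in> I" for i
    using assms(4)[OF that, symmetric] iu Q(2)[OF that] assms(3) by (auto simp: Hom_def Comp_assoc_Arr)
  fix W
  {
    fix g h assume gh: "g \<in> Hom C W P" "h \<in> Hom C W P" "\<And>i. i \<in> I \<Longrightarrow> p i \<cdot> g = p i \<cdot> h"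
    have "u \<cdot> g = u \<cdot> h"
    proof (rule Q(3)[of _ W])
      fix i assume i: "i \<in> I"
      have "q i \<cdot> u \<cdot> g = p i \<cdot> g" "q i \<cdot> u \<cdot> h = p i \<cdot> h"
        using assms(4)[OF i, symmetric] gh Q(2)[OF i] assms(3) by (auto simp: Hom_def Comp_assoc_Arr)
      then show "q i \<cdot> u \<cdot> g = q i \<cdot> u \<cdot> h" using gh(3)[OF i] by simp
    qed (use Comp_Hom gh assms in auto)
    then show "g = h" using mono_arrowD[OF mono_inverse[OF assms(2)]] gh assms(3) by (auto simp: Hom_def)
  }
  fix r assume "W \<in> Obj C" "\<And>i. i \<in> I \<Longrightarrow> r i \<in> Hom C W (X i)"
  then obtain h where h: "h \<in> Hom C W Q" "\<And>i. i \<in> I \<Longrightarrow> q i \<cdot> h = r i"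
    using Q(4)[of W r] by blast
  have "p i \<cdot> v \<cdot> h = r i" if "i \<in> I" for i
    using h(2)[OF that] p[OF that] pv[OF that, symmetric] iu(1-4) h(1) assms(3)
    by (auto simp: Hom_def Comp_assoc_Arr)
  then show "\<exists>h. h \<in> Hom C W P \<and> (\<forall>i\<in>I. p i \<cdot> h = r i)"
    using h(1) iu assms(3) by (intro exI[of _ "v \<cdot> h"]) (auto simp: Hom_def)
qed

end

section \<open>Additive structures\<close>

text \<open>One witness of \<open>preadditive\<close> is fixed, together with the existence of a
  zero object: \<open>zero_arrow\<close>, and with it every kernel, is defined by factorization
  through a zero object and has to be matched with the neutral elements.\<close>

locale additive_structure = category +
  fixes plus :: "'b \<Rightarrow> 'b \<Rightarrow> 'b" and zero :: "'a \<Rightarrow> 'a \<Rightarrow> 'b"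
  assumes Hom_group: "\<lbrakk>X \<in> Obj C; Y \<in> Obj C\<rbrakk> \<Longrightarrow>
      comm_group \<lparr>carrier = Hom C X Y, monoid.mult = plus, one = zero X Y\<rparr>"
    and Comp_plus: "\<lbrakk>f \<in> Hom C X Y; f' \<in> Hom C X Y; g \<in> Hom C Y Z\<rbrakk>
      \<Longrightarrow> g \<cdot> plus f f' = plus (g \<cdot> f) (g \<cdot> f')"
    and plus_Comp: "\<lbrakk>f \<in> Hom C X Y; g \<in> Hom C Y Z; g' \<in> Hom C Y Z\<rbrakk>
      \<Longrightarrow> plus g g' \<cdot> f = plus (g \<cdot> f) (g' \<cdot> f)"
    and zero_ex: "\<exists>Z. zero_object C Z"

lemma (in category) preadditive_iff:
  assumes "\<exists>Z. zero_object C Z"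
  shows "preadditive C \<longleftrightarrow> (\<exists>plus zero. additive_structure C plus zero)"
proof
  assume "preadditive C"
  then obtain plus zero where
    1: "\<And>X Y. \<lbrakk>X \<in> Obj C; Y \<in> Obj C\<rbrakk> \<Longrightarrow>
        comm_group \<lparr>carrier = Hom C X Y, monoid.mult = plus, one = zero X Y\<rparr>"
    and 2: "\<And>X Y Z f g. \<lbrakk>X \<in> Obj C; Y \<in> Obj C; Z \<in> Obj C; f \<in> Hom C X Y; g \<in> Hom C Y Z\<rbrakk> \<Longrightarrow>
        (\<forall>f'\<in>Hom C X Y. g \<cdot> plus f f' = plus (g \<cdot> f) (g \<cdot> f')) \<and>
        (\<forall>g'\<in>Hom C Y Z. plus g g' \<cdot> f = plus (g \<cdot> f) (g' \<cdot> f))"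
    unfolding preadditive_def by (elim exE conjE) blast
  have "additive_structure C plus zero"
  proof (intro additive_structure.intro category_axioms additive_structure_axioms.intro)
    fix f f' X Y g Z assume f: "f \<in> Hom C X Y" "f' \<in> Hom C X Y" "g \<in> Hom C Y Z"
    show "g \<cdot> plus f f' = plus (g \<cdot> f) (g \<cdot> f')"
      using 2[OF Hom_Obj[OF f(1)] Hom_Obj(2)[OF f(3)] f(1,3)] f(2) by blast
  next
    fix f X Y g Z g' assume f: "f \<in> Hom C X Y" "g \<in> Hom C Y Z" "g' \<in> Hom C Y Z"
    show "plus g g' \<cdot> f = plus (g \<cdot> f) (g' \<cdot> f)"
      using 2[OF Hom_Obj[OF f(1)] Hom_Obj(2)[OF f(2)] f(1,2)] f(3) by blast
  qed (use 1 assms in blast)+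
  then show "\<exists>plus zero. additive_structure C plus zero" by blast
next
  assume "\<exists>plus zero. additive_structure C plus zero"
  then obtain plus zero where "additive_structure C plus zero" by blast
  then interpret additive_structure C plus zero .
  show "preadditive C"
    unfolding preadditive_def
    by (intro exI[of _ plus] exI[of _ zero] conjI ballI Hom_group Comp_plus plus_Comp)
qed

context additive_structure
begin

lemma zero_Hom: "\<lbrakk>X \<in> Obj C; Y \<in> Obj C\<rbrakk> \<Longrightarrow> zero X Y \<in> Hom C X Y"
  using comm_group.axioms(2)[OF Hom_group, THEN group.is_monoid, THEN monoid.one_closed] by fastforce

lemma plus_Hom: "\<lbrakk>f \<in> Hom C X Y; g \<in> Hom C X Y\<rbrakk> \<Longrightarrow> plus f g \<in> Hom C X Y"
  using comm_group.axioms(2)[OF Hom_group[OF Hom_Obj], THEN group.is_monoid, THEN monoid.m_closed]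
  by fastforce

lemma plus_assoc:
  assumes "f \<in> Hom C X Y" "g \<in> Hom C X Y" "h \<in> Hom C X Y"
  shows "plus (plus f g) h = plus f (plus g h)"
  using comm_group.axioms(2)[OF Hom_group[OF Hom_Obj[OF assms(1)]], THEN group.is_monoid,
    THEN monoid.m_assoc, of f g h] assms
  by simp

lemma plus_comm:
  assumes "f \<in> Hom C X Y" "g \<in> Hom C X Y"
  shows "plus f g = plus g f"
  using comm_group.axioms(1)[OF Hom_group[OF Hom_Obj[OF assms(1)]], THEN comm_monoid.m_comm, of f g] assms
  by simp

lemma plus_zero: "f \<in> Hom C X Y \<Longrightarrow> plus f (zero X Y) = f" "f \<in> Hom C X Y \<Longrightarrow> plus (zero X Y) f = f"
  using comm_group.axioms(2)[OF Hom_group[OF Hom_Obj], THEN group.is_monoid, THEN monoid.r_one, of f X Y f X Y]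
   comm_group.axioms(2)[OF Hom_group[OF Hom_Obj], THEN group.is_monoid, THEN monoid.l_one, of f X Y f X Y]
  by auto

lemma neg_ex:
  assumes "f \<in> Hom C X Y"
  obtains g where "g \<in> Hom C X Y" "plus f g = zero X Y"
proof -
  have "group \<lparr>carrier = Hom C X Y, monoid.mult = plus, one = zero X Y\<rparr>"
    using Hom_group[OF Hom_Obj[OF assms]] by (rule comm_group.axioms(2))
  from group.r_inv_ex[OF this, of f] show ?thesis using that assms by auto
qed

lemma plus_cancel:
  assumes "f \<in> Hom C X Y" "g \<in> Hom C X Y" "h \<in> Hom C X Y" "plus f g = plus f h"
  shows "g = h"
proof -
  have "group \<lparr>carrier = Hom C X Y, monoid.mult = plus, one = zero X Y\<rparr>"
    using Hom_group[OF Hom_Obj[OF assms(1)]] by (rule comm_group.axioms(2))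
  from monoid.Units_l_cancel[OF group.is_monoid[OF this], of f g h] group.Units_eq[OF this]
  show ?thesis using assms by auto
qed

text \<open>By bilinearity the composite equals its own double, and the only such element of a group
  is the neutral one.\<close>

lemma Comp_zero:
  assumes "g \<in> Hom C Y Z" "X \<in> Obj C"
  shows "g \<cdot> zero X Y = zero X Z"
proof -
  have Y: "Y \<in> Obj C" "Z \<in> Obj C" using Hom_Obj assms by auto
  have z: "zero X Y \<in> Hom C X Y" using zero_Hom assms Y by simp
  have gz: "g \<cdot> zero X Y \<in> Hom C X Z" using Comp_Hom[OF z assms(1)] .
  have "plus (g \<cdot> zero X Y) (g \<cdot> zero X Y) = g \<cdot> plus (zero X Y) (zero X Y)"
    using Comp_plus[OF z z assms(1)] by simp
  also have "\<dots> = plus (g \<cdot> zero X Y) (zero X Z)" using plus_zero z gz by simp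
  finally show ?thesis using plus_cancel gz zero_Hom assms Y by metis
qed

lemma zero_Comp:
  assumes "g \<in> Hom C X Y" "Z \<in> Obj C"
  shows "zero Y Z \<cdot> g = zero X Z"
proof -
  have Y: "X \<in> Obj C" "Y \<in> Obj C" using Hom_Obj assms by auto
  have z: "zero Y Z \<in> Hom C Y Z" using zero_Hom assms Y by simp
  have gz: "zero Y Z \<cdot> g \<in> Hom C X Z" using Comp_Hom[OF assms(1) z] .
  have "plus (zero Y Z \<cdot> g) (zero Y Z \<cdot> g) = plus (zero Y Z) (zero Y Z) \<cdot> g"
    using plus_Comp[OF assms(1) z z] by simp
  also have "\<dots> = plus (zero Y Z \<cdot> g) (zero X Z)" using plus_zero z gz by simp
  finally show ?thesis using plus_cancel gz zero_Hom assms Y by metis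
qed

lemma zero_arrow_zero: "\<lbrakk>X \<in> Obj C; Y \<in> Obj C\<rbrakk> \<Longrightarrow> zero_arrow C (zero X Y)"
proof -
  assume XY: "X \<in> Obj C" "Y \<in> Obj C"
  obtain Z where Z: "zero_object C Z" using zero_ex by blast
  then have "Z \<in> Obj C" by (simp add: zero_object_def)
  then have "zero X Z \<in> Hom C X Z" "zero Z Y \<in> Hom C Z Y" "zero X Y = zero Z Y \<cdot> zero X Z"
    "zero X Y \<in> Hom C X Y"
    using XY zero_Hom Comp_zero[OF zero_Hom, of Z Y X] by auto
  with Z XY show "zero_arrow C (zero X Y)"
    by (auto simp: zero_arrow_def Hom_def)
qed

text \<open>An arrow into a zero object is unique, hence the neutral element, and
  \<open>Comp_zero\<close> carries this along the second factor. Kernels thereby become accessible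
  to additive computation.\<close>

lemma zero_arrow_iff: "f \<in> Hom C X Y \<Longrightarrow> zero_arrow C f \<longleftrightarrow> f = zero X Y"
proof
  assume f: "f \<in> Hom C X Y" "zero_arrow C f"
  then obtain Z u v where Z: "zero_object C Z" "u \<in> Hom C X Z" "v \<in> Hom C Z Y" "f = v \<cdot> u"
    unfolding zero_arrow_def by (auto simp: Hom_def)
  have "Z \<in> Obj C" "X \<in> Obj C" using Z f Hom_Obj by auto
  then have "u = zero X Z" using Z zero_Hom[of X Z] unfolding zero_object_def by blast
  then show "f = zero X Y" using Z Comp_zero \<open>X \<in> Obj C\<close> by simp
qed (use Hom_Obj zero_arrow_zero in auto)

lemma op: "additive_structure (op_cat C) plus (\<lambda>X Y. zero Y X)"
  unfolding additive_structure_def additive_structure_axioms_def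
  using category_op zero_ex Hom_group Comp_plus plus_Comp by auto

text \<open>The usual passage to the difference of \<open>g\<close> and \<open>h\<close>; negation
  is not an operation of the structure, so a negative \<open>k\<close> of \<open>h\<close> is
  chosen.\<close>

lemma mono_if_zero_cancel:
  assumes "f \<in> Hom C X Y" "\<And>W g. \<lbrakk>g \<in> Hom C W X; f \<cdot> g = zero W Y\<rbrakk> \<Longrightarrow> g = zero W X"
  shows "mono_arrow C f"
  unfolding mono_arrow_def
proof (intro conjI ballI impI)
  show "f \<in> Arr C" using assms by (auto simp: Hom_def)
  fix W g h assume "W \<in> Obj C" and gh: "g \<in> Hom C W (Dom C f)" "h \<in> Hom C W (Dom C f)" "f \<cdot> g = f \<cdot> h"
  have D: "Dom C f = X" using assms by (auto simp: Hom_def)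
  obtain k where k: "k \<in> Hom C W X" "plus h k = zero W X" using neg_ex gh(2) D by metis
  have "f \<cdot> plus g k = plus (f \<cdot> h) (f \<cdot> k)" using Comp_plus[of g W X k f Y] k gh D assms by simp
  also have "\<dots> = f \<cdot> zero W X" using Comp_plus[of h W X k f Y] k gh D assms by simp
  also have "\<dots> = zero W Y" using Comp_zero assms(1) \<open>W \<in> Obj C\<close> by simp
  finally have "plus g k = zero W X" using assms(2)[OF plus_Hom] gh k D by simp
  then have "plus k g = plus k h" using k gh D plus_comm by metis
  then show "g = h" using plus_cancel[of k W X g h] k gh D by simp
qed

end

section \<open>Categories whose limits are computed pointwise\<close>

text \<open>The lift lies over the given products strictly, not up to isomorphism, and does so for
  every choice of them. Thus no comparison isomorphisms have to be carried along at the separate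
  indices.\<close>

definition lifts_products ::
  "('o, 'm, 'z) cat_scheme \<Rightarrow> ('p, 'n, 'y) cat_scheme \<Rightarrow> 'a set \<Rightarrow> ('a \<Rightarrow> 'p \<Rightarrow> 'o) \<Rightarrow> ('a \<Rightarrow> 'n \<Rightarrow> 'm) \<Rightarrow>
   'i set \<Rightarrow> bool" where
  "lifts_products A M S UO UA I \<longleftrightarrow> (\<forall>X P p.
     (\<forall>i\<in>I. X i \<in> Obj M) \<and> (\<forall>a\<in>S. is_product A I (\<lambda>i. UO a (X i)) (P a) (p a)) \<longrightarrow>
     (\<exists>Q q. is_product M I X Q q \<and> (\<forall>a\<in>S. UO a Q = P a \<and> (\<forall>i\<in>I. UA a (q i) = p a i))))"

text \<open>The properties of the forgetful functors \<open>UO a\<close>, \<open>UA a\<close> that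
  are to make \<open>M\<close> inherit exactness from \<open>A\<close>. Only the limit half is
  stated; the conditions on sums, zeros and negatives are self-dual, so a second interpretation at
  the opposite categories supplies the colimit half. \<open>lift_mono\<close> says that a
  factorization found pointwise through a pointwise mono is an arrow of \<open>M\<close>.\<close>

locale pointwise_limits = A: additive_structure A plus zero + M: category M
  for A :: "('o, 'm, 'z) cat_scheme" and plus :: "'m \<Rightarrow> 'm \<Rightarrow> 'm" and zero :: "'o \<Rightarrow> 'o \<Rightarrow> 'm"
    and M :: "('p, 'n, 'y) cat_scheme" +
  fixes S :: "'a set" and UO :: "'a \<Rightarrow> 'p \<Rightarrow> 'o" and UA :: "'a \<Rightarrow> 'n \<Rightarrow> 'm"
  assumes ex_kernel_A: "u \<in> Arr A \<Longrightarrow> \<exists>k. is_kernel A k u"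
    and mono_normal_A: "mono_arrow A u \<Longrightarrow> \<exists>v. is_kernel A u v"
    and UO_Obj: "\<lbrakk>a \<in> S; X \<in> Obj M\<rbrakk> \<Longrightarrow> UO a X \<in> Obj A"
    and UA_Hom: "\<lbrakk>a \<in> S; f \<in> Hom M X Y\<rbrakk> \<Longrightarrow> UA a f \<in> Hom A (UO a X) (UO a Y)"
    and UA_Ident: "\<lbrakk>a \<in> S; X \<in> Obj M\<rbrakk> \<Longrightarrow> UA a (Ident M X) = Ident A (UO a X)"
    and UA_Comp: "\<lbrakk>a \<in> S; f \<in> Hom M X Y; g \<in> Hom M Y Z\<rbrakk> \<Longrightarrow> UA a (g \<cdot>\<^bsub>M\<^esub> f) = UA a g \<cdot>\<^bsub>A\<^esub> UA a f"
    and faithful: "\<lbrakk>f \<in> Hom M X Y; g \<in> Hom M X Y; \<And>a. a \<in> S \<Longrightarrow> UA a f = UA a g\<rbrakk> \<Longrightarrow> f = g"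
    and lift_plus: "\<lbrakk>f \<in> Hom M X Y; g \<in> Hom M X Y\<rbrakk>
      \<Longrightarrow> \<exists>h\<in>Hom M X Y. \<forall>a\<in>S. UA a h = plus (UA a f) (UA a g)"
    and lift_zero: "\<lbrakk>X \<in> Obj M; Y \<in> Obj M\<rbrakk> \<Longrightarrow> \<exists>h\<in>Hom M X Y. \<forall>a\<in>S. UA a h = zero (UO a X) (UO a Y)"
    and lift_neg: "f \<in> Hom M X Y \<Longrightarrow> \<exists>h\<in>Hom M X Y. \<forall>a\<in>S. plus (UA a f) (UA a h) = zero (UO a X) (UO a Y)"
    and lift_zero_object: "zero_object A N \<Longrightarrow> \<exists>Q\<in>Obj M. \<forall>a\<in>S. UO a Q = N"
    and lift_mono: "\<lbrakk>k \<in> Hom M K X; g \<in> Hom M W X; \<And>a. a \<in> S \<Longrightarrow> mono_arrow A (UA a k);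
        \<And>a. a \<in> S \<Longrightarrow> h a \<in> Hom A (UO a W) (UO a K); \<And>a. a \<in> S \<Longrightarrow> UA a k \<cdot>\<^bsub>A\<^esub> h a = UA a g\<rbrakk>
      \<Longrightarrow> \<exists>h'\<in>Hom M W K. \<forall>a\<in>S. UA a h' = h a"
    and lift_kernel: "\<lbrakk>f \<in> Hom M X Y; \<And>a. a \<in> S \<Longrightarrow> is_kernel A (kk a) (UA a f)\<rbrakk>
      \<Longrightarrow> \<exists>K. \<exists>k\<in>Hom M K X. \<forall>a\<in>S. UA a k = kk a"
begin

lemma ex_zero_object: "\<exists>Z. zero_object M Z"
proof -
  obtain Z where Z: "zero_object A Z" using A.zero_ex by blast
  obtain Q where Q: "Q \<in> Obj M" "\<And>a. a \<in> S \<Longrightarrow> UO a Q = Z" using lift_zero_object[OF Z] by blast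
  have *: "\<exists>!f. f \<in> Hom M X Y" if XY: "X \<in> Obj M" "Y \<in> Obj M" "X = Q \<or> Y = Q" for X Y
  proof -
    obtain h where "h \<in> Hom M X Y" using lift_zero[OF XY(1,2)] by blast
    moreover have "f = g" if fg: "f \<in> Hom M X Y" "g \<in> Hom M X Y" for f g
    proof (rule faithful[OF fg])
      fix a assume a: "a \<in> S"
      have "UA a f \<in> Hom A (UO a X) (UO a Y)" "UA a g \<in> Hom A (UO a X) (UO a Y)"
        using UA_Hom a fg by auto
      moreover have "UO a X \<in> Obj A" "UO a Y \<in> Obj A" "UO a X = Z \<or> UO a Y = Z"
        using UO_Obj Q \<open>X = Q \<or> Y = Q\<close> M.Hom_Obj[OF fg(1)] a by auto
      ultimately show "UA a f = UA a g" using Z unfolding zero_object_def by blast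
    qed
    ultimately show ?thesis by blast
  qed
  show ?thesis
    unfolding zero_object_def by (intro exI[of _ Q] conjI ballI * Q(1)) (simp_all add: Q(1))
qed

text \<open>The choice is harmless: by \<open>faithful\<close> there is only one such arrow.\<close>

definition plusM :: "'n \<Rightarrow> 'n \<Rightarrow> 'n" where
  "plusM f g = (SOME h. h \<in> Hom M (Dom M f) (Cod M f) \<and> (\<forall>a\<in>S. UA a h = plus (UA a f) (UA a g)))"

definition zeroM :: "'p \<Rightarrow> 'p \<Rightarrow> 'n" where
  "zeroM X Y = (SOME h. h \<in> Hom M X Y \<and> (\<forall>a\<in>S. UA a h = zero (UO a X) (UO a Y)))"

lemma plusM:
  assumes "f \<in> Hom M X Y" "g \<in> Hom M X Y"
  shows "plusM f g \<in> Hom M X Y" "a \<in> S \<Longrightarrow> UA a (plusM f g) = plus (UA a f) (UA a g)"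
proof -
  have "\<exists>h. h \<in> Hom M (Dom M f) (Cod M f) \<and> (\<forall>a\<in>S. UA a h = plus (UA a f) (UA a g))"
    using lift_plus[OF assms] assms(1) by (auto simp: Hom_def)
  from someI_ex[OF this, folded plusM_def]
  show "plusM f g \<in> Hom M X Y" "a \<in> S \<Longrightarrow> UA a (plusM f g) = plus (UA a f) (UA a g)"
    using assms(1) by (auto simp: Hom_def)
qed

lemma zeroM:
  assumes "X \<in> Obj M" "Y \<in> Obj M"
  shows "zeroM X Y \<in> Hom M X Y" "a \<in> S \<Longrightarrow> UA a (zeroM X Y) = zero (UO a X) (UO a Y)"
proof -
  have "\<exists>h. h \<in> Hom M X Y \<and> (\<forall>a\<in>S. UA a h = zero (UO a X) (UO a Y))"
    using lift_zero[OF assms] by blast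
  from someI_ex[OF this, folded zeroM_def]
  show "zeroM X Y \<in> Hom M X Y" "a \<in> S \<Longrightarrow> UA a (zeroM X Y) = zero (UO a X) (UO a Y)"
    by auto
qed

text \<open>Group laws and bilinearity are equations between parallel arrows, so
  \<open>faithful\<close> brings them back to \<open>A\<close>, index by index.\<close>

lemma additive_M: "additive_structure M plusM zeroM"
proof (intro additive_structure.intro M.category_axioms additive_structure_axioms.intro ex_zero_object)
  fix X Y assume XY: "X \<in> Obj M" "Y \<in> Obj M"
  show "comm_group \<lparr>carrier = Hom M X Y, monoid.mult = plusM, one = zeroM X Y\<rparr>"
  proof (rule comm_groupI; (simp only: partial_object.simps monoid.simps)?)
    show "zeroM X Y \<in> Hom M X Y" using zeroM XY by auto
    fix f g assume f: "f \<in> Hom M X Y"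
    show "plusM (zeroM X Y) f = f"
    proof (rule faithful[of _ X Y])
      fix a assume a: "a \<in> S"
      show "UA a (plusM (zeroM X Y) f) = UA a f"
        using plusM(2)[OF zeroM(1)[OF XY] f a] zeroM(2)[OF XY a] A.plus_zero(2)[OF UA_Hom[OF a f]] by simp
    qed (use f XY in \<open>simp_all add: plusM zeroM\<close>)
    obtain h where h: "h \<in> Hom M X Y" "\<And>a. a\<in>S \<Longrightarrow> plus (UA a f) (UA a h) = zero (UO a X) (UO a Y)"
      using lift_neg[OF f] by blast
    have "plusM h f = zeroM X Y"
    proof (rule faithful[of _ X Y])
      fix a assume a: "a \<in> S"
      show "UA a (plusM h f) = UA a (zeroM X Y)"
        using plusM(2)[OF h(1) f a] zeroM(2)[OF XY a] h(2)[OF a] A.plus_comm[OF UA_Hom[OF a f] UA_Hom[OF a h(1)]]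
        by simp
    qed (use f h XY in \<open>simp_all add: plusM zeroM\<close>)
    then show "\<exists>y\<in>Hom M X Y. plusM y f = zeroM X Y" using h(1) by blast
    assume g: "g \<in> Hom M X Y"
    show "plusM f g \<in> Hom M X Y" using plusM f g by simp
    show "plusM f g = plusM g f"
    proof (rule faithful[of _ X Y])
      fix a assume a: "a \<in> S"
      show "UA a (plusM f g) = UA a (plusM g f)"
        using plusM(2)[OF f g a] plusM(2)[OF g f a] A.plus_comm[OF UA_Hom[OF a f] UA_Hom[OF a g]] by simp
    qed (use f g in \<open>simp_all add: plusM\<close>)
    fix h assume h: "h \<in> Hom M X Y"
    show "plusM (plusM f g) h = plusM f (plusM g h)"
    proof (rule faithful[of _ X Y])
      fix a assume a: "a \<in> S"
      show "UA a (plusM (plusM f g) h) = UA a (plusM f (plusM g h))"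
        using a f g h A.plus_assoc[OF UA_Hom[OF a f] UA_Hom[OF a g] UA_Hom[OF a h]]
        by (simp add: plusM(2)[of _ X Y] plusM(1))
    qed (use f g h in \<open>simp_all add: plusM\<close>)
  qed
next
  fix f f' X Y g Z assume f: "f \<in> Hom M X Y" "f' \<in> Hom M X Y" and g: "g \<in> Hom M Y Z"
  note gf = M.Comp_Hom[OF f(1) g] M.Comp_Hom[OF f(2) g]
  show "g \<cdot>\<^bsub>M\<^esub> plusM f f' = plusM (g \<cdot>\<^bsub>M\<^esub> f) (g \<cdot>\<^bsub>M\<^esub> f')"
  proof (rule faithful)
    fix a assume a: "a \<in> S"
    show "UA a (g \<cdot>\<^bsub>M\<^esub> plusM f f') = UA a (plusM (g \<cdot>\<^bsub>M\<^esub> f) (g \<cdot>\<^bsub>M\<^esub> f'))"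
      using UA_Comp[OF a plusM(1)[OF f] g] plusM(2)[OF gf a] plusM(2)[OF f a]
        UA_Comp[OF a f(1) g] UA_Comp[OF a f(2) g] A.Comp_plus[OF UA_Hom[OF a f(1)] UA_Hom[OF a f(2)] UA_Hom[OF a g]]
      by simp
  qed (rule M.Comp_Hom[OF plusM(1)[OF f] g] plusM(1)[OF gf])+
next
  fix f X Y g g' Z assume f: "f \<in> Hom M X Y" and g: "g \<in> Hom M Y Z" "g' \<in> Hom M Y Z"
  note gf = M.Comp_Hom[OF f g(1)] M.Comp_Hom[OF f g(2)]
  show "plusM g g' \<cdot>\<^bsub>M\<^esub> f = plusM (g \<cdot>\<^bsub>M\<^esub> f) (g' \<cdot>\<^bsub>M\<^esub> f)"
  proof (rule faithful)
    fix a assume a: "a \<in> S"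
    show "UA a (plusM g g' \<cdot>\<^bsub>M\<^esub> f) = UA a (plusM (g \<cdot>\<^bsub>M\<^esub> f) (g' \<cdot>\<^bsub>M\<^esub> f))"
      using UA_Comp[OF a f plusM(1)[OF g]] plusM(2)[OF gf a] plusM(2)[OF g a]
        UA_Comp[OF a f g(1)] UA_Comp[OF a f g(2)] A.plus_Comp[OF UA_Hom[OF a f] UA_Hom[OF a g(1)] UA_Hom[OF a g(2)]]
      by simp
  qed (rule M.Comp_Hom[OF f plusM(1)[OF g]] plusM(1)[OF gf])+
qed

sublocale MA: additive_structure M plusM zeroM by (rule additive_M)

section \<open>Zero arrows, kernels, monos and products are detected pointwise\<close>

lemma zero_arrow_pointwise:
  assumes "f \<in> Hom M X Y"
  shows "zero_arrow M f \<longleftrightarrow> (\<forall>a\<in>S. zero_arrow A (UA a f))"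
proof -
  note XY = M.Hom_Obj[OF assms]
  have "zero_arrow M f \<longleftrightarrow> f = zeroM X Y" by (rule MA.zero_arrow_iff[OF assms])
  also have "\<dots> \<longleftrightarrow> (\<forall>a\<in>S. UA a f = UA a (zeroM X Y))"
    using faithful[OF assms zeroM(1)[OF XY]] by blast
  also have "\<dots> \<longleftrightarrow> (\<forall>a\<in>S. zero_arrow A (UA a f))"
    using zeroM(2)[OF XY] A.zero_arrow_iff[OF UA_Hom[OF _ assms]] by simp
  finally show ?thesis .
qed

lemma mono_reflected:
  assumes "f \<in> Hom M X Y" "\<And>a. a \<in> S \<Longrightarrow> mono_arrow A (UA a f)"
  shows "mono_arrow M f"
  unfolding mono_arrow_def
proof (intro conjI ballI impI)
  have D: "Dom M f = X" "f \<in> Arr M" using assms by (auto simp: Hom_def)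
  show "f \<in> Arr M" by (rule D)
  fix W g h assume g: "g \<in> Hom M W (Dom M f)" and h: "h \<in> Hom M W (Dom M f)"
    and eq: "f \<cdot>\<^bsub>M\<^esub> g = f \<cdot>\<^bsub>M\<^esub> h"
  note g = g[unfolded D] and h = h[unfolded D]
  show "g = h"
  proof (rule faithful[OF g h])
    fix a assume a: "a \<in> S"
    have "UA a f \<cdot>\<^bsub>A\<^esub> UA a g = UA a f \<cdot>\<^bsub>A\<^esub> UA a h"
      using UA_Comp[OF a g assms(1)] UA_Comp[OF a h assms(1)] eq by simp
    then show "UA a g = UA a h"
      using A.mono_arrowD[OF assms(2)[OF a], of "UA a g" "UO a W"] UA_Hom[OF a g] UA_Hom[OF a h]
        UA_Hom[OF a assms(1)] by (simp add: Hom_def)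
  qed
qed

lemma kernel_reflected:
  assumes f: "f \<in> Hom M X Y" and k: "k \<in> Hom M K X"
    and ker: "\<And>a. a \<in> S \<Longrightarrow> is_kernel A (UA a k) (UA a f)"
  shows "is_kernel M k f"
proof (rule M.is_kernelI)
  note D = HomD[OF f] HomD[OF k]
  show "f \<in> Arr M" "Cod M k = Dom M f" using D by auto
  have mono: "mono_arrow A (UA a k)" if "a \<in> S" for a using A.mono_kernel[OF ker[OF that]] .
  show "mono_arrow M k" using mono_reflected[OF k mono] .
  show "zero_arrow M (f \<cdot>\<^bsub>M\<^esub> k)"
    using zero_arrow_pointwise[OF M.Comp_Hom[OF k f]] UA_Comp[OF _ k f] ker by (auto simp: is_kernel_def)
  fix W h assume h: "h \<in> Hom M W (Dom M f)" and z: "zero_arrow M (f \<cdot>\<^bsub>M\<^esub> h)"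
  note h = h[unfolded D]
  have "\<exists>g. g \<in> Hom A (UO a W) (UO a K) \<and> UA a k \<cdot>\<^bsub>A\<^esub> g = UA a h" if a: "a \<in> S" for a
  proof -
    have "zero_arrow A (UA a f \<cdot>\<^bsub>A\<^esub> UA a h)"
      using z zero_arrow_pointwise[OF M.Comp_Hom[OF h f]] UA_Comp[OF a h f] a by auto
    then show ?thesis
      using A.is_kernel_factor[OF ker[OF a], of "UA a h" "UO a W"] HomD[OF UA_Hom[OF a f]]
        HomD[OF UA_Hom[OF a k]] UA_Hom[OF a h] by metis
  qed
  then obtain g where g: "\<And>a. a \<in> S \<Longrightarrow> g a \<in> Hom A (UO a W) (UO a K) \<and> UA a k \<cdot>\<^bsub>A\<^esub> g a = UA a h"
    by metis
  \<comment> \<open>The factorizations are chosen independently at each index; that they fit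
    together to an arrow of \<open>M\<close> is \<open>lift_mono\<close>, applicable because
    \<open>k\<close> is pointwise mono.\<close>
  then obtain g' where g': "g' \<in> Hom M W K" "\<And>a. a \<in> S \<Longrightarrow> UA a g' = g a"
    using lift_mono[OF k h mono, of g] by blast
  have "k \<cdot>\<^bsub>M\<^esub> g' = h"
    by (rule faithful[OF M.Comp_Hom[OF g'(1) k] h]) (simp add: UA_Comp[OF _ g'(1) k] g' g)
  then show "\<exists>g. g \<in> Hom M W (Dom M k) \<and> k \<cdot>\<^bsub>M\<^esub> g = h" using g'(1) D by blast
qed

lemma ex_pointwise_kernel:
  assumes f: "f \<in> Hom M X Y"
  obtains K k where "k \<in> Hom M K X" "is_kernel M k f" "\<And>a. a \<in> S \<Longrightarrow> is_kernel A (UA a k) (UA a f)"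
proof -
  have "\<exists>k. is_kernel A k (UA a f)" if "a \<in> S" for a
    using ex_kernel_A HomD(1)[OF UA_Hom[OF that f]] by blast
  then obtain kk where kk: "\<And>a. a \<in> S \<Longrightarrow> is_kernel A (kk a) (UA a f)" by metis
  then obtain K k where k: "k \<in> Hom M K X" "\<And>a. a \<in> S \<Longrightarrow> UA a k = kk a"
    using lift_kernel[OF f kk] by blast
  with kk have "\<And>a. a \<in> S \<Longrightarrow> is_kernel A (UA a k) (UA a f)" by simp
  with kernel_reflected[OF f k(1)] k(1) show ?thesis using that by blast
qed

lemma UA_inverse:
  assumes "inverse_arrows M u v" "a \<in> S"
  shows "inverse_arrows A (UA a u) (UA a v)"
proof -
  note iu = M.inverse_arrows_simps[OF assms(1)]
  have u: "u \<in> Hom M (Dom M u) (Cod M u)" and v: "v \<in> Hom M (Cod M u) (Dom M u)"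
    using iu by (auto simp: Hom_def)
  have "UA a v \<cdot>\<^bsub>A\<^esub> UA a u = Ident A (UO a (Dom M u))" "UA a u \<cdot>\<^bsub>A\<^esub> UA a v = Ident A (UO a (Cod M u))"
    using UA_Comp[OF assms(2) u v] UA_Comp[OF assms(2) v u] iu UA_Ident assms(2) M.Hom_Obj[OF u] by auto
  then show ?thesis
    using UA_Hom[OF assms(2) u] UA_Hom[OF assms(2) v] by (auto simp: inverse_arrows_def Hom_def)
qed

text \<open>Besides reflection, what counts is that \<open>f\<close> has at least one pointwise
  kernel. Any other kernel is isomorphic to it, and each \<open>UA a\<close> preserves the
  isomorphism.\<close>

lemma kernel_pointwise:
  assumes f: "f \<in> Hom M X Y" and k: "k \<in> Hom M K X"
  shows "is_kernel M k f \<longleftrightarrow> (\<forall>a\<in>S. is_kernel A (UA a k) (UA a f))"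
proof
  assume ker: "is_kernel M k f"
  obtain L l where l: "l \<in> Hom M L X" "is_kernel M l f" "\<And>a. a \<in> S \<Longrightarrow> is_kernel A (UA a l) (UA a f)"
    using ex_pointwise_kernel[OF f] by blast
  obtain u v where u: "inverse_arrows M u v" "u \<in> Hom M K L" "l \<cdot>\<^bsub>M\<^esub> u = k"
    using M.kernel_unique[OF ker l(2)] HomD[OF l(1)] HomD[OF k] by metis
  show "\<forall>a\<in>S. is_kernel A (UA a k) (UA a f)"
  proof
    fix a assume a: "a \<in> S"
    have "Dom A (UA a l) = UO a L" using HomD[OF UA_Hom[OF a l(1)]] by simp
    then have "is_kernel A (UA a l \<cdot>\<^bsub>A\<^esub> UA a u) (UA a f)"
      using A.kernel_transfer[OF l(3)[OF a] UA_inverse[OF u(1) a], of "UO a K"] UA_Hom[OF a u(2)] by simp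
    then show "is_kernel A (UA a k) (UA a f)" using UA_Comp[OF a u(2) l(1)] u(3) by simp
  qed
qed (use kernel_reflected assms in blast)

text \<open>With an additive structure, being mono amounts to having zero kernel. The kernel of
  \<open>f\<close> vanishes and is computed pointwise, so the kernel of each \<open>UA a f\<close>
  vanishes as well.\<close>

lemma mono_pointwise:
  assumes f: "f \<in> Hom M X Y" and mono: "mono_arrow M f" and a: "a \<in> S"
  shows "mono_arrow A (UA a f)"
proof -
  obtain K k where k: "k \<in> Hom M K X" "is_kernel M k f" "\<And>a. a \<in> S \<Longrightarrow> is_kernel A (UA a k) (UA a f)"
    using ex_pointwise_kernel[OF f] by blast
  note KX = M.Hom_Obj[OF k(1)] M.Hom_Obj(2)[OF f]
  have z: "zeroM K X \<in> Hom M K X" using zeroM KX by simp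
  have "f \<cdot>\<^bsub>M\<^esub> k = zeroM K Y"
    using k(2) MA.zero_arrow_iff[OF M.Comp_Hom[OF k(1) f]] by (auto simp: is_kernel_def)
  also have "\<dots> = f \<cdot>\<^bsub>M\<^esub> zeroM K X" using MA.Comp_zero[OF f KX(1)] by simp
  finally have "k = zeroM K X"
    using M.mono_arrowD[OF mono, of k K] k(1) z HomD[OF f] by auto
  then have ka: "UA a k = zero (UO a K) (UO a X)" using zeroM(2) KX a by simp
  show ?thesis
  proof (rule A.mono_if_zero_cancel[OF UA_Hom[OF a f]])
    fix W g assume g: "g \<in> Hom A W (UO a X)" "UA a f \<cdot>\<^bsub>A\<^esub> g = zero W (UO a Y)"
    have "zero_arrow A (UA a f \<cdot>\<^bsub>A\<^esub> g)"
      unfolding g(2) using A.zero_arrow_zero A.Hom_Obj[OF g(1)] A.Hom_Obj[OF UA_Hom[OF a f]] by auto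
    then obtain w where "w \<in> Hom A W (UO a K)" "UA a k \<cdot>\<^bsub>A\<^esub> w = g"
      using A.is_kernel_factor[OF k(3)[OF a], of g W] g(1) HomD[OF UA_Hom[OF a f]] HomD[OF UA_Hom[OF a k(1)]]
      by metis
    then show "g = zero W (UO a X)"
      using ka A.zero_Comp UO_Obj[OF a KX(2)] by metis
  qed
qed

lemma product_pointwise:
  assumes lift: "lifts_products A M S UO UA I"
    and ex: "\<And>a. a \<in> S \<Longrightarrow> \<exists>P p. is_product A I (\<lambda>i. UO a (X i)) P p"
    and P: "is_product M I X P p" and X: "\<And>i. i \<in> I \<Longrightarrow> X i \<in> Obj M" and a: "a \<in> S"
  shows "is_product A I (\<lambda>i. UO a (X i)) (UO a P) (\<lambda>i. UA a (p i))"
proof -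
  obtain PP pp where pp: "\<And>a. a \<in> S \<Longrightarrow> is_product A I (\<lambda>i. UO a (X i)) (PP a) (pp a)"
    using ex by metis
  obtain Q q where Q: "is_product M I X Q q"
    and Qa: "\<And>a. a \<in> S \<Longrightarrow> UO a Q = PP a" and qa: "\<And>a i. \<lbrakk>a \<in> S; i \<in> I\<rbrakk> \<Longrightarrow> UA a (q i) = pp a i"
    using lift X pp unfolding lifts_products_def by blast
  obtain u v where u: "inverse_arrows M u v" "u \<in> Hom M P Q" "\<And>i. i \<in> I \<Longrightarrow> q i \<cdot>\<^bsub>M\<^esub> u = p i"
    using M.product_unique[OF P Q] by blast
  show ?thesis
  proof (rule A.product_transfer[OF pp[OF a] UA_inverse[OF u(1) a]])
    show "UA a u \<in> Hom A (UO a P) (PP a)" using UA_Hom[OF a u(2)] Qa[OF a] by simp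
    fix i assume i: "i \<in> I"
    show "pp a i \<cdot>\<^bsub>A\<^esub> UA a u = UA a (p i)"
      using UA_Comp[OF a u(2) M.is_productD(2)[OF Q i]] u(3)[OF i] qa[OF a i] by simp
  qed
qed

lemma ex_product:
  assumes lift: "lifts_products A M S UO UA I"
    and ex: "\<And>a. a \<in> S \<Longrightarrow> \<exists>P p. is_product A I (\<lambda>i. UO a (X i)) P p"
    and X: "\<And>i. i \<in> I \<Longrightarrow> X i \<in> Obj M"
  shows "\<exists>P p. is_product M I X P p"
proof -
  obtain PP pp where pp: "\<And>a. a \<in> S \<Longrightarrow> is_product A I (\<lambda>i. UO a (X i)) (PP a) (pp a)"
    using ex by metis
  then show ?thesis using lift X unfolding lifts_products_def by blast
qed

end

section \<open>Exactness, normality and the AB axioms from limits and colimits together\<close>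

locale pointwise_limits_colimits = pointwise_limits A plus zero M S UO UA
  for A :: "('o, 'm, 'z) cat_scheme" and plus zero and M :: "('p, 'n, 'y) cat_scheme"
    and S :: "'a set" and UO UA +
  assumes op: "pointwise_limits (op_cat A) plus (\<lambda>X Y. zero Y X) (op_cat M) S UO UA"
begin

sublocale op: pointwise_limits "op_cat A" plus "\<lambda>X Y. zero Y X" "op_cat M" S UO UA
  by (rule op)

lemma short_exact_pointwise:
  assumes "f \<in> Hom M X Y" "g \<in> Hom M Y Z"
  shows "short_exact M f g \<longleftrightarrow> (\<forall>a\<in>S. short_exact A (UA a f) (UA a g))"
  using kernel_pointwise[of g Y Z f X] op.kernel_pointwise[of f Y X g Z] assms
  by (auto simp: short_exact_def is_cokernel_def)

text \<open>Normality in \<open>A\<close> presents each \<open>UA a f\<close> as the kernel of some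
  arrow, but such arrows for different indices need not form an arrow of \<open>M\<close>. They are
  replaced by the cokernel \<open>q\<close> of \<open>f\<close>, which is an arrow of
  \<open>M\<close> and pointwise a cokernel: a normal mono is the kernel of its cokernel.\<close>

lemma mono_normal:
  assumes mono: "mono_arrow M f"
  shows "\<exists>g. is_kernel M f g"
proof -
  define X Y where "X = Dom M f" and "Y = Cod M f"
  have f: "f \<in> Hom M X Y" using mono by (auto simp: mono_arrow_def X_def Y_def Hom_def)
  obtain Q q where q: "q \<in> Hom M Y Q" "\<And>a. a \<in> S \<Longrightarrow> is_kernel (op_cat A) (UA a q) (UA a f)"
    using op.ex_pointwise_kernel[of f Y X] f unfolding Hom_op_cat by metis
  have "is_kernel A (UA a f) (UA a q)" if a: "a \<in> S" for a
  proof -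
    note fa = UA_Hom[OF a f] and qa = UA_Hom[OF a q(1)]
    have m: "mono_arrow A (UA a f)" by (rule mono_pointwise[OF f mono a])
    obtain g where g: "is_kernel A (UA a f) g" using mono_normal_A[OF m] by blast
    then have g': "g \<in> Hom A (UO a Y) (Cod A g)" "zero_arrow A (g \<cdot>\<^bsub>A\<^esub> UA a f)"
      using HomD[OF fa] by (auto simp: is_kernel_def Hom_def)
    show ?thesis
    proof (rule A.is_kernelI)
      show "UA a q \<in> Arr A" "Cod A (UA a f) = Dom A (UA a q)" using HomD[OF qa] HomD[OF fa] by auto
      show "mono_arrow A (UA a f)" by (rule m)
      show "zero_arrow A (UA a q \<cdot>\<^bsub>A\<^esub> UA a f)" using q(2)[OF a] by (auto simp: is_kernel_def)
      fix W h assume h: "h \<in> Hom A W (Dom A (UA a q))" and z: "zero_arrow A (UA a q \<cdot>\<^bsub>A\<^esub> h)"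
      have h: "h \<in> Hom A W (UO a Y)" using h HomD[OF qa] by simp
      \<comment> \<open>Since \<open>g\<close> kills \<open>UA a f\<close>, it factors through the
        cokernel. So whatever \<open>UA a q\<close> kills is killed by \<open>g\<close>, and
        therefore factors through the kernel \<open>UA a f\<close> of \<open>g\<close>.\<close>
      obtain r where r: "r \<in> Hom A (UO a Q) (Cod A g)" "r \<cdot>\<^bsub>A\<^esub> UA a q = g"
        using op.A.is_kernel_factor[OF q(2)[OF a], of g "Cod A g"] g' HomD[OF fa] HomD[OF qa] by auto
      have "g \<cdot>\<^bsub>A\<^esub> h = r \<cdot>\<^bsub>A\<^esub> UA a q \<cdot>\<^bsub>A\<^esub> h" using A.Comp_assoc[OF h qa r(1)] r(2) by simp
      also have "\<dots> = zero W (Cod A g)"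
        using z A.zero_arrow_iff[OF A.Comp_Hom[OF h qa]] A.Comp_zero[OF r(1)] A.Hom_Obj[OF h] by simp
      finally have "zero_arrow A (g \<cdot>\<^bsub>A\<^esub> h)"
        using A.zero_arrow_zero A.Hom_Obj[OF h] A.Hom_Obj[OF g'(1)] by simp
      then show "\<exists>k. k \<in> Hom A W (Dom A (UA a f)) \<and> UA a f \<cdot>\<^bsub>A\<^esub> k = h"
        using A.is_kernel_factor[OF g, of h W] h HomD[OF g'(1)] by auto
    qed
  qed
  then show ?thesis using kernel_reflected[OF q(1) f] by blast
qed

lemma AB4_star_pointwise:
  assumes AB: "AB4_star TYPE('u) A"
    and lift: "\<And>I :: 'u set. lifts_products A M S UO UA I"
  shows "AB4_star TYPE('u) M"
  unfolding AB4_star_def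
proof (intro conjI allI impI; (elim conjE)?)
  have ex: "\<exists>P p. is_product A I (\<lambda>i. UO a (X i)) P p"
    if "small TYPE('u) I" "\<forall>i\<in>I. X i \<in> Obj M" "a \<in> S" for I :: "'u set" and X a
    using AB[unfolded AB4_star_def, THEN conjunct1, rule_format, of I "\<lambda>i. UO a (X i)"] UO_Obj that by blast
  {
    fix I :: "'u set" and X assume "small TYPE('u) I" "\<forall>i\<in>I. X i \<in> Obj M"
    then show "\<exists>P p. is_product M I X P p" using ex_product[OF lift ex] by blast
  }
  fix I :: "'u set" and X Y Z f g PX pX PY pY PZ pZ f' g'
  assume I: "small TYPE('u) I" and
    fg: "\<forall>i\<in>I. f i \<in> Hom M (X i) (Y i) \<and> g i \<in> Hom M (Y i) (Z i) \<and> short_exact M (f i) (g i)" and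
    P: "is_product M I X PX pX" "is_product M I Y PY pY" "is_product M I Z PZ pZ" and
    f': "f' \<in> Hom M PX PY" "\<forall>i\<in>I. pY i \<cdot>\<^bsub>M\<^esub> f' = f i \<cdot>\<^bsub>M\<^esub> pX i" and
    g': "g' \<in> Hom M PY PZ" "\<forall>i\<in>I. pZ i \<cdot>\<^bsub>M\<^esub> g' = g i \<cdot>\<^bsub>M\<^esub> pY i"
  have f: "\<And>i. i \<in> I \<Longrightarrow> f i \<in> Hom M (X i) (Y i)" and g: "\<And>i. i \<in> I \<Longrightarrow> g i \<in> Hom M (Y i) (Z i)"
    using fg by auto
  have XYZ: "\<forall>i\<in>I. X i \<in> Obj M" "\<forall>i\<in>I. Y i \<in> Obj M" "\<forall>i\<in>I. Z i \<in> Obj M"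
    using f g M.Hom_Obj by blast+
  have "short_exact A (UA a f') (UA a g')" if a: "a \<in> S" for a
  proof -
    have 1: "\<forall>i\<in>I. UA a (f i) \<in> Hom A (UO a (X i)) (UO a (Y i)) \<and> UA a (g i) \<in> Hom A (UO a (Y i)) (UO a (Z i))
        \<and> short_exact A (UA a (f i)) (UA a (g i))"
      using UA_Hom[OF a] fg short_exact_pointwise a by blast
    \<comment> \<open>The products in \<open>M\<close> are arbitrary; only
      \<open>product_pointwise\<close> makes them products in \<open>A\<close> at the index
      \<open>a\<close>, to which the axiom of \<open>A\<close> can be applied.\<close>
    have 2: "is_product A I (\<lambda>i. UO a (X i)) (UO a PX) (\<lambda>i. UA a (pX i))"
      "is_product A I (\<lambda>i. UO a (Y i)) (UO a PY) (\<lambda>i. UA a (pY i))"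
      "is_product A I (\<lambda>i. UO a (Z i)) (UO a PZ) (\<lambda>i. UA a (pZ i))"
      using product_pointwise[OF lift ex] P I XYZ a by auto
    have 3: "\<forall>i\<in>I. UA a (pY i) \<cdot>\<^bsub>A\<^esub> UA a f' = UA a (f i) \<cdot>\<^bsub>A\<^esub> UA a (pX i)"
      using f'(2) UA_Comp[OF a f'(1) M.is_productD(2)[OF P(2)]] UA_Comp[OF a M.is_productD(2)[OF P(1)] f]
      by metis
    have 4: "\<forall>i\<in>I. UA a (pZ i) \<cdot>\<^bsub>A\<^esub> UA a g' = UA a (g i) \<cdot>\<^bsub>A\<^esub> UA a (pY i)"
      using g'(2) UA_Comp[OF a g'(1) M.is_productD(2)[OF P(3)]] UA_Comp[OF a M.is_productD(2)[OF P(2)] g]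
      by metis
    show ?thesis
      using AB[unfolded AB4_star_def, THEN conjunct2, rule_format,
        of I "\<lambda>i. UA a (f i)" "\<lambda>i. UO a (X i)" "\<lambda>i. UO a (Y i)" "\<lambda>i. UA a (g i)" "\<lambda>i. UO a (Z i)"
          "UO a PX" "\<lambda>i. UA a (pX i)" "UO a PY" "\<lambda>i. UA a (pY i)" "UO a PZ" "\<lambda>i. UA a (pZ i)" "UA a f'" "UA a g'"]
        I 1 2 3 4 UA_Hom[OF a f'(1)] UA_Hom[OF a g'(1)]
      by blast
  qed
  then show "short_exact M f' g'" using short_exact_pointwise[OF f'(1) g'(1)] by blast
qed

end

text \<open>Passing to the opposite reverses the short exact sequences, so the axiom is instantiated
  with \<open>f\<close> and \<open>g\<close>, and \<open>X\<close> and \<open>Z\<close>,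
  exchanged.\<close>

lemma AB4_star_op:
  fixes U :: "'u itself"
  assumes "category C"
  shows "AB4_star U (op_cat C) \<longleftrightarrow> AB4 U C"
proof -
  have "AB4_star U (op_cat C)" if AB: "AB4 U C"
    unfolding AB4_star_def
  proof (intro conjI allI impI; (elim conjE)?)
    fix I :: "'u set" and X assume "small U I" "\<forall>i\<in>I. X i \<in> Obj (op_cat C)"
    then show "\<exists>P p. is_product (op_cat C) I X P p" using AB[unfolded AB4_def is_coproduct_def, THEN conjunct1, rule_format, of I X] by simp
  next
    fix I :: "'u set" and X Y Z f g PX pX PY pY PZ pZ f' g'
    assume "small U I"
      "\<forall>i\<in>I. f i \<in> Hom (op_cat C) (X i) (Y i) \<and> g i \<in> Hom (op_cat C) (Y i) (Z i) \<and> short_exact (op_cat C) (f i) (g i)"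
      "is_product (op_cat C) I X PX pX" "is_product (op_cat C) I Y PY pY" "is_product (op_cat C) I Z PZ pZ"
      "f' \<in> Hom (op_cat C) PX PY" "\<forall>i\<in>I. pY i \<cdot>\<^bsub>op_cat C\<^esub> f' = f i \<cdot>\<^bsub>op_cat C\<^esub> pX i"
      "g' \<in> Hom (op_cat C) PY PZ" "\<forall>i\<in>I. pZ i \<cdot>\<^bsub>op_cat C\<^esub> g' = g i \<cdot>\<^bsub>op_cat C\<^esub> pY i"
    then show "short_exact (op_cat C) f' g'"
      using AB[unfolded AB4_def is_coproduct_def, THEN conjunct2, rule_format,
        of I g Z Y f X PZ pZ PY pY PX pX g' f']
      by (simp add: short_exact_op)
  qed
  moreover have "AB4 U C" if AB: "AB4_star U (op_cat C)"
    unfolding AB4_def is_coproduct_def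
  proof (intro conjI allI impI; (elim conjE)?)
    fix I :: "'u set" and X assume "small U I" "\<forall>i\<in>I. X i \<in> Obj C"
    then show "\<exists>P p. is_product (op_cat C) I X P p" using AB[unfolded AB4_star_def, THEN conjunct1, rule_format, of I X] by simp
  next
    fix I :: "'u set" and X Y Z f g PX pX PY pY PZ pZ f' g'
    assume "small U I"
      "\<forall>i\<in>I. f i \<in> Hom C (X i) (Y i) \<and> g i \<in> Hom C (Y i) (Z i) \<and> short_exact C (f i) (g i)"
      "is_product (op_cat C) I X PX pX" "is_product (op_cat C) I Y PY pY" "is_product (op_cat C) I Z PZ pZ"
      "f' \<in> Hom C PX PY" "\<forall>i\<in>I. f' \<cdot>\<^bsub>C\<^esub> pX i = pY i \<cdot>\<^bsub>C\<^esub> f i"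
      "g' \<in> Hom C PY PZ" "\<forall>i\<in>I. g' \<cdot>\<^bsub>C\<^esub> pY i = pZ i \<cdot>\<^bsub>C\<^esub> g i"
    then show "short_exact C f' g'"
      using AB[unfolded AB4_star_def, THEN conjunct2, rule_format,
        of I g Z Y f X PZ pZ PY pY PX pX g' f']
      by (simp add: short_exact_op)
  qed
  ultimately show ?thesis by blast
qed

context pointwise_limits_colimits
begin

text \<open>\<open>op_cat (op_cat A)\<close> has lost any record fields beyond those of a category,
  so it is in general not \<open>A\<close> itself. The axioms are transferred by unfolding, since
  they read only the data that survive.\<close>

lemma op_limits_colimits:
  "pointwise_limits_colimits (op_cat A) plus (\<lambda>X Y. zero Y X) (op_cat M) S UO UA"
proof (intro pointwise_limits_colimits.intro op pointwise_limits_colimits_axioms.intro)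
  have "pointwise_limits_axioms A plus zero M S UO UA"
    using pointwise_limits_axioms unfolding pointwise_limits_def by blast
  then have "pointwise_limits_axioms (op_cat (op_cat A)) plus zero (op_cat (op_cat M)) S UO UA"
    by (simp add: pointwise_limits_axioms_def)
  then show "pointwise_limits (op_cat (op_cat A)) plus (\<lambda>X Y. zero X Y) (op_cat (op_cat M)) S UO UA"
    unfolding pointwise_limits_def
    using additive_structure.op[OF op.A.additive_structure_axioms] op.M.category_op by simp
qed

lemma abelian_M:
  assumes ex: "\<And>X Y. \<lbrakk>X \<in> Obj A; Y \<in> Obj A\<rbrakk> \<Longrightarrow> \<exists>P p. is_product A (UNIV :: bool set) (case_bool X Y) P p"
    and lift: "lifts_products A M S UO UA (UNIV :: bool set)"
  shows "abelian_category M"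
proof (intro abelian_category.intro M.category_axioms abelian_category_axioms.intro)
  show "\<exists>Z. zero_object M Z" by (rule ex_zero_object)
  then show "preadditive M" using M.preadditive_iff additive_M by blast
  show "\<exists>P p. is_product M (UNIV :: bool set) (case_bool X Y) P p" if "X \<in> Obj M" "Y \<in> Obj M" for X Y
  proof (rule ex_product[OF lift])
    fix a assume a: "a \<in> S"
    have "(\<lambda>i. UO a (case i of True \<Rightarrow> X | False \<Rightarrow> Y)) = case_bool (UO a X) (UO a Y)"
      by (auto split: bool.split)
    then show "\<exists>P p. is_product A (UNIV :: bool set) (\<lambda>i. UO a (case i of True \<Rightarrow> X | False \<Rightarrow> Y)) P p"
      using ex[of "UO a X" "UO a Y"] UO_Obj a that by auto
  qed (use that in \<open>auto split: bool.split\<close>)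
  show "\<exists>k. is_kernel M k f" if "f \<in> Arr M" for f
    using ex_pointwise_kernel[OF Hom_self[OF that]] by blast
  show "\<exists>k. is_cokernel M k f" if "f \<in> Arr M" for f
    using op.ex_pointwise_kernel[of f "Cod M f" "Dom M f"] Hom_self[OF that]
    unfolding is_cokernel_def by auto
  show "\<exists>g. is_kernel M f g" if "mono_arrow M f" for f using mono_normal[OF that] .
  \<comment> \<open>A second copy of the theory at the opposites: normality of epis in
    \<open>M\<close> is \<open>mono_normal\<close> there.\<close>
  interpret opop: pointwise_limits_colimits "op_cat A" plus "\<lambda>X Y. zero Y X" "op_cat M" S UO UA
    by (rule op_limits_colimits)
  show "\<exists>g. is_cokernel M f g" if "epi_arrow M f" for f
    using opop.mono_normal that unfolding epi_arrow_def is_cokernel_def by blast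
qed

lemma AB4_pointwise:
  assumes AB: "AB4 TYPE('u) A"
    and lift: "\<And>I :: 'u set. lifts_products (op_cat A) (op_cat M) S UO UA I"
  shows "AB4 TYPE('u) M"
proof -
  interpret opop: pointwise_limits_colimits "op_cat A" plus "\<lambda>X Y. zero Y X" "op_cat M" S UO UA
    by (rule op_limits_colimits)
  show ?thesis
    using opop.AB4_star_pointwise lift AB AB4_star_op[OF M.category_axioms] AB4_star_op[OF A.category_axioms]
    by blast
qed

end

section \<open>Algebras over a family of functors with right adjoints\<close>

text \<open>One notion for three kinds of limit: over the empty index set it says that parallel
  arrows into \<open>P\<close> coincide, as for a zero object; over a single index it is the mono
  property of a kernel; and product projections satisfy it in general.\<close>

definition jointly_monic :: "('o, 'm, 'z) cat_scheme \<Rightarrow> 'i set \<Rightarrow> 'o \<Rightarrow> ('i \<Rightarrow> 'm) \<Rightarrow> bool" where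
  "jointly_monic C I P p \<longleftrightarrow> (\<forall>W. \<forall>g\<in>Hom C W P. \<forall>h\<in>Hom C W P.
     (\<forall>i\<in>I. p i \<cdot>\<^bsub>C\<^esub> g = p i \<cdot>\<^bsub>C\<^esub> h) \<longrightarrow> g = h)"

definition jointly_epic :: "('o, 'm, 'z) cat_scheme \<Rightarrow> 'i set \<Rightarrow> 'o \<Rightarrow> ('i \<Rightarrow> 'm) \<Rightarrow> bool" where
  "jointly_epic C = jointly_monic (op_cat C)"

lemma jointly_monicD:
  "\<lbrakk>jointly_monic C I P p; g \<in> Hom C W P; h \<in> Hom C W P;
    \<And>i. i \<in> I \<Longrightarrow> p i \<cdot>\<^bsub>C\<^esub> g = p i \<cdot>\<^bsub>C\<^esub> h\<rbrakk> \<Longrightarrow> g = h"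
  by (simp add: jointly_monic_def)

lemma jointly_epicD:
  "\<lbrakk>jointly_epic C I P p; g \<in> Hom C P W; h \<in> Hom C P W;
    \<And>i. i \<in> I \<Longrightarrow> g \<cdot>\<^bsub>C\<^esub> p i = h \<cdot>\<^bsub>C\<^esub> p i\<rbrakk> \<Longrightarrow> g = h"
  by (simp add: jointly_epic_def jointly_monic_def)

lemma (in category) jointly_monic_product: "is_product C I X P p \<Longrightarrow> jointly_monic C I P p"
  unfolding jointly_monic_def using is_productD(3) by blast

lemma (in category) jointly_monic_mono:
  "\<lbrakk>mono_arrow C k; k \<in> Hom C K X\<rbrakk> \<Longrightarrow> jointly_monic C (UNIV :: unit set) K (\<lambda>_. k)"
  unfolding jointly_monic_def using mono_arrowD by (auto simp: Hom_def)

text \<open>Algebras are families of objects \<open>P a\<close> with actions \<open>F a b (P a) \<rightarrow> P b\<close> compatible with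
  \<open>mu\<close> and \<open>eta\<close>; the objects of \<open>M\<close> stand for these via \<open>UO\<close> and \<open>act\<close>.\<close>

locale graded_algebras = A: additive_structure A plus zero + M: category M
  for A :: "('o, 'm, 'z) cat_scheme" and plus :: "'m \<Rightarrow> 'm \<Rightarrow> 'm" and zero :: "'o \<Rightarrow> 'o \<Rightarrow> 'm"
    and M :: "('p, 'n, 'y) cat_scheme" +
  fixes S :: "'a set" and FO :: "'a \<Rightarrow> 'a \<Rightarrow> 'o \<Rightarrow> 'o" and FA :: "'a \<Rightarrow> 'a \<Rightarrow> 'm \<Rightarrow> 'm"
    and mu :: "'a \<Rightarrow> 'a \<Rightarrow> 'a \<Rightarrow> 'o \<Rightarrow> 'm" and eta :: "'a \<Rightarrow> 'o \<Rightarrow> 'm"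
    and UO :: "'a \<Rightarrow> 'p \<Rightarrow> 'o" and UA :: "'a \<Rightarrow> 'n \<Rightarrow> 'm" and act :: "'p \<Rightarrow> 'a \<Rightarrow> 'a \<Rightarrow> 'm"
  assumes ex_binary_product_A: "\<lbrakk>X \<in> Obj A; Y \<in> Obj A\<rbrakk>
      \<Longrightarrow> \<exists>P p. is_product A (UNIV :: bool set) (case_bool X Y) P p"
    and ex_kernel_A: "f \<in> Arr A \<Longrightarrow> \<exists>k. is_kernel A k f"
    and ex_cokernel_A: "f \<in> Arr A \<Longrightarrow> \<exists>k. is_cokernel A k f"
    and mono_normal_A: "mono_arrow A f \<Longrightarrow> \<exists>g. is_kernel A f g"
    and epi_normal_A: "epi_arrow A f \<Longrightarrow> \<exists>g. is_cokernel A f g"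
    and FO_Obj: "\<lbrakk>a \<in> S; b \<in> S; X \<in> Obj A\<rbrakk> \<Longrightarrow> FO a b X \<in> Obj A"
    and FA_Hom: "\<lbrakk>a \<in> S; b \<in> S; f \<in> Hom A X Y\<rbrakk> \<Longrightarrow> FA a b f \<in> Hom A (FO a b X) (FO a b Y)"
    and FA_Ident: "\<lbrakk>a \<in> S; b \<in> S; X \<in> Obj A\<rbrakk> \<Longrightarrow> FA a b (Ident A X) = Ident A (FO a b X)"
    and FA_Comp: "\<lbrakk>a \<in> S; b \<in> S; f \<in> Hom A X Y; g \<in> Hom A Y Z\<rbrakk>
      \<Longrightarrow> FA a b (g \<cdot>\<^bsub>A\<^esub> f) = FA a b g \<cdot>\<^bsub>A\<^esub> FA a b f"
    and F_adjoint: "\<lbrakk>a \<in> S; b \<in> S; Y \<in> Obj A\<rbrakk> \<Longrightarrow>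
      \<exists>H e. H \<in> Obj A \<and> e \<in> Hom A (FO a b H) Y \<and>
        (\<forall>X. \<forall>f\<in>Hom A (FO a b X) Y. X \<in> Obj A \<longrightarrow> (\<exists>!g. g \<in> Hom A X H \<and> e \<cdot>\<^bsub>A\<^esub> FA a b g = f))"
    and mu_Hom: "\<lbrakk>a \<in> S; b \<in> S; c \<in> S; X \<in> Obj A\<rbrakk>
      \<Longrightarrow> mu a b c X \<in> Hom A (FO b c (FO a b X)) (FO a c X)"
    and mu_natural: "\<lbrakk>a \<in> S; b \<in> S; c \<in> S; f \<in> Hom A X Y\<rbrakk>
      \<Longrightarrow> mu a b c Y \<cdot>\<^bsub>A\<^esub> FA b c (FA a b f) = FA a c f \<cdot>\<^bsub>A\<^esub> mu a b c X"
    and eta_Hom: "\<lbrakk>a \<in> S; X \<in> Obj A\<rbrakk> \<Longrightarrow> eta a X \<in> Hom A X (FO a a X)"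
    and eta_natural: "\<lbrakk>a \<in> S; f \<in> Hom A X Y\<rbrakk> \<Longrightarrow> eta a Y \<cdot>\<^bsub>A\<^esub> f = FA a a f \<cdot>\<^bsub>A\<^esub> eta a X"
    and UO_Obj: "\<lbrakk>a \<in> S; T \<in> Obj M\<rbrakk> \<Longrightarrow> UO a T \<in> Obj A"
    and act_Hom: "\<lbrakk>a \<in> S; b \<in> S; T \<in> Obj M\<rbrakk> \<Longrightarrow> act T a b \<in> Hom A (FO a b (UO a T)) (UO b T)"
    and act_mu: "\<lbrakk>a \<in> S; b \<in> S; c \<in> S; T \<in> Obj M\<rbrakk>
      \<Longrightarrow> act T a c \<cdot>\<^bsub>A\<^esub> mu a b c (UO a T) = act T b c \<cdot>\<^bsub>A\<^esub> FA b c (act T a b)"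
    and act_eta: "\<lbrakk>a \<in> S; T \<in> Obj M\<rbrakk> \<Longrightarrow> act T a a \<cdot>\<^bsub>A\<^esub> eta a (UO a T) = Ident A (UO a T)"
    and ex_object: "\<lbrakk>\<And>a. a \<in> S \<Longrightarrow> P a \<in> Obj A;
        \<And>a b. \<lbrakk>a \<in> S; b \<in> S\<rbrakk> \<Longrightarrow> pi a b \<in> Hom A (FO a b (P a)) (P b);
        \<And>a b c. \<lbrakk>a \<in> S; b \<in> S; c \<in> S\<rbrakk>
          \<Longrightarrow> pi a c \<cdot>\<^bsub>A\<^esub> mu a b c (P a) = pi b c \<cdot>\<^bsub>A\<^esub> FA b c (pi a b);
        \<And>a. a \<in> S \<Longrightarrow> pi a a \<cdot>\<^bsub>A\<^esub> eta a (P a) = Ident A (P a)\<rbrakk>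
      \<Longrightarrow> \<exists>T\<in>Obj M. (\<forall>a\<in>S. UO a T = P a) \<and> (\<forall>a\<in>S. \<forall>b\<in>S. act T a b = pi a b)"
    and UA_Hom: "\<lbrakk>a \<in> S; u \<in> Hom M T R\<rbrakk> \<Longrightarrow> UA a u \<in> Hom A (UO a T) (UO a R)"
    and UA_act: "\<lbrakk>a \<in> S; b \<in> S; u \<in> Hom M T R\<rbrakk>
      \<Longrightarrow> UA b u \<cdot>\<^bsub>A\<^esub> act T a b = act R a b \<cdot>\<^bsub>A\<^esub> FA a b (UA a u)"
    and ex_arrow: "\<lbrakk>T \<in> Obj M; R \<in> Obj M; \<And>a. a \<in> S \<Longrightarrow> h a \<in> Hom A (UO a T) (UO a R);
        \<And>a b. \<lbrakk>a \<in> S; b \<in> S\<rbrakk> \<Longrightarrow> h b \<cdot>\<^bsub>A\<^esub> act T a b = act R a b \<cdot>\<^bsub>A\<^esub> FA a b (h a)\<rbrakk>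
      \<Longrightarrow> \<exists>u\<in>Hom M T R. \<forall>a\<in>S. UA a u = h a"
    and faithful: "\<lbrakk>u \<in> Hom M T R; v \<in> Hom M T R; \<And>a. a \<in> S \<Longrightarrow> UA a u = UA a v\<rbrakk> \<Longrightarrow> u = v"
    and UA_Ident: "\<lbrakk>a \<in> S; T \<in> Obj M\<rbrakk> \<Longrightarrow> UA a (Ident M T) = Ident A (UO a T)"
    and UA_Comp: "\<lbrakk>a \<in> S; u \<in> Hom M T R; v \<in> Hom M R Q\<rbrakk> \<Longrightarrow> UA a (v \<cdot>\<^bsub>M\<^esub> u) = UA a v \<cdot>\<^bsub>A\<^esub> UA a u"
begin

section \<open>Left adjoints preserve jointly epic families and are additive\<close>

lemma jointly_epic_F:
  assumes ab: "a \<in> S" "b \<in> S" and P: "P \<in> Obj A" and p: "\<And>i. i \<in> I \<Longrightarrow> p i \<in> Hom A (X i) P"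
    and je: "jointly_epic A I P p"
  shows "jointly_epic A I (FO a b P) (\<lambda>i. FA a b (p i))"
  unfolding jointly_epic_def jointly_monic_def Hom_op_cat op_cat_simps
proof (intro allI ballI impI)
  fix W g h assume g: "g \<in> Hom A (FO a b P) W" and h: "h \<in> Hom A (FO a b P) W"
    and eq: "\<forall>i\<in>I. g \<cdot>\<^bsub>A\<^esub> FA a b (p i) = h \<cdot>\<^bsub>A\<^esub> FA a b (p i)"
  \<comment> \<open>Transposed under the adjunction, agreement of \<open>g\<close> and
    \<open>h\<close> on all \<open>FA a b (p i)\<close> becomes agreement of \<open>g'\<close> and
    \<open>h'\<close> on all \<open>p i\<close>, where \<open>je\<close> decides.\<close>
  obtain H e where H: "H \<in> Obj A" "e \<in> Hom A (FO a b H) W"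
    "\<And>X f. \<lbrakk>f \<in> Hom A (FO a b X) W; X \<in> Obj A\<rbrakk> \<Longrightarrow> \<exists>!g. g \<in> Hom A X H \<and> e \<cdot>\<^bsub>A\<^esub> FA a b g = f"
    using F_adjoint[OF ab A.Hom_Obj(2)[OF g]] by blast
  obtain g' where g': "g' \<in> Hom A P H" "e \<cdot>\<^bsub>A\<^esub> FA a b g' = g" using H(3)[OF g P] by blast
  obtain h' where h': "h' \<in> Hom A P H" "e \<cdot>\<^bsub>A\<^esub> FA a b h' = h" using H(3)[OF h P] by blast
  have "g' = h'"
  proof (rule jointly_epicD[OF je g'(1) h'(1)])
    fix i assume i: "i \<in> I"
    have "e \<cdot>\<^bsub>A\<^esub> FA a b (k' \<cdot>\<^bsub>A\<^esub> p i) = k \<cdot>\<^bsub>A\<^esub> FA a b (p i)"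
      if "k' \<in> Hom A P H" "e \<cdot>\<^bsub>A\<^esub> FA a b k' = k" for k k'
      using A.Comp_assoc[OF FA_Hom[OF ab p[OF i]] FA_Hom[OF ab that(1)] H(2)]
        FA_Comp[OF ab p[OF i] that(1)] that by simp
    from this[OF g'] this[OF h'] have
      "e \<cdot>\<^bsub>A\<^esub> FA a b (g' \<cdot>\<^bsub>A\<^esub> p i) = e \<cdot>\<^bsub>A\<^esub> FA a b (h' \<cdot>\<^bsub>A\<^esub> p i)"
      using eq i by simp
    moreover have "g' \<cdot>\<^bsub>A\<^esub> p i \<in> Hom A (X i) H" "h' \<cdot>\<^bsub>A\<^esub> p i \<in> Hom A (X i) H"
      using A.Comp_Hom[OF p[OF i]] g' h' by auto
    moreover have "\<exists>!k. k \<in> Hom A (X i) H \<and> e \<cdot>\<^bsub>A\<^esub> FA a b k = e \<cdot>\<^bsub>A\<^esub> FA a b (h' \<cdot>\<^bsub>A\<^esub> p i)"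
      using A.Hom_Obj[OF p[OF i]] FA_Hom[OF ab A.Comp_Hom[OF p[OF i] h'(1)]]
      by (intro H(3) A.Comp_Hom[OF _ H(2)]) auto
    ultimately show "g' \<cdot>\<^bsub>A\<^esub> p i = h' \<cdot>\<^bsub>A\<^esub> p i" by blast
  qed
  then show "g = h" using g' h' by simp
qed

text \<open>An initial object is an object on which the empty family is jointly epic. This survives
  the functor, so parallel arrows out of \<open>FO a b Z\<close> coincide, and a zero arrow factors
  through \<open>Z\<close>.\<close>

lemma FA_zero:
  assumes ab: "a \<in> S" "b \<in> S" and X: "X \<in> Obj A" and Y: "Y \<in> Obj A"
  shows "FA a b (zero X Y) = zero (FO a b X) (FO a b Y)"
proof -
  obtain Z where Z: "zero_object A Z" using A.zero_ex by blast
  then have ZO: "Z \<in> Obj A" by (simp add: zero_object_def)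
  have "jointly_epic A ({} :: 'a set) Z undefined"
    using Z A.Hom_Obj unfolding jointly_epic_def jointly_monic_def zero_object_def by auto blast
  then have je: "jointly_epic A ({} :: 'a set) (FO a b Z) (\<lambda>i. FA a b (undefined i))"
    by (rule jointly_epic_F[OF ab ZO, rotated]) simp
  note FX = FO_Obj[OF ab]
  have "FA a b (zero Z Y) = zero (FO a b Z) (FO a b Y)"
    by (rule jointly_epicD[OF je FA_Hom[OF ab A.zero_Hom[OF ZO Y]] A.zero_Hom[OF FX[OF ZO] FX[OF Y]]]) simp
  moreover have "zero X Y = zero Z Y \<cdot>\<^bsub>A\<^esub> zero X Z"
    using A.Comp_zero[OF A.zero_Hom[OF ZO Y] X] by simp
  ultimately show ?thesis
    using FA_Comp[OF ab A.zero_Hom[OF X ZO] A.zero_Hom[OF ZO Y]]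
      A.zero_Comp[OF FA_Hom[OF ab A.zero_Hom[OF X ZO]] FX[OF Y]] by simp
qed

text \<open>The sum \<open>plus f g\<close> is the codiagonal \<open>s\<close> of
  \<open>Y \<oplus> Y\<close> after the pairing \<open>h\<close> of \<open>f\<close> and
  \<open>g\<close>, so it suffices to follow a biproduct diagram through the functor. Its injections
  are jointly epic; by \<open>jointly_epic_F\<close> so are their images, and this forces the images
  of injections and projections to satisfy the biproduct identity again.\<close>

lemma FA_plus:
  assumes ab: "a \<in> S" "b \<in> S" and f: "f \<in> Hom A X Y" and g: "g \<in> Hom A X Y"
  shows "FA a b (plus f g) = plus (FA a b f) (FA a b g)"
proof -
  have X: "X \<in> Obj A" and Y: "Y \<in> Obj A" using A.Hom_Obj[OF f] by auto
  have IY: "Ident A Y \<in> Hom A Y Y" and z: "zero Y Y \<in> Hom A Y Y"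
    using Y A.Ident_Hom A.zero_Hom by auto
  obtain P p where P: "is_product A (UNIV :: bool set) (case_bool Y Y) P p"
    using ex_binary_product_A[OF Y Y] by blast
  note PO = A.is_productD(1)[OF P]
  have p: "p j \<in> Hom A P Y" for j using A.is_productD(2)[OF P, of j] by (auto split: bool.splits)
  have pair: "\<exists>h. h \<in> Hom A W P \<and> p True \<cdot>\<^bsub>A\<^esub> h = k \<and> p False \<cdot>\<^bsub>A\<^esub> h = l"
    if kl: "k \<in> Hom A W Y" "l \<in> Hom A W Y" for W k l
  proof -
    have "case_bool k l j \<in> Hom A W (case_bool Y Y j)" for j using kl by (cases j) auto
    then obtain h where "h \<in> Hom A W P" "\<And>j. p j \<cdot>\<^bsub>A\<^esub> h = case_bool k l j"
      using A.is_productD(4)[OF P A.Hom_Obj(1)[OF kl(1)], of "case_bool k l"] by blast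
    then show ?thesis by (intro exI[of _ h]) simp
  qed
  obtain i1 where i1: "i1 \<in> Hom A Y P" "p True \<cdot>\<^bsub>A\<^esub> i1 = Ident A Y" "p False \<cdot>\<^bsub>A\<^esub> i1 = zero Y Y"
    using pair[OF IY z] by blast
  obtain i2 where i2: "i2 \<in> Hom A Y P" "p True \<cdot>\<^bsub>A\<^esub> i2 = zero Y Y" "p False \<cdot>\<^bsub>A\<^esub> i2 = Ident A Y"
    using pair[OF z IY] by blast
  obtain h where h: "h \<in> Hom A X P" "p True \<cdot>\<^bsub>A\<^esub> h = f" "p False \<cdot>\<^bsub>A\<^esub> h = g"
    using pair[OF f g] by blast
  have i1p: "i1 \<cdot>\<^bsub>A\<^esub> p True \<in> Hom A P P" and i2p: "i2 \<cdot>\<^bsub>A\<^esub> p False \<in> Hom A P P"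
    using A.Comp_Hom[OF p] i1 i2 by auto
  \<comment> \<open>Here the product becomes a biproduct: the identity is checked after both
    projections, where it reads off the definition of \<open>i1\<close> and
    \<open>i2\<close>.\<close>
  have sum_ip: "plus (i1 \<cdot>\<^bsub>A\<^esub> p True) (i2 \<cdot>\<^bsub>A\<^esub> p False) = Ident A P"
  proof (rule A.is_productD(3)[OF P A.plus_Hom[OF i1p i2p] A.Ident_Hom[OF PO]])
    fix j :: bool
    have "p j \<cdot>\<^bsub>A\<^esub> plus (i1 \<cdot>\<^bsub>A\<^esub> p True) (i2 \<cdot>\<^bsub>A\<^esub> p False)
        = plus ((p j \<cdot>\<^bsub>A\<^esub> i1) \<cdot>\<^bsub>A\<^esub> p True) ((p j \<cdot>\<^bsub>A\<^esub> i2) \<cdot>\<^bsub>A\<^esub> p False)"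
      using A.Comp_plus[OF i1p i2p p] A.Comp_assoc[OF p i1(1) p] A.Comp_assoc[OF p i2(1) p] by simp
    also have "\<dots> = p j"
      using i1 i2 A.Ident_Comp[OF p] A.zero_Comp[OF p Y] A.plus_zero[OF p] by (cases j) simp_all
    finally show "p j \<cdot>\<^bsub>A\<^esub> plus (i1 \<cdot>\<^bsub>A\<^esub> p True) (i2 \<cdot>\<^bsub>A\<^esub> p False) = p j \<cdot>\<^bsub>A\<^esub> Ident A P"
      using A.Comp_Ident[OF p] by simp
  qed
  have ii: "case_bool i1 i2 j \<in> Hom A Y P" for j using i1 i2 by (cases j) auto
  have split: "k = plus (k \<cdot>\<^bsub>A\<^esub> i1 \<cdot>\<^bsub>A\<^esub> p True) (k \<cdot>\<^bsub>A\<^esub> i2 \<cdot>\<^bsub>A\<^esub> p False)" if "k \<in> Hom A P W" for k W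
    using A.Comp_plus[OF i1p i2p that] sum_ip A.Comp_Ident[OF that] by simp
  have "jointly_epic A UNIV P (case_bool i1 i2)"
    unfolding jointly_epic_def jointly_monic_def Hom_op_cat op_cat_simps
  proof (intro allI ballI impI)
    fix W k l assume kl: "k \<in> Hom A P W" "l \<in> Hom A P W"
      "\<forall>j\<in>UNIV. k \<cdot>\<^bsub>A\<^esub> case_bool i1 i2 j = l \<cdot>\<^bsub>A\<^esub> case_bool i1 i2 j"
    have "k \<cdot>\<^bsub>A\<^esub> i1 = l \<cdot>\<^bsub>A\<^esub> i1" "k \<cdot>\<^bsub>A\<^esub> i2 = l \<cdot>\<^bsub>A\<^esub> i2"
      using kl(3)[rule_format, of True] kl(3)[rule_format, of False] by auto
    then have "k \<cdot>\<^bsub>A\<^esub> i1 \<cdot>\<^bsub>A\<^esub> p True = l \<cdot>\<^bsub>A\<^esub> i1 \<cdot>\<^bsub>A\<^esub> p True"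
        "k \<cdot>\<^bsub>A\<^esub> i2 \<cdot>\<^bsub>A\<^esub> p False = l \<cdot>\<^bsub>A\<^esub> i2 \<cdot>\<^bsub>A\<^esub> p False"
      using A.Comp_assoc[OF p i1(1) kl(1)] A.Comp_assoc[OF p i1(1) kl(2)]
        A.Comp_assoc[OF p i2(1) kl(1)] A.Comp_assoc[OF p i2(1) kl(2)] by metis+
    then show "k = l" using split[OF kl(1)] split[OF kl(2)] by simp
  qed
  then have je: "jointly_epic A UNIV (FO a b P) (\<lambda>j. FA a b (case_bool i1 i2 j))"
    using jointly_epic_F[OF ab PO, of UNIV "case_bool i1 i2" "\<lambda>_. Y"] ii by blast
  note Fp = FA_Hom[OF ab p] and Fi1 = FA_Hom[OF ab i1(1)] and Fi2 = FA_Hom[OF ab i2(1)]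
  note Fh = FA_Hom[OF ab h(1)]
  have Fi1p: "FA a b i1 \<cdot>\<^bsub>A\<^esub> FA a b (p True) \<in> Hom A (FO a b P) (FO a b P)"
    and Fi2p: "FA a b i2 \<cdot>\<^bsub>A\<^esub> FA a b (p False) \<in> Hom A (FO a b P) (FO a b P)"
    using A.Comp_Hom[OF Fp] Fi1 Fi2 by auto
  have FP: "FO a b P \<in> Obj A" "FO a b Y \<in> Obj A" using FO_Obj ab PO Y by auto
  \<comment> \<open>Tested on the images of the injections, where only composites of a projection
    with an injection remain. They are identities or zero, and the zeros are preserved by
    \<open>FA_zero\<close>.\<close>
  have sum_Fip: "plus (FA a b i1 \<cdot>\<^bsub>A\<^esub> FA a b (p True)) (FA a b i2 \<cdot>\<^bsub>A\<^esub> FA a b (p False)) = Ident A (FO a b P)"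
  proof (rule jointly_epicD[OF je A.plus_Hom[OF Fi1p Fi2p] A.Ident_Hom[OF FP(1)]])
    fix j :: bool
    note Fii = FA_Hom[OF ab ii]
    have "plus (FA a b i1 \<cdot>\<^bsub>A\<^esub> FA a b (p True)) (FA a b i2 \<cdot>\<^bsub>A\<^esub> FA a b (p False)) \<cdot>\<^bsub>A\<^esub> FA a b (case_bool i1 i2 j)
      = plus (FA a b i1 \<cdot>\<^bsub>A\<^esub> FA a b (p True \<cdot>\<^bsub>A\<^esub> case_bool i1 i2 j)) (FA a b i2 \<cdot>\<^bsub>A\<^esub> FA a b (p False \<cdot>\<^bsub>A\<^esub> case_bool i1 i2 j))"
      using A.plus_Comp[OF Fii Fi1p Fi2p] A.Comp_assoc[OF Fii Fp Fi1] A.Comp_assoc[OF Fii Fp Fi2]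
        FA_Comp[OF ab ii p] by simp
    also have "\<dots> = FA a b (case_bool i1 i2 j)"
      using i1 i2 FA_Ident[OF ab Y] FA_zero[OF ab Y Y] A.Comp_Ident[OF Fi1] A.Comp_Ident[OF Fi2]
        A.Comp_zero[OF Fi1 FP(2)] A.Comp_zero[OF Fi2 FP(2)] A.plus_zero[OF Fi1] A.plus_zero[OF Fi2]
      by (cases j) simp_all
    finally show "plus (FA a b i1 \<cdot>\<^bsub>A\<^esub> FA a b (p True)) (FA a b i2 \<cdot>\<^bsub>A\<^esub> FA a b (p False)) \<cdot>\<^bsub>A\<^esub> FA a b (case_bool i1 i2 j)
      = Ident A (FO a b P) \<cdot>\<^bsub>A\<^esub> FA a b (case_bool i1 i2 j)"
      using A.Ident_Comp[OF Fii] by simp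
  qed
  \<comment> \<open>The codiagonal: it is the identity along both injections, so inserting
    \<open>sum_Fip\<close> computes \<open>FA a b s\<close>.\<close>
  define s where "s = plus (p True) (p False)"
  have s: "s \<in> Hom A P Y" unfolding s_def using A.plus_Hom p by simp
  note Fs = FA_Hom[OF ab s]
  have si: "s \<cdot>\<^bsub>A\<^esub> i1 = Ident A Y" "s \<cdot>\<^bsub>A\<^esub> i2 = Ident A Y"
    unfolding s_def using A.plus_Comp[OF i1(1) p p] A.plus_Comp[OF i2(1) p p] i1 i2 A.plus_zero[OF IY] by auto
  have "s \<cdot>\<^bsub>A\<^esub> h = plus f g" unfolding s_def using A.plus_Comp[OF h(1) p p] h by simp
  then have "FA a b (plus f g) = FA a b s \<cdot>\<^bsub>A\<^esub> FA a b h" using FA_Comp[OF ab h(1) s] by simp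
  also have "FA a b s = plus (FA a b (p True)) (FA a b (p False))"
  proof -
    have "FA a b s = FA a b s \<cdot>\<^bsub>A\<^esub> plus (FA a b i1 \<cdot>\<^bsub>A\<^esub> FA a b (p True)) (FA a b i2 \<cdot>\<^bsub>A\<^esub> FA a b (p False))"
      using sum_Fip A.Comp_Ident[OF Fs] by simp
    also have "\<dots> = plus ((FA a b s \<cdot>\<^bsub>A\<^esub> FA a b i1) \<cdot>\<^bsub>A\<^esub> FA a b (p True)) ((FA a b s \<cdot>\<^bsub>A\<^esub> FA a b i2) \<cdot>\<^bsub>A\<^esub> FA a b (p False))"
      using A.Comp_plus[OF Fi1p Fi2p Fs] A.Comp_assoc[OF Fp Fi1 Fs] A.Comp_assoc[OF Fp Fi2 Fs] by simp
    also have "\<dots> = plus (FA a b (p True)) (FA a b (p False))"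
      using FA_Comp[OF ab i1(1) s] FA_Comp[OF ab i2(1) s] si FA_Ident[OF ab Y] A.Ident_Comp[OF Fp] by simp
    finally show ?thesis .
  qed
  also have "plus (FA a b (p True)) (FA a b (p False)) \<cdot>\<^bsub>A\<^esub> FA a b h = plus (FA a b f) (FA a b g)"
    using A.plus_Comp[OF Fh Fp Fp, of True False] FA_Comp[OF ab h(1) p[of True]]
      FA_Comp[OF ab h(1) p[of False]] h by simp
  finally show ?thesis .
qed

section \<open>Actions and equivariance transported along jointly monic and jointly epic
  families\<close>

lemma lift_source:
  assumes X: "\<And>i. i \<in> I \<Longrightarrow> X i \<in> Obj M" and P: "\<And>a. a \<in> S \<Longrightarrow> P a \<in> Obj A"
    and p: "\<And>a i. \<lbrakk>a \<in> S; i \<in> I\<rbrakk> \<Longrightarrow> p a i \<in> Hom A (P a) (UO a (X i))"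
    and jm: "\<And>a. a \<in> S \<Longrightarrow> jointly_monic A I (P a) (p a)"
    and fac: "\<And>a b. \<lbrakk>a \<in> S; b \<in> S\<rbrakk> \<Longrightarrow>
      \<exists>m\<in>Hom A (FO a b (P a)) (P b). \<forall>i\<in>I. p b i \<cdot>\<^bsub>A\<^esub> m = act (X i) a b \<cdot>\<^bsub>A\<^esub> FA a b (p a i)"
  obtains Q q where "Q \<in> Obj M" "\<And>a. a \<in> S \<Longrightarrow> UO a Q = P a" "\<And>i. i \<in> I \<Longrightarrow> q i \<in> Hom M Q (X i)"
    "\<And>a i. \<lbrakk>a \<in> S; i \<in> I\<rbrakk> \<Longrightarrow> UA a (q i) = p a i"
proof -
  obtain m where m: "\<And>a b. \<lbrakk>a \<in> S; b \<in> S\<rbrakk> \<Longrightarrow> m a b \<in> Hom A (FO a b (P a)) (P b)"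
    "\<And>a b i. \<lbrakk>a \<in> S; b \<in> S; i \<in> I\<rbrakk> \<Longrightarrow> p b i \<cdot>\<^bsub>A\<^esub> m a b = act (X i) a b \<cdot>\<^bsub>A\<^esub> FA a b (p a i)"
    using fac by metis
  \<comment> \<open>Equivariance of the legs forces the action to be \<open>m\<close>. The module
    axioms are equations between arrows into \<open>P c\<close> and \<open>P a\<close>, so they may
    be tested after the legs, where naturality of \<open>mu\<close> and \<open>eta\<close> reduces
    them to the axioms of \<open>X i\<close>.\<close>
  have "\<exists>T\<in>Obj M. (\<forall>a\<in>S. UO a T = P a) \<and> (\<forall>a\<in>S. \<forall>b\<in>S. act T a b = m a b)"
  proof (rule ex_object[OF P m(1)])
    fix a b c assume a: "a \<in> S" and b: "b \<in> S" and c: "c \<in> S"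
    note mu = mu_Hom[OF a b c P[OF a]]
    note Fm = FA_Hom[OF b c m(1)[OF a b]]
    show "m a c \<cdot>\<^bsub>A\<^esub> mu a b c (P a) = m b c \<cdot>\<^bsub>A\<^esub> FA b c (m a b)"
    proof (rule jointly_monicD[OF jm[OF c] A.Comp_Hom[OF mu m(1)[OF a c]] A.Comp_Hom[OF Fm m(1)[OF b c]]])
      fix i assume i: "i \<in> I"
      note Xi = X[OF i]
      note UX = UO_Obj[OF a Xi] and Fp = FA_Hom[OF a b p[OF a i]]
      have "p c i \<cdot>\<^bsub>A\<^esub> m a c \<cdot>\<^bsub>A\<^esub> mu a b c (P a) = act (X i) a c \<cdot>\<^bsub>A\<^esub> FA a c (p a i) \<cdot>\<^bsub>A\<^esub> mu a b c (P a)"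
        using A.Comp_assoc[OF mu m(1)[OF a c] p[OF c i]] m(2)[OF a c i]
          A.Comp_assoc[OF mu FA_Hom[OF a c p[OF a i]] act_Hom[OF a c Xi]] by simp
      also have "\<dots> = (act (X i) b c \<cdot>\<^bsub>A\<^esub> FA b c (act (X i) a b)) \<cdot>\<^bsub>A\<^esub> FA b c (FA a b (p a i))"
        using mu_natural[OF a b c p[OF a i]] act_mu[OF a b c Xi]
          A.Comp_assoc[OF FA_Hom[OF b c Fp] mu_Hom[OF a b c UX] act_Hom[OF a c Xi]] by simp
      also have "\<dots> = act (X i) b c \<cdot>\<^bsub>A\<^esub> FA b c (p b i \<cdot>\<^bsub>A\<^esub> m a b)"
        using A.Comp_assoc[OF FA_Hom[OF b c Fp] FA_Hom[OF b c act_Hom[OF a b Xi]] act_Hom[OF b c Xi]]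
          FA_Comp[OF b c Fp act_Hom[OF a b Xi]] m(2)[OF a b i] by simp
      also have "\<dots> = p c i \<cdot>\<^bsub>A\<^esub> m b c \<cdot>\<^bsub>A\<^esub> FA b c (m a b)"
        using FA_Comp[OF b c m(1)[OF a b] p[OF b i]] m(2)[OF b c i] A.Comp_assoc[OF Fm m(1)[OF b c] p[OF c i]]
          A.Comp_assoc[OF Fm FA_Hom[OF b c p[OF b i]] act_Hom[OF b c Xi]] by simp
      finally show "p c i \<cdot>\<^bsub>A\<^esub> m a c \<cdot>\<^bsub>A\<^esub> mu a b c (P a) = p c i \<cdot>\<^bsub>A\<^esub> m b c \<cdot>\<^bsub>A\<^esub> FA b c (m a b)" .
    qed
  next
    fix a assume a: "a \<in> S"
    note eta = eta_Hom[OF a P[OF a]]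
    show "m a a \<cdot>\<^bsub>A\<^esub> eta a (P a) = Ident A (P a)"
    proof (rule jointly_monicD[OF jm[OF a] A.Comp_Hom[OF eta m(1)[OF a a]] A.Ident_Hom[OF P[OF a]]])
      fix i assume i: "i \<in> I"
      note Xi = X[OF i]
      have "p a i \<cdot>\<^bsub>A\<^esub> m a a \<cdot>\<^bsub>A\<^esub> eta a (P a) = act (X i) a a \<cdot>\<^bsub>A\<^esub> eta a (UO a (X i)) \<cdot>\<^bsub>A\<^esub> p a i"
        using A.Comp_assoc[OF eta m(1)[OF a a] p[OF a i]] m(2)[OF a a i]
          A.Comp_assoc[OF eta FA_Hom[OF a a p[OF a i]] act_Hom[OF a a Xi]] eta_natural[OF a p[OF a i]]
        by simp
      also have "\<dots> = p a i"
        using A.Comp_assoc[OF p[OF a i] eta_Hom[OF a UO_Obj[OF a Xi]] act_Hom[OF a a Xi]] act_eta[OF a Xi]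
          A.Ident_Comp[OF p[OF a i]] by simp
      finally show "p a i \<cdot>\<^bsub>A\<^esub> m a a \<cdot>\<^bsub>A\<^esub> eta a (P a) = p a i \<cdot>\<^bsub>A\<^esub> Ident A (P a)"
        using A.Comp_Ident[OF p[OF a i]] by simp
    qed
  qed
  then obtain Q where Q: "Q \<in> Obj M" "\<And>a. a \<in> S \<Longrightarrow> UO a Q = P a"
    "\<And>a b. \<lbrakk>a \<in> S; b \<in> S\<rbrakk> \<Longrightarrow> act Q a b = m a b"
    by blast
  have "\<exists>u\<in>Hom M Q (X i). \<forall>a\<in>S. UA a u = p a i" if "i \<in> I" for i
    by (rule ex_arrow) (use Q X p m that in auto)
  then obtain q where "\<And>i. i \<in> I \<Longrightarrow> q i \<in> Hom M Q (X i) \<and> (\<forall>a\<in>S. UA a (q i) = p a i)" by metis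
  then show ?thesis using that[of Q q] Q by blast
qed

text \<open>This does not follow from \<open>lift_source\<close> by reversing arrows, because the
  functors stay on the domain side of the actions. The associativity equation now starts at
  \<open>FO b c (FO a b (P a))\<close>, and testing it on the sink needs that two applications of
  the functors keep the sink jointly epic.\<close>

lemma lift_sink:
  assumes X: "\<And>i. i \<in> I \<Longrightarrow> X i \<in> Obj M" and P: "\<And>a. a \<in> S \<Longrightarrow> P a \<in> Obj A"
    and p: "\<And>a i. \<lbrakk>a \<in> S; i \<in> I\<rbrakk> \<Longrightarrow> p a i \<in> Hom A (UO a (X i)) (P a)"
    and je: "\<And>a. a \<in> S \<Longrightarrow> jointly_epic A I (P a) (p a)"
    and fac: "\<And>a b. \<lbrakk>a \<in> S; b \<in> S\<rbrakk> \<Longrightarrow>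
      \<exists>m\<in>Hom A (FO a b (P a)) (P b). \<forall>i\<in>I. m \<cdot>\<^bsub>A\<^esub> FA a b (p a i) = p b i \<cdot>\<^bsub>A\<^esub> act (X i) a b"
  obtains Q q where "Q \<in> Obj M" "\<And>a. a \<in> S \<Longrightarrow> UO a Q = P a" "\<And>i. i \<in> I \<Longrightarrow> q i \<in> Hom M (X i) Q"
    "\<And>a i. \<lbrakk>a \<in> S; i \<in> I\<rbrakk> \<Longrightarrow> UA a (q i) = p a i"
proof -
  obtain m where m: "\<And>a b. \<lbrakk>a \<in> S; b \<in> S\<rbrakk> \<Longrightarrow> m a b \<in> Hom A (FO a b (P a)) (P b)"
    "\<And>a b i. \<lbrakk>a \<in> S; b \<in> S; i \<in> I\<rbrakk> \<Longrightarrow> m a b \<cdot>\<^bsub>A\<^esub> FA a b (p a i) = p b i \<cdot>\<^bsub>A\<^esub> act (X i) a b"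
    using fac by metis
  have "\<exists>T\<in>Obj M. (\<forall>a\<in>S. UO a T = P a) \<and> (\<forall>a\<in>S. \<forall>b\<in>S. act T a b = m a b)"
  proof (rule ex_object[OF P m(1)])
    fix a b c assume a: "a \<in> S" and b: "b \<in> S" and c: "c \<in> S"
    note mu = mu_Hom[OF a b c P[OF a]]
    note Fm = FA_Hom[OF b c m(1)[OF a b]]
    have jeF: "jointly_epic A I (FO a b (P a)) (\<lambda>i. FA a b (p a i))"
      by (rule jointly_epic_F[OF a b P[OF a] _ je[OF a]]) (rule p[OF a])
    have jeFF: "jointly_epic A I (FO b c (FO a b (P a))) (\<lambda>i. FA b c (FA a b (p a i)))"
      by (rule jointly_epic_F[OF b c FO_Obj[OF a b P[OF a]] _ jeF]) (rule FA_Hom[OF a b p[OF a]])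
    show "m a c \<cdot>\<^bsub>A\<^esub> mu a b c (P a) = m b c \<cdot>\<^bsub>A\<^esub> FA b c (m a b)"
    proof (rule jointly_epicD[OF jeFF A.Comp_Hom[OF mu m(1)[OF a c]] A.Comp_Hom[OF Fm m(1)[OF b c]]])
      fix i assume i: "i \<in> I"
      note Xi = X[OF i]
      note UX = UO_Obj[OF a Xi] and Fp = FA_Hom[OF a b p[OF a i]]
      note FFp = FA_Hom[OF b c Fp] and Fact = FA_Hom[OF b c act_Hom[OF a b Xi]]
      have "(m a c \<cdot>\<^bsub>A\<^esub> mu a b c (P a)) \<cdot>\<^bsub>A\<^esub> FA b c (FA a b (p a i))
          = (m a c \<cdot>\<^bsub>A\<^esub> FA a c (p a i)) \<cdot>\<^bsub>A\<^esub> mu a b c (UO a (X i))"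
        using A.Comp_assoc[OF FFp mu m(1)[OF a c]] mu_natural[OF a b c p[OF a i]]
          A.Comp_assoc[OF mu_Hom[OF a b c UX] FA_Hom[OF a c p[OF a i]] m(1)[OF a c]] by simp
      also have "\<dots> = p c i \<cdot>\<^bsub>A\<^esub> act (X i) b c \<cdot>\<^bsub>A\<^esub> FA b c (act (X i) a b)"
        using m(2)[OF a c i] A.Comp_assoc[OF mu_Hom[OF a b c UX] act_Hom[OF a c Xi] p[OF c i]]
          act_mu[OF a b c Xi] by simp
      also have "\<dots> = m b c \<cdot>\<^bsub>A\<^esub> FA b c (p b i \<cdot>\<^bsub>A\<^esub> act (X i) a b)"
        using A.Comp_assoc[OF Fact act_Hom[OF b c Xi] p[OF c i]] m(2)[OF b c i]
          A.Comp_assoc[OF Fact FA_Hom[OF b c p[OF b i]] m(1)[OF b c]] FA_Comp[OF b c act_Hom[OF a b Xi] p[OF b i]]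
        by simp
      also have "\<dots> = (m b c \<cdot>\<^bsub>A\<^esub> FA b c (m a b)) \<cdot>\<^bsub>A\<^esub> FA b c (FA a b (p a i))"
        using m(2)[OF a b i] FA_Comp[OF b c Fp m(1)[OF a b]] A.Comp_assoc[OF FFp Fm m(1)[OF b c]] by simp
      finally show "(m a c \<cdot>\<^bsub>A\<^esub> mu a b c (P a)) \<cdot>\<^bsub>A\<^esub> FA b c (FA a b (p a i))
        = (m b c \<cdot>\<^bsub>A\<^esub> FA b c (m a b)) \<cdot>\<^bsub>A\<^esub> FA b c (FA a b (p a i))" .
    qed
  next
    fix a assume a: "a \<in> S"
    note eta = eta_Hom[OF a P[OF a]]
    show "m a a \<cdot>\<^bsub>A\<^esub> eta a (P a) = Ident A (P a)"
    proof (rule jointly_epicD[OF je[OF a] A.Comp_Hom[OF eta m(1)[OF a a]] A.Ident_Hom[OF P[OF a]]])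
      fix i assume i: "i \<in> I"
      note Xi = X[OF i]
      note etaX = eta_Hom[OF a UO_Obj[OF a Xi]]
      have "(m a a \<cdot>\<^bsub>A\<^esub> eta a (P a)) \<cdot>\<^bsub>A\<^esub> p a i = (m a a \<cdot>\<^bsub>A\<^esub> FA a a (p a i)) \<cdot>\<^bsub>A\<^esub> eta a (UO a (X i))"
        using A.Comp_assoc[OF p[OF a i] eta m(1)[OF a a]] eta_natural[OF a p[OF a i]]
          A.Comp_assoc[OF etaX FA_Hom[OF a a p[OF a i]] m(1)[OF a a]] by simp
      also have "\<dots> = p a i"
        using m(2)[OF a a i] A.Comp_assoc[OF etaX act_Hom[OF a a Xi] p[OF a i]] act_eta[OF a Xi]
          A.Comp_Ident[OF p[OF a i]] by simp
      finally show "(m a a \<cdot>\<^bsub>A\<^esub> eta a (P a)) \<cdot>\<^bsub>A\<^esub> p a i = Ident A (P a) \<cdot>\<^bsub>A\<^esub> p a i"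
        using A.Ident_Comp[OF p[OF a i]] by simp
    qed
  qed
  then obtain Q where Q: "Q \<in> Obj M" "\<And>a. a \<in> S \<Longrightarrow> UO a Q = P a"
    "\<And>a b. \<lbrakk>a \<in> S; b \<in> S\<rbrakk> \<Longrightarrow> act Q a b = m a b"
    by blast
  have "\<exists>u\<in>Hom M (X i) Q. \<forall>a\<in>S. UA a u = p a i" if "i \<in> I" for i
    by (rule ex_arrow) (use Q X p m that in auto)
  then obtain q where "\<And>i. i \<in> I \<Longrightarrow> q i \<in> Hom M (X i) Q \<and> (\<forall>a\<in>S. UA a (q i) = p a i)" by metis
  then show ?thesis using that[of Q q] Q by blast
qed

text \<open>Equivariance of \<open>h\<close> is an equation with values in \<open>UO b Q\<close>,
  which the jointly monic legs detect; after the legs it is the equivariance of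
  \<open>r i\<close>.\<close>

lemma factor_source:
  assumes Q: "Q \<in> Obj M" and R: "R \<in> Obj M"
    and q: "\<And>i. i \<in> I \<Longrightarrow> q i \<in> Hom M Q (X i)" and r: "\<And>i. i \<in> I \<Longrightarrow> r i \<in> Hom M R (X i)"
    and jm: "\<And>a. a \<in> S \<Longrightarrow> jointly_monic A I (UO a Q) (\<lambda>i. UA a (q i))"
    and h: "\<And>a. a \<in> S \<Longrightarrow> h a \<in> Hom A (UO a R) (UO a Q)"
    and qh: "\<And>a i. \<lbrakk>a \<in> S; i \<in> I\<rbrakk> \<Longrightarrow> UA a (q i) \<cdot>\<^bsub>A\<^esub> h a = UA a (r i)"
  shows "\<exists>u\<in>Hom M R Q. \<forall>a\<in>S. UA a u = h a"
proof (rule ex_arrow[OF R Q h])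
  fix a b assume a: "a \<in> S" and b: "b \<in> S"
  note Fh = FA_Hom[OF a b h[OF a]]
  show "h b \<cdot>\<^bsub>A\<^esub> act R a b = act Q a b \<cdot>\<^bsub>A\<^esub> FA a b (h a)"
  proof (rule jointly_monicD[OF jm[OF b] A.Comp_Hom[OF act_Hom[OF a b R] h[OF b]] A.Comp_Hom[OF Fh act_Hom[OF a b Q]]])
    fix i assume i: "i \<in> I"
    note X = M.Hom_Obj(2)[OF q[OF i]]
    note qa = UA_Hom[OF a q[OF i]] and qb = UA_Hom[OF b q[OF i]]
    have "UA b (q i) \<cdot>\<^bsub>A\<^esub> h b \<cdot>\<^bsub>A\<^esub> act R a b = UA b (r i) \<cdot>\<^bsub>A\<^esub> act R a b"
      using A.Comp_assoc[OF act_Hom[OF a b R] h[OF b] qb] qh[OF b i] by simp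
    also have "\<dots> = act (X i) a b \<cdot>\<^bsub>A\<^esub> FA a b (UA a (q i)) \<cdot>\<^bsub>A\<^esub> FA a b (h a)"
      using UA_act[OF a b r[OF i]] qh[OF a i] FA_Comp[OF a b h[OF a] qa] by simp
    also have "\<dots> = UA b (q i) \<cdot>\<^bsub>A\<^esub> act Q a b \<cdot>\<^bsub>A\<^esub> FA a b (h a)"
      using A.Comp_assoc[OF Fh FA_Hom[OF a b qa] act_Hom[OF a b X]] UA_act[OF a b q[OF i]]
        A.Comp_assoc[OF Fh act_Hom[OF a b Q] qb] by simp
    finally show "UA b (q i) \<cdot>\<^bsub>A\<^esub> h b \<cdot>\<^bsub>A\<^esub> act R a b = UA b (q i) \<cdot>\<^bsub>A\<^esub> act Q a b \<cdot>\<^bsub>A\<^esub> FA a b (h a)" .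
  qed
qed

text \<open>Here equivariance is an equation of arrows out of \<open>FO a b (UO a Q)\<close>, so the
  legs have to be jointly epic after the functor has been applied.\<close>

lemma factor_sink:
  assumes Q: "Q \<in> Obj M" and R: "R \<in> Obj M"
    and q: "\<And>i. i \<in> I \<Longrightarrow> q i \<in> Hom M (X i) Q" and r: "\<And>i. i \<in> I \<Longrightarrow> r i \<in> Hom M (X i) R"
    and je: "\<And>a. a \<in> S \<Longrightarrow> jointly_epic A I (UO a Q) (\<lambda>i. UA a (q i))"
    and h: "\<And>a. a \<in> S \<Longrightarrow> h a \<in> Hom A (UO a Q) (UO a R)"
    and hq: "\<And>a i. \<lbrakk>a \<in> S; i \<in> I\<rbrakk> \<Longrightarrow> h a \<cdot>\<^bsub>A\<^esub> UA a (q i) = UA a (r i)"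
  shows "\<exists>u\<in>Hom M Q R. \<forall>a\<in>S. UA a u = h a"
proof (rule ex_arrow[OF Q R h])
  fix a b assume a: "a \<in> S" and b: "b \<in> S"
  note Fh = FA_Hom[OF a b h[OF a]]
  have jeF: "jointly_epic A I (FO a b (UO a Q)) (\<lambda>i. FA a b (UA a (q i)))"
    by (rule jointly_epic_F[OF a b UO_Obj[OF a Q] _ je[OF a]]) (rule UA_Hom[OF a q])
  show "h b \<cdot>\<^bsub>A\<^esub> act Q a b = act R a b \<cdot>\<^bsub>A\<^esub> FA a b (h a)"
  proof (rule jointly_epicD[OF jeF A.Comp_Hom[OF act_Hom[OF a b Q] h[OF b]] A.Comp_Hom[OF Fh act_Hom[OF a b R]]])
    fix i assume i: "i \<in> I"
    note X = M.Hom_Obj(1)[OF q[OF i]]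
    note qa = UA_Hom[OF a q[OF i]] and qb = UA_Hom[OF b q[OF i]]
    note Fqa = FA_Hom[OF a b qa]
    have "(h b \<cdot>\<^bsub>A\<^esub> act Q a b) \<cdot>\<^bsub>A\<^esub> FA a b (UA a (q i)) = UA b (r i) \<cdot>\<^bsub>A\<^esub> act (X i) a b"
      using A.Comp_assoc[OF Fqa act_Hom[OF a b Q] h[OF b]] UA_act[OF a b q[OF i]]
        A.Comp_assoc[OF act_Hom[OF a b X] qb h[OF b]] hq[OF b i] by simp
    also have "\<dots> = (act R a b \<cdot>\<^bsub>A\<^esub> FA a b (h a)) \<cdot>\<^bsub>A\<^esub> FA a b (UA a (q i))"
      using UA_act[OF a b r[OF i]] hq[OF a i] FA_Comp[OF a b qa h[OF a]]
        A.Comp_assoc[OF Fqa Fh act_Hom[OF a b R]] by simp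
    finally show "(h b \<cdot>\<^bsub>A\<^esub> act Q a b) \<cdot>\<^bsub>A\<^esub> FA a b (UA a (q i))
      = (act R a b \<cdot>\<^bsub>A\<^esub> FA a b (h a)) \<cdot>\<^bsub>A\<^esub> FA a b (UA a (q i))" .
  qed
qed

section \<open>Sums, zeros and negatives of equivariant families\<close>

lemma lift_plus:
  assumes u: "u \<in> Hom M T R" and v: "v \<in> Hom M T R"
  shows "\<exists>w\<in>Hom M T R. \<forall>a\<in>S. UA a w = plus (UA a u) (UA a v)"
proof (rule ex_arrow)
  show T: "T \<in> Obj M" and R: "R \<in> Obj M" using M.Hom_Obj[OF u] by auto
  show "plus (UA a u) (UA a v) \<in> Hom A (UO a T) (UO a R)" if "a \<in> S" for a
    using A.plus_Hom[OF UA_Hom[OF that u] UA_Hom[OF that v]] .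
  fix a b assume a: "a \<in> S" and b: "b \<in> S"
  note ua = UA_Hom[OF a u] UA_Hom[OF a v] and ub = UA_Hom[OF b u] UA_Hom[OF b v]
  show "plus (UA b u) (UA b v) \<cdot>\<^bsub>A\<^esub> act T a b = act R a b \<cdot>\<^bsub>A\<^esub> FA a b (plus (UA a u) (UA a v))"
    using A.plus_Comp[OF act_Hom[OF a b T] ub] UA_act[OF a b u] UA_act[OF a b v] FA_plus[OF a b ua]
      A.Comp_plus[OF FA_Hom[OF a b ua(1)] FA_Hom[OF a b ua(2)] act_Hom[OF a b R]] by simp
qed

lemma lift_zero:
  assumes T: "T \<in> Obj M" and R: "R \<in> Obj M"
  shows "\<exists>w\<in>Hom M T R. \<forall>a\<in>S. UA a w = zero (UO a T) (UO a R)"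
proof (rule ex_arrow[OF T R])
  show "zero (UO a T) (UO a R) \<in> Hom A (UO a T) (UO a R)" if "a \<in> S" for a
    using A.zero_Hom UO_Obj that T R by simp
  fix a b assume a: "a \<in> S" and b: "b \<in> S"
  show "zero (UO b T) (UO b R) \<cdot>\<^bsub>A\<^esub> act T a b = act R a b \<cdot>\<^bsub>A\<^esub> FA a b (zero (UO a T) (UO a R))"
    using A.zero_Comp[OF act_Hom[OF a b T] UO_Obj[OF b R]] FA_zero[OF a b UO_Obj[OF a T] UO_Obj[OF a R]]
      A.Comp_zero[OF act_Hom[OF a b R] FO_Obj[OF a b UO_Obj[OF a T]]] by simp
qed

text \<open>Both sides of the equivariance equation for the pointwise negatives are negatives of one
  arrow, \<open>UA b u\<close> after the action, because the functor is additive. So they cancel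
  against it.\<close>

lemma lift_neg:
  assumes u: "u \<in> Hom M T R"
  shows "\<exists>w\<in>Hom M T R. \<forall>a\<in>S. plus (UA a u) (UA a w) = zero (UO a T) (UO a R)"
proof -
  have T: "T \<in> Obj M" and R: "R \<in> Obj M" using M.Hom_Obj[OF u] by auto
  have "\<exists>n. n \<in> Hom A (UO a T) (UO a R) \<and> plus (UA a u) n = zero (UO a T) (UO a R)" if "a \<in> S" for a
    using A.neg_ex[OF UA_Hom[OF that u]] by blast
  then obtain n where n: "\<And>a. a \<in> S \<Longrightarrow> n a \<in> Hom A (UO a T) (UO a R)"
    "\<And>a. a \<in> S \<Longrightarrow> plus (UA a u) (n a) = zero (UO a T) (UO a R)" by metis
  have "\<exists>w\<in>Hom M T R. \<forall>a\<in>S. UA a w = n a"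
  proof (rule ex_arrow[OF T R n(1)])
    fix a b assume a: "a \<in> S" and b: "b \<in> S"
    note ua = UA_Hom[OF a u] and ub = UA_Hom[OF b u]
    note actT = act_Hom[OF a b T] and actR = act_Hom[OF a b R]
    have l: "plus (UA b u \<cdot>\<^bsub>A\<^esub> act T a b) (n b \<cdot>\<^bsub>A\<^esub> act T a b) = zero (FO a b (UO a T)) (UO b R)"
      using A.plus_Comp[OF actT ub n(1)[OF b]] n(2)[OF b] A.zero_Comp[OF actT UO_Obj[OF b R]] by simp
    have "plus (act R a b \<cdot>\<^bsub>A\<^esub> FA a b (UA a u)) (act R a b \<cdot>\<^bsub>A\<^esub> FA a b (n a))
        = act R a b \<cdot>\<^bsub>A\<^esub> FA a b (plus (UA a u) (n a))"
      using A.Comp_plus[OF FA_Hom[OF a b ua] FA_Hom[OF a b n(1)[OF a]] actR] FA_plus[OF a b ua n(1)[OF a]]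
      by simp
    also have "\<dots> = zero (FO a b (UO a T)) (UO b R)"
      using n(2)[OF a] FA_zero[OF a b UO_Obj[OF a T] UO_Obj[OF a R]]
        A.Comp_zero[OF act_Hom[OF a b R] FO_Obj[OF a b UO_Obj[OF a T]]] by simp
    finally have "plus (UA b u \<cdot>\<^bsub>A\<^esub> act T a b) (n b \<cdot>\<^bsub>A\<^esub> act T a b)
        = plus (UA b u \<cdot>\<^bsub>A\<^esub> act T a b) (act R a b \<cdot>\<^bsub>A\<^esub> FA a b (n a))"
      using l UA_act[OF a b u] by simp
    then show "n b \<cdot>\<^bsub>A\<^esub> act T a b = act R a b \<cdot>\<^bsub>A\<^esub> FA a b (n a)"
      by (rule A.plus_cancel[OF A.Comp_Hom[OF actT ub] A.Comp_Hom[OF actT n(1)[OF b]]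
          A.Comp_Hom[OF FA_Hom[OF a b n(1)[OF a]] actR]])
  qed
  then show ?thesis using n(2) by (metis (no_types, lifting))
qed

section \<open>Zero objects, kernels, cokernels, products and coproducts of algebras\<close>

lemma lift_zero_object:
  assumes N: "zero_object A N"
  shows "\<exists>Q\<in>Obj M. \<forall>a\<in>S. UO a Q = N"
proof -
  have NO: "N \<in> Obj A" using N by (simp add: zero_object_def)
  \<comment> \<open>A zero object is the vertex of an empty source, joint monicity being uniqueness
    of arrows into it. Over the empty index set the legs and the objects are filled with
    \<open>undefined\<close>.\<close>
  have "jointly_monic A ({} :: 'a set) N undefined"
    using N A.Hom_Obj unfolding jointly_monic_def zero_object_def by auto blast
  moreover have "\<exists>m\<in>Hom A (FO a b N) N. \<forall>i\<in>({} :: 'a set). undefined i \<cdot>\<^bsub>A\<^esub> m = act (undefined i) a b \<cdot>\<^bsub>A\<^esub> FA a b (undefined i)"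
    if "a \<in> S" "b \<in> S" for a b
    using A.zero_Hom[OF FO_Obj[OF that NO] NO] by blast
  ultimately obtain Q q where "Q \<in> Obj M" "\<And>a. a \<in> S \<Longrightarrow> UO a Q = N"
    using lift_source[of "{} :: 'a set" "undefined" "\<lambda>_. N" "\<lambda>_. undefined"] NO by auto
  then show ?thesis by blast
qed

text \<open>The kernel arrow is a source with a single leg, indexed by \<open>unit\<close>. The
  kernels receive an action because \<open>UA b u\<close> kills the action of \<open>T\<close>
  restricted to them: equivariance moves \<open>u\<close> inside the functor, where it meets its
  kernel, and the functor preserves zero.\<close>

lemma lift_kernel:
  assumes u: "u \<in> Hom M T R" and k: "\<And>a. a \<in> S \<Longrightarrow> is_kernel A (k a) (UA a u)"
  shows "\<exists>K. \<exists>w\<in>Hom M K T. \<forall>a\<in>S. UA a w = k a"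
proof -
  have T: "T \<in> Obj M" and R: "R \<in> Obj M" using M.Hom_Obj[OF u] by auto
  have kH: "k a \<in> Hom A (Dom A (k a)) (UO a T)" if "a \<in> S" for a
    using k[OF that] HomD[OF UA_Hom[OF that u]] by (auto simp: is_kernel_def Hom_def)
  have fac: "\<exists>m\<in>Hom A (FO a b (Dom A (k a))) (Dom A (k b)). \<forall>i\<in>(UNIV :: unit set).
      k b \<cdot>\<^bsub>A\<^esub> m = act T a b \<cdot>\<^bsub>A\<^esub> FA a b (k a)" if a: "a \<in> S" and b: "b \<in> S" for a b
  proof -
    note ua = UA_Hom[OF a u] and ub = UA_Hom[OF b u]
    note Fk = FA_Hom[OF a b kH[OF a]]
    note KO = A.Hom_Obj(1)[OF kH[OF a]]
    have "UA a u \<cdot>\<^bsub>A\<^esub> k a = zero (Dom A (k a)) (UO a R)"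
      using k[OF a] A.zero_arrow_iff[OF A.Comp_Hom[OF kH[OF a] ua]] by (simp add: is_kernel_def)
    then have "act R a b \<cdot>\<^bsub>A\<^esub> FA a b (UA a u \<cdot>\<^bsub>A\<^esub> k a) = zero (FO a b (Dom A (k a))) (UO b R)"
      using FA_zero[OF a b KO UO_Obj[OF a R]] A.Comp_zero[OF act_Hom[OF a b R] FO_Obj[OF a b KO]] by simp
    moreover have "UA b u \<cdot>\<^bsub>A\<^esub> act T a b \<cdot>\<^bsub>A\<^esub> FA a b (k a) = act R a b \<cdot>\<^bsub>A\<^esub> FA a b (UA a u \<cdot>\<^bsub>A\<^esub> k a)"
      using A.Comp_assoc[OF Fk act_Hom[OF a b T] ub] UA_act[OF a b u]
        A.Comp_assoc[OF Fk FA_Hom[OF a b ua] act_Hom[OF a b R]] FA_Comp[OF a b kH[OF a] ua] by simp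
    ultimately have "zero_arrow A (UA b u \<cdot>\<^bsub>A\<^esub> act T a b \<cdot>\<^bsub>A\<^esub> FA a b (k a))"
      using A.zero_arrow_zero[OF FO_Obj[OF a b KO] UO_Obj[OF b R]] by simp
    then show ?thesis
      using A.is_kernel_factor[OF k[OF b], of "act T a b \<cdot>\<^bsub>A\<^esub> FA a b (k a)"] HomD[OF ub]
        A.Comp_Hom[OF Fk act_Hom[OF a b T]] by metis
  qed
  obtain Q q where "q () \<in> Hom M Q T" "\<And>a. a \<in> S \<Longrightarrow> UA a (q ()) = k a"
    by (rule lift_source[of "UNIV :: unit set" "\<lambda>_. T" "\<lambda>a. Dom A (k a)" "\<lambda>a _. k a"])
      (use T kH fac A.Hom_Obj(1)[OF kH] A.jointly_monic_mono[OF A.mono_kernel[OF k] kH] in auto)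
  then show ?thesis by blast
qed

text \<open>The required arrow starts at \<open>FO a b\<close> of a cokernel, where no universal
  property is at hand. So \<open>k b\<close> after the action is transposed to \<open>t\<close>,
  which kills \<open>UA a u\<close> because its transpose does; \<open>t\<close> then descends to
  \<open>w\<close> on the cokernel, and \<open>w\<close> is transposed back.\<close>

lemma lift_cokernel:
  assumes u: "u \<in> Hom M T R" and k: "\<And>a. a \<in> S \<Longrightarrow> is_cokernel A (k a) (UA a u)"
  shows "\<exists>K. \<exists>w\<in>Hom M R K. \<forall>a\<in>S. UA a w = k a"
proof -
  interpret op: category "op_cat A" by (rule A.category_op)
  have T: "T \<in> Obj M" and R: "R \<in> Obj M" using M.Hom_Obj[OF u] by auto
  note k = k[unfolded is_cokernel_def]
  have kH: "k a \<in> Hom A (UO a R) (Cod A (k a))" if "a \<in> S" for a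
    using k[OF that] HomD[OF UA_Hom[OF that u]] by (auto simp: is_kernel_def Hom_def)
  have fac: "\<exists>m\<in>Hom A (FO a b (Cod A (k a))) (Cod A (k b)). \<forall>i\<in>(UNIV :: unit set).
      m \<cdot>\<^bsub>A\<^esub> FA a b (k a) = k b \<cdot>\<^bsub>A\<^esub> act R a b" if a: "a \<in> S" and b: "b \<in> S" for a b
  proof -
    note ua = UA_Hom[OF a u] and ub = UA_Hom[OF b u]
    note KO = A.Hom_Obj(2)[OF kH[OF b]]
    obtain H e where H: "H \<in> Obj A" "e \<in> Hom A (FO a b H) (Cod A (k b))"
      "\<And>X f. \<lbrakk>f \<in> Hom A (FO a b X) (Cod A (k b)); X \<in> Obj A\<rbrakk> \<Longrightarrow> \<exists>!g. g \<in> Hom A X H \<and> e \<cdot>\<^bsub>A\<^esub> FA a b g = f"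
      using F_adjoint[OF a b KO] by blast
    obtain t where t: "t \<in> Hom A (UO a R) H" "e \<cdot>\<^bsub>A\<^esub> FA a b t = k b \<cdot>\<^bsub>A\<^esub> act R a b"
      using H(3)[OF A.Comp_Hom[OF act_Hom[OF a b R] kH[OF b]] UO_Obj[OF a R]] by blast
    have tu: "t \<cdot>\<^bsub>A\<^esub> UA a u \<in> Hom A (UO a T) H" using A.Comp_Hom[OF ua t(1)] .
    have zH: "zero (UO a T) H \<in> Hom A (UO a T) H" using A.zero_Hom[OF UO_Obj[OF a T] H(1)] .
    have "e \<cdot>\<^bsub>A\<^esub> FA a b (t \<cdot>\<^bsub>A\<^esub> UA a u) = (k b \<cdot>\<^bsub>A\<^esub> act R a b) \<cdot>\<^bsub>A\<^esub> FA a b (UA a u)"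
      using FA_Comp[OF a b ua t(1)] A.Comp_assoc[OF FA_Hom[OF a b ua] FA_Hom[OF a b t(1)] H(2)] t(2) by simp
    also have "\<dots> = (k b \<cdot>\<^bsub>A\<^esub> UA b u) \<cdot>\<^bsub>A\<^esub> act T a b"
      using A.Comp_assoc[OF FA_Hom[OF a b ua] act_Hom[OF a b R] kH[OF b]] UA_act[OF a b u]
        A.Comp_assoc[OF act_Hom[OF a b T] ub kH[OF b]] by simp
    also have "k b \<cdot>\<^bsub>A\<^esub> UA b u = zero (UO b T) (Cod A (k b))"
      using k[OF b] A.zero_arrow_iff[OF A.Comp_Hom[OF ub kH[OF b]]] by (simp add: is_kernel_def)
    also have "zero (UO b T) (Cod A (k b)) \<cdot>\<^bsub>A\<^esub> act T a b = e \<cdot>\<^bsub>A\<^esub> FA a b (zero (UO a T) H)"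
      using A.zero_Comp[OF act_Hom[OF a b T] KO] FA_zero[OF a b UO_Obj[OF a T] H(1)]
        A.Comp_zero[OF H(2) FO_Obj[OF a b UO_Obj[OF a T]]] by simp
    finally have "t \<cdot>\<^bsub>A\<^esub> UA a u = zero (UO a T) H"
      using H(3)[OF A.Comp_Hom[OF FA_Hom[OF a b zH] H(2)] UO_Obj[OF a T]] tu zH by blast
    then have "zero_arrow A (t \<cdot>\<^bsub>A\<^esub> UA a u)"
      using A.zero_arrow_zero[OF UO_Obj[OF a T] H(1)] by simp
    then obtain w where w: "w \<in> Hom A (Cod A (k a)) H" "w \<cdot>\<^bsub>A\<^esub> k a = t"
      using op.is_kernel_factor[OF k[OF a], of t H] t(1) HomD[OF ua] by auto
    have "(e \<cdot>\<^bsub>A\<^esub> FA a b w) \<cdot>\<^bsub>A\<^esub> FA a b (k a) = k b \<cdot>\<^bsub>A\<^esub> act R a b"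
      using A.Comp_assoc[OF FA_Hom[OF a b kH[OF a]] FA_Hom[OF a b w(1)] H(2)] FA_Comp[OF a b kH[OF a] w(1)] w(2) t(2)
      by simp
    then show ?thesis using A.Comp_Hom[OF FA_Hom[OF a b w(1)] H(2)] by blast
  qed
  have je: "jointly_epic A (UNIV :: unit set) (Cod A (k a)) (\<lambda>_. k a)" if "a \<in> S" for a
    using op.jointly_monic_mono[OF op.mono_kernel[OF k[OF that]]] kH[OF that]
    unfolding jointly_epic_def Hom_op_cat by blast
  obtain Q q where "q () \<in> Hom M R Q" "\<And>a. a \<in> S \<Longrightarrow> UA a (q ()) = k a"
    by (rule lift_sink[of "UNIV :: unit set" "\<lambda>_. R" "\<lambda>a. Cod A (k a)" "\<lambda>a _. k a"])
      (use R kH fac A.Hom_Obj(2)[OF kH] je in auto)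
  then show ?thesis by blast
qed

text \<open>The index set may be arbitrary since the products in \<open>A\<close> are part of the
  hypothesis of \<open>lifts_products\<close>. It is used for \<open>bool\<close>, giving binary
  products, and for small sets, giving AB4_star.\<close>

lemma lifts_products_M: "lifts_products A M S UO UA I"
  unfolding lifts_products_def
proof (intro allI impI, elim conjE)
  fix X P p assume X: "\<forall>i\<in>I. X i \<in> Obj M"
    and prod: "\<forall>a\<in>S. is_product A I (\<lambda>i. UO a (X i)) (P a) (p a)"
  have jm: "jointly_monic A I (P a) (p a)" if "a \<in> S" for a
    using A.jointly_monic_product prod that by blast
  note PD = A.is_productD[OF prod[rule_format]]
  obtain Q q where Q: "Q \<in> Obj M" "\<And>a. a \<in> S \<Longrightarrow> UO a Q = P a"
    and q: "\<And>i. i \<in> I \<Longrightarrow> q i \<in> Hom M Q (X i)" "\<And>a i. \<lbrakk>a \<in> S; i \<in> I\<rbrakk> \<Longrightarrow> UA a (q i) = p a i"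
  proof (rule lift_source[of I X P p])
    fix a b assume a: "a \<in> S" and b: "b \<in> S"
    have "act (X i) a b \<cdot>\<^bsub>A\<^esub> FA a b (p a i) \<in> Hom A (FO a b (P a)) (UO b (X i))" if "i \<in> I" for i
      using A.Comp_Hom[OF FA_Hom[OF a b PD(2)[OF a that]] act_Hom[OF a b]] X that by simp
    then show "\<exists>m\<in>Hom A (FO a b (P a)) (P b). \<forall>i\<in>I. p b i \<cdot>\<^bsub>A\<^esub> m = act (X i) a b \<cdot>\<^bsub>A\<^esub> FA a b (p a i)"
      using PD(4)[OF b FO_Obj[OF a b PD(1)[OF a]], of "\<lambda>i. act (X i) a b \<cdot>\<^bsub>A\<^esub> FA a b (p a i)"] by blast
  qed (use X PD(1,2) jm in auto)
  have "is_product M I X Q q"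
  proof (rule M.is_productI[OF Q(1) q(1)])
    fix g h W assume g: "g \<in> Hom M W Q" and h: "h \<in> Hom M W Q"
      and eq: "\<And>i. i \<in> I \<Longrightarrow> q i \<cdot>\<^bsub>M\<^esub> g = q i \<cdot>\<^bsub>M\<^esub> h"
    show "g = h"
    proof (rule faithful[OF g h])
      fix a assume a: "a \<in> S"
      have "UA a g \<in> Hom A (UO a W) (P a)" "UA a h \<in> Hom A (UO a W) (P a)"
        using UA_Hom[OF a g] UA_Hom[OF a h] Q(2)[OF a] by auto
      moreover have "p a i \<cdot>\<^bsub>A\<^esub> UA a g = p a i \<cdot>\<^bsub>A\<^esub> UA a h" if "i \<in> I" for i
        using UA_Comp[OF a g q(1)[OF that]] UA_Comp[OF a h q(1)[OF that]] eq[OF that] q(2)[OF a that] by simp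
      ultimately show "UA a g = UA a h" using jointly_monicD[OF jm[OF a]] by blast
    qed
  next
    fix W r assume W: "W \<in> Obj M" and r: "\<And>i. i \<in> I \<Longrightarrow> r i \<in> Hom M W (X i)"
    have "\<exists>h. h \<in> Hom A (UO a W) (P a) \<and> (\<forall>i\<in>I. p a i \<cdot>\<^bsub>A\<^esub> h = UA a (r i))" if "a \<in> S" for a
      using PD(4)[OF that UO_Obj[OF that W], of "\<lambda>i. UA a (r i)"] UA_Hom[OF that r] by blast
    then obtain h where h: "\<And>a. a \<in> S \<Longrightarrow> h a \<in> Hom A (UO a W) (P a)"
      "\<And>a i. \<lbrakk>a \<in> S; i \<in> I\<rbrakk> \<Longrightarrow> p a i \<cdot>\<^bsub>A\<^esub> h a = UA a (r i)" by metis
    have jm': "jointly_monic A I (UO a Q) (\<lambda>i. UA a (q i))" if "a \<in> S" for a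
      using jm[OF that] Q(2)[OF that] q(2)[OF that] by (simp add: jointly_monic_def)
    have "\<exists>u\<in>Hom M W Q. \<forall>a\<in>S. UA a u = h a"
      by (rule factor_source[OF Q(1) W q(1) r jm']) (use h Q q in auto)
    then obtain u where u: "u \<in> Hom M W Q" "\<And>a. a \<in> S \<Longrightarrow> UA a u = h a" by blast
    have "q i \<cdot>\<^bsub>M\<^esub> u = r i" if i: "i \<in> I" for i
    proof (rule faithful[OF M.Comp_Hom[OF u(1) q(1)[OF i]] r[OF i]])
      fix a assume a: "a \<in> S"
      show "UA a (q i \<cdot>\<^bsub>M\<^esub> u) = UA a (r i)"
        using UA_Comp[OF a u(1) q(1)[OF i]] q(2)[OF a i] u(2)[OF a] h(2)[OF a i] by simp
    qed
    then show "\<exists>h. h \<in> Hom M W Q \<and> (\<forall>i\<in>I. q i \<cdot>\<^bsub>M\<^esub> h = r i)" using u(1) by blast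
  qed
  then show "\<exists>Q q. is_product M I X Q q \<and> (\<forall>a\<in>S. UO a Q = P a \<and> (\<forall>i\<in>I. UA a (q i) = p a i))"
    using Q q by blast
qed

text \<open>As for cokernels, the action on the coproduct \<open>P a\<close> is obtained by
  transposing the prescribed arrows, gluing the transposes over the injections into
  \<open>P a\<close>, and transposing back: the preservation of coproducts by a left adjoint. The
  later steps use only that the family is jointly epic.\<close>

lemma lifts_coproducts_M: "lifts_products (op_cat A) (op_cat M) S UO UA I"
  unfolding lifts_products_def op_cat_simps
proof (intro allI impI, elim conjE)
  interpret op: category "op_cat A" by (rule A.category_op)
  interpret opM: category "op_cat M" by (rule M.category_op)
  fix X P p assume X: "\<forall>i\<in>I. X i \<in> Obj M"
    and prod: "\<forall>a\<in>S. is_product (op_cat A) I (\<lambda>i. UO a (X i)) (P a) (p a)"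
  have je: "jointly_epic A I (P a) (p a)" if "a \<in> S" for a
    using op.jointly_monic_product prod that unfolding jointly_epic_def by blast
  note PD = op.is_productD[OF prod[rule_format], unfolded Hom_op_cat op_cat_simps]
  obtain Q q where Q: "Q \<in> Obj M" "\<And>a. a \<in> S \<Longrightarrow> UO a Q = P a"
    and q: "\<And>i. i \<in> I \<Longrightarrow> q i \<in> Hom M (X i) Q" "\<And>a i. \<lbrakk>a \<in> S; i \<in> I\<rbrakk> \<Longrightarrow> UA a (q i) = p a i"
  proof (rule lift_sink[of I X P p])
    fix a b assume a: "a \<in> S" and b: "b \<in> S"
    obtain H e where H: "H \<in> Obj A" "e \<in> Hom A (FO a b H) (P b)"
      "\<And>X f. \<lbrakk>f \<in> Hom A (FO a b X) (P b); X \<in> Obj A\<rbrakk> \<Longrightarrow> \<exists>!g. g \<in> Hom A X H \<and> e \<cdot>\<^bsub>A\<^esub> FA a b g = f"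
      using F_adjoint[OF a b PD(1)[OF b]] by blast
    have "\<exists>t. t \<in> Hom A (UO a (X i)) H \<and> e \<cdot>\<^bsub>A\<^esub> FA a b t = p b i \<cdot>\<^bsub>A\<^esub> act (X i) a b" if i: "i \<in> I" for i
      using H(3)[OF A.Comp_Hom[OF act_Hom[OF a b] PD(2)[OF b i]] UO_Obj[OF a]] X i by blast
    then obtain t where t: "\<And>i. i \<in> I \<Longrightarrow> t i \<in> Hom A (UO a (X i)) H"
      "\<And>i. i \<in> I \<Longrightarrow> e \<cdot>\<^bsub>A\<^esub> FA a b (t i) = p b i \<cdot>\<^bsub>A\<^esub> act (X i) a b" by metis
    obtain w where w: "w \<in> Hom A (P a) H" "\<And>i. i \<in> I \<Longrightarrow> w \<cdot>\<^bsub>A\<^esub> p a i = t i"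
      using PD(4)[OF a H(1), of t] t(1) by blast
    have "(e \<cdot>\<^bsub>A\<^esub> FA a b w) \<cdot>\<^bsub>A\<^esub> FA a b (p a i) = p b i \<cdot>\<^bsub>A\<^esub> act (X i) a b" if i: "i \<in> I" for i
      using A.Comp_assoc[OF FA_Hom[OF a b PD(2)[OF a i]] FA_Hom[OF a b w(1)] H(2)]
        FA_Comp[OF a b PD(2)[OF a i] w(1)] w(2)[OF i] t(2)[OF i] by simp
    then show "\<exists>m\<in>Hom A (FO a b (P a)) (P b). \<forall>i\<in>I. m \<cdot>\<^bsub>A\<^esub> FA a b (p a i) = p b i \<cdot>\<^bsub>A\<^esub> act (X i) a b"
      using A.Comp_Hom[OF FA_Hom[OF a b w(1)] H(2)] by blast
  qed (use X PD(1,2) je in auto)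
  have "is_product (op_cat M) I X Q q"
  proof (rule opM.is_productI, unfold Hom_op_cat op_cat_simps)
    fix g h W assume g: "g \<in> Hom M Q W" and h: "h \<in> Hom M Q W"
      and eq: "\<And>i. i \<in> I \<Longrightarrow> g \<cdot>\<^bsub>M\<^esub> q i = h \<cdot>\<^bsub>M\<^esub> q i"
    show "g = h"
    proof (rule faithful[OF g h])
      fix a assume a: "a \<in> S"
      have "UA a g \<in> Hom A (P a) (UO a W)" "UA a h \<in> Hom A (P a) (UO a W)"
        using UA_Hom[OF a g] UA_Hom[OF a h] Q(2)[OF a] by auto
      moreover have "UA a g \<cdot>\<^bsub>A\<^esub> p a i = UA a h \<cdot>\<^bsub>A\<^esub> p a i" if "i \<in> I" for i
        using UA_Comp[OF a q(1)[OF that] g] UA_Comp[OF a q(1)[OF that] h] eq[OF that] q(2)[OF a that] by simp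
      ultimately show "UA a g = UA a h" using jointly_epicD[OF je[OF a]] by blast
    qed
  next
    fix W r assume W: "W \<in> Obj M" and r: "\<And>i. i \<in> I \<Longrightarrow> r i \<in> Hom M (X i) W"
    have "\<exists>h. h \<in> Hom A (P a) (UO a W) \<and> (\<forall>i\<in>I. h \<cdot>\<^bsub>A\<^esub> p a i = UA a (r i))" if "a \<in> S" for a
      using PD(4)[OF that UO_Obj[OF that W], of "\<lambda>i. UA a (r i)"] UA_Hom[OF that r] by blast
    then obtain h where h: "\<And>a. a \<in> S \<Longrightarrow> h a \<in> Hom A (P a) (UO a W)"
      "\<And>a i. \<lbrakk>a \<in> S; i \<in> I\<rbrakk> \<Longrightarrow> h a \<cdot>\<^bsub>A\<^esub> p a i = UA a (r i)" by metis
    have je': "jointly_epic A I (UO a Q) (\<lambda>i. UA a (q i))" if "a \<in> S" for a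
      using je[OF that] Q(2)[OF that] q(2)[OF that] by (simp add: jointly_epic_def jointly_monic_def)
    have "\<exists>u\<in>Hom M Q W. \<forall>a\<in>S. UA a u = h a"
      by (rule factor_sink[OF Q(1) W q(1) r je']) (use h Q q in auto)
    then obtain u where u: "u \<in> Hom M Q W" "\<And>a. a \<in> S \<Longrightarrow> UA a u = h a" by blast
    have "u \<cdot>\<^bsub>M\<^esub> q i = r i" if i: "i \<in> I" for i
    proof (rule faithful[OF M.Comp_Hom[OF q(1)[OF i] u(1)] r[OF i]])
      fix a assume a: "a \<in> S"
      show "UA a (u \<cdot>\<^bsub>M\<^esub> q i) = UA a (r i)"
        using UA_Comp[OF a q(1)[OF i] u(1)] q(2)[OF a i] u(2)[OF a] h(2)[OF a i] by simp
    qed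
    then show "\<exists>h. h \<in> Hom M Q W \<and> (\<forall>i\<in>I. h \<cdot>\<^bsub>M\<^esub> q i = r i)" using u(1) by blast
  qed (use Q q in auto)
  then show "\<exists>Q q. is_product (op_cat M) I X Q q \<and> (\<forall>a\<in>S. UO a Q = P a \<and> (\<forall>i\<in>I. UA a (q i) = p a i))"
    using Q q by blast
qed

section \<open>Algebras and their opposites satisfy the pointwise interface\<close>

lemma pointwise: "pointwise_limits A plus zero M S UO UA"
proof (intro pointwise_limits.intro A.additive_structure_axioms M.category_axioms pointwise_limits_axioms.intro)
  fix k K X g W h
  assume k: "k \<in> Hom M K X" and g: "g \<in> Hom M W X" and mono: "\<And>a. a \<in> S \<Longrightarrow> mono_arrow A (UA a k)"
    and h: "\<And>a. a \<in> S \<Longrightarrow> h a \<in> Hom A (UO a W) (UO a K)" and kh: "\<And>a. a \<in> S \<Longrightarrow> UA a k \<cdot>\<^bsub>A\<^esub> h a = UA a g"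
  show "\<exists>h'\<in>Hom M W K. \<forall>a\<in>S. UA a h' = h a"
    by (rule factor_source[of K W "UNIV :: unit set" "\<lambda>_. k" "\<lambda>_. X" "\<lambda>_. g"])
      (use M.Hom_Obj[OF k] M.Hom_Obj[OF g] k g h kh A.jointly_monic_mono[OF mono UA_Hom[OF _ k]] in auto)
next
  show "u = v" if "u \<in> Hom M T R" "v \<in> Hom M T R" "\<And>a. a \<in> S \<Longrightarrow> UA a u = UA a v" for u v T R
    using faithful that by blast
  show "\<exists>K. \<exists>k\<in>Hom M K X. \<forall>a\<in>S. UA a k = kk a"
    if "u \<in> Hom M X Y" "\<And>a. a \<in> S \<Longrightarrow> is_kernel A (kk a) (UA a u)" for u X Y kk
    using lift_kernel[OF that] .
  show "UA a (v \<cdot>\<^bsub>M\<^esub> u) = UA a v \<cdot>\<^bsub>A\<^esub> UA a u" if "a \<in> S" "u \<in> Hom M T R" "v \<in> Hom M R Q" for a u v T R Q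
    using UA_Comp that by blast
qed (simp_all add: ex_kernel_A mono_normal_A UO_Obj UA_Hom UA_Ident lift_plus lift_zero lift_neg lift_zero_object)

text \<open>The source lemmas are replaced by the sink lemmas exactly in the lifting of kernels and
  in \<open>lift_mono\<close>; the additive conditions are literally those of
  \<open>pointwise\<close> with the arguments of \<open>zero\<close> exchanged.\<close>

lemma pointwise_op: "pointwise_limits (op_cat A) plus (\<lambda>X Y. zero Y X) (op_cat M) S UO UA"
proof (intro pointwise_limits.intro A.op M.category_op pointwise_limits_axioms.intro;
    (unfold op_cat_simps Hom_op_cat zero_object_op)?)
  interpret op: category "op_cat A" by (rule A.category_op)
  show "\<And>u. u \<in> Arr A \<Longrightarrow> \<exists>k. is_kernel (op_cat A) k u"
    using ex_cokernel_A by (simp add: is_cokernel_def)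
  show "\<And>u. mono_arrow (op_cat A) u \<Longrightarrow> \<exists>v. is_kernel (op_cat A) u v"
    using epi_normal_A by (simp add: is_cokernel_def epi_arrow_def)
  show "\<exists>K. \<exists>k\<in>Hom M X K. \<forall>a\<in>S. UA a k = kk a"
    if "f \<in> Hom M Y X" "\<And>a. a \<in> S \<Longrightarrow> is_kernel (op_cat A) (kk a) (UA a f)" for f X Y kk
    using lift_cokernel[OF that(1)] that(2) by (simp add: is_cokernel_def)
  fix k K X g W h
  assume k: "k \<in> Hom M X K" and g: "g \<in> Hom M X W" and mono: "\<And>a. a \<in> S \<Longrightarrow> mono_arrow (op_cat A) (UA a k)"
    and h: "\<And>a. a \<in> S \<Longrightarrow> h a \<in> Hom A (UO a K) (UO a W)" and kh: "\<And>a. a \<in> S \<Longrightarrow> h a \<cdot>\<^bsub>A\<^esub> UA a k = UA a g"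
  have je: "jointly_epic A (UNIV :: unit set) (UO a K) (\<lambda>_. UA a k)" if "a \<in> S" for a
    using op.jointly_monic_mono[OF mono[OF that]] UA_Hom[OF that k]
    unfolding jointly_epic_def Hom_op_cat by blast
  show "\<exists>h'\<in>Hom M K W. \<forall>a\<in>S. UA a h' = h a"
    by (rule factor_sink[of K W "UNIV :: unit set" "\<lambda>_. k" "\<lambda>_. X" "\<lambda>_. g"])
      (use M.Hom_Obj[OF k] M.Hom_Obj[OF g] k g h kh je in auto)
next
  show "u = v" if "u \<in> Hom M R T" "v \<in> Hom M R T" "\<And>a. a \<in> S \<Longrightarrow> UA a u = UA a v" for u v T R
    using faithful that by blast
  show "UA a (u \<cdot>\<^bsub>M\<^esub> v) = UA a u \<cdot>\<^bsub>A\<^esub> UA a v" if "a \<in> S" "u \<in> Hom M R T" "v \<in> Hom M Q R" for a u v T R Q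
    using UA_Comp that by blast
qed (simp_all add: UO_Obj UA_Hom UA_Ident lift_plus lift_zero lift_neg lift_zero_object)

sublocale pointwise_limits_colimits A plus zero M S UO UA
  by (intro pointwise_limits_colimits.intro pointwise pointwise_op pointwise_limits_colimits_axioms.intro)

theorem algebras_abelian:
  "abelian_category M"
  "AB4 TYPE('u) A \<Longrightarrow> AB4 TYPE('u) M"
  "AB4_star TYPE('u) A \<Longrightarrow> AB4_star TYPE('u) M"
  using abelian_M[OF ex_binary_product_A lifts_products_M] AB4_pointwise[OF _ lifts_coproducts_M]
    AB4_star_pointwise[OF _ lifts_products_M] by blast+

end

section \<open>Modules as algebras\<close>

context monoidal_category
begin

lemma TensorO_UnitO_Obj [simp]:
  "UnitO A \<in> Obj A" "\<lbrakk>X \<in> Obj A; Y \<in> Obj A\<rbrakk> \<Longrightarrow> X \<otimes> Y \<in> Obj A"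
  by (rule UnitO_Obj TensorO_Obj; assumption?)+

lemma TensorA_simps [simp]:
  assumes "f \<in> Arr A" "g \<in> Arr A"
  shows "f \<boxtimes> g \<in> Arr A" "Dom A (f \<boxtimes> g) = Dom A f \<otimes> Dom A g" "Cod A (f \<boxtimes> g) = Cod A f \<otimes> Cod A g"
  using HomD[OF TensorA_Hom[OF Hom_self[OF assms(1)] Hom_self[OF assms(2)]]] by auto

lemma TensorA_Ident_Ident [simp]:
  "\<lbrakk>X \<in> Obj A; Y \<in> Obj A\<rbrakk> \<Longrightarrow> Ident A X \<boxtimes> Ident A Y = Ident A (X \<otimes> Y)"
  by (rule TensorA_Ident)

lemma TensorA_Comp_Arr:
  assumes "f \<in> Arr A" "f' \<in> Arr A" "g \<in> Arr A" "g' \<in> Arr A" "Dom A f' = Cod A f" "Dom A g' = Cod A g"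
  shows "(f' \<boxtimes> g') \<cdot> (f \<boxtimes> g) = (f' \<cdot> f) \<boxtimes> (g' \<cdot> g)"
  by (rule TensorA_Comp[symmetric]) (use assms in \<open>auto intro!: HomI\<close>)

text \<open>The interchange law with a tail \<open>k\<close>: composites are bracketed to the right
  by \<open>Comp_assoc_Arr\<close>, so two adjacent tensor arrows in the middle are reached only in
  this form.\<close>

lemma TensorA_Comp_Arr_left:
  assumes "f \<in> Arr A" "f' \<in> Arr A" "g \<in> Arr A" "g' \<in> Arr A" "Dom A f' = Cod A f" "Dom A g' = Cod A g"
    "k \<in> Arr A" "Cod A k = Dom A f \<otimes> Dom A g"
  shows "(f' \<boxtimes> g') \<cdot> (f \<boxtimes> g) \<cdot> k = ((f' \<cdot> f) \<boxtimes> (g' \<cdot> g)) \<cdot> k"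
  using assms Comp_assoc_Arr[of k "f \<boxtimes> g" "f' \<boxtimes> g'"] TensorA_Comp_Arr[of f f' g g'] by simp

lemma Assoc_simps [simp]:
  assumes "X \<in> Obj A" "Y \<in> Obj A" "Z \<in> Obj A"
  shows "Assoc A X Y Z \<in> Arr A" "Dom A (Assoc A X Y Z) = (X \<otimes> Y) \<otimes> Z"
    "Cod A (Assoc A X Y Z) = X \<otimes> (Y \<otimes> Z)"
  using HomD[OF Assoc_Hom[OF assms]] by auto

lemma Unit_simps [simp]:
  assumes "X \<in> Obj A"
  shows "LUnit A X \<in> Arr A" "Dom A (LUnit A X) = UnitO A \<otimes> X" "Cod A (LUnit A X) = X"
    "RUnit A X \<in> Arr A" "Dom A (RUnit A X) = X \<otimes> UnitO A" "Cod A (RUnit A X) = X"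
  using HomD[OF LUnit_Hom[OF assms]] HomD[OF RUnit_Hom[OF assms]] by auto

abbreviation "LInv X \<equiv> inv_arrow A (LUnit A X)"
abbreviation "RInv X \<equiv> inv_arrow A (RUnit A X)"
abbreviation "AInv X Y Z \<equiv> inv_arrow A (Assoc A X Y Z)"

lemma inv_simps [simp]:
  assumes "X \<in> Obj A"
  shows "LInv X \<in> Arr A" "Dom A (LInv X) = X" "Cod A (LInv X) = UnitO A \<otimes> X"
    "LUnit A X \<cdot> LInv X = Ident A X" "LInv X \<cdot> LUnit A X = Ident A (UnitO A \<otimes> X)"
    "RInv X \<in> Arr A" "Dom A (RInv X) = X" "Cod A (RInv X) = X \<otimes> UnitO A"
    "RUnit A X \<cdot> RInv X = Ident A X" "RInv X \<cdot> RUnit A X = Ident A (X \<otimes> UnitO A)"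
  using inverse_arrows_simps[OF inv_arrow_inverse[OF LUnit_iso[OF assms]]]
    inverse_arrows_simps[OF inv_arrow_inverse[OF RUnit_iso[OF assms]]] assms by auto

lemma AInv_simps [simp]:
  assumes "X \<in> Obj A" "Y \<in> Obj A" "Z \<in> Obj A"
  shows "AInv X Y Z \<in> Arr A" "Dom A (AInv X Y Z) = X \<otimes> (Y \<otimes> Z)" "Cod A (AInv X Y Z) = (X \<otimes> Y) \<otimes> Z"
    "Assoc A X Y Z \<cdot> AInv X Y Z = Ident A (X \<otimes> (Y \<otimes> Z))"
    "AInv X Y Z \<cdot> Assoc A X Y Z = Ident A ((X \<otimes> Y) \<otimes> Z)"
  using inverse_arrows_simps[OF inv_arrow_inverse[OF Assoc_iso[OF assms]]] assms by auto

lemma LUnit_natural_Arr: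
  "f \<in> Arr A \<Longrightarrow> LUnit A (Cod A f) \<cdot> (Ident A (UnitO A) \<boxtimes> f) = f \<cdot> LUnit A (Dom A f)"
  by (rule LUnit_natural[OF Hom_self])

text \<open>Tensoring with the unit is naturally isomorphic to the identity functor, hence
  faithful.\<close>

lemma UnitO_TensorA_cancel:
  assumes "f \<in> Hom A X Y" "g \<in> Hom A X Y" "Ident A (UnitO A) \<boxtimes> f = Ident A (UnitO A) \<boxtimes> g"
  shows "f = g"
proof (rule inverse_cancel_right[of "LUnit A X" "LInv X"])
  have X: "X \<in> Obj A" using Hom_Obj[OF assms(1)] by simp
  show "f \<cdot> LUnit A X = g \<cdot> LUnit A X"
    using LUnit_natural[OF assms(1)] LUnit_natural[OF assms(2)] assms(3) by simp
qed (use HomD[OF assms(1)] HomD[OF assms(2)] Hom_Obj[OF assms(1)] in auto)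

text \<open>Kelly's lemma: tensor the claim with the unit, where it follows from the pentagon and two
  triangles.\<close>

lemma LUnit_Assoc:
  assumes X: "X \<in> Obj A" and Y: "Y \<in> Obj A"
  shows "LUnit A (X \<otimes> Y) \<cdot> Assoc A (UnitO A) X Y = LUnit A X \<boxtimes> Ident A Y"
proof (rule UnitO_TensorA_cancel)
  note [simp] = X Y
  let ?I = "UnitO A"
  let ?i = "Ident A ?I"
  \<comment> \<open>\<open>u\<close> consists of two edges of the pentagon for I, I, X, Y, and
    \<open>v\<close> is a right inverse. Precomposing the claim with \<open>u\<close> completes the
    pentagon.\<close>
  define u where "u = Assoc A ?I (?I \<otimes> X) Y \<cdot> (Assoc A ?I ?I X \<boxtimes> Ident A Y)"
  define v where "v = (AInv ?I ?I X \<boxtimes> Ident A Y) \<cdot> AInv ?I (?I \<otimes> X) Y"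
  have u: "u \<in> Arr A" "Cod A u = ?I \<otimes> ((?I \<otimes> X) \<otimes> Y)" "Dom A u = ((?I \<otimes> ?I) \<otimes> X) \<otimes> Y"
    and v: "v \<in> Arr A" "Dom A v = ?I \<otimes> ((?I \<otimes> X) \<otimes> Y)" "Cod A v = ((?I \<otimes> ?I) \<otimes> X) \<otimes> Y"
    by (simp_all add: u_def v_def)
  have uv: "u \<cdot> v = Ident A (Cod A u)"
    by (simp add: u_def v_def Comp_assoc_Arr TensorA_Comp_Arr_left)
  have tri: "(?i \<boxtimes> LUnit A Z) \<cdot> Assoc A ?I ?I Z = RUnit A ?I \<boxtimes> Ident A Z" if "Z \<in> Obj A" for Z
    using triangle[of ?I Z] that by simp
  have "(?i \<boxtimes> (LUnit A (X \<otimes> Y) \<cdot> Assoc A ?I X Y)) \<cdot> u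
      = (?i \<boxtimes> LUnit A (X \<otimes> Y)) \<cdot> (?i \<boxtimes> Assoc A ?I X Y) \<cdot> u"
    using u by (simp add: TensorA_Comp_Arr_left)
  also have "\<dots> = (?i \<boxtimes> LUnit A (X \<otimes> Y)) \<cdot> Assoc A ?I ?I (X \<otimes> Y) \<cdot> Assoc A (?I \<otimes> ?I) X Y"
    using pentagon[of ?I ?I X Y] by (simp add: u_def)
  also have "\<dots> = (RUnit A ?I \<boxtimes> (Ident A X \<boxtimes> Ident A Y)) \<cdot> Assoc A (?I \<otimes> ?I) X Y"
    using tri[of "X \<otimes> Y"] Comp_assoc_Arr[of "Assoc A (?I \<otimes> ?I) X Y" "Assoc A ?I ?I (X \<otimes> Y)" "?i \<boxtimes> LUnit A (X \<otimes> Y)"]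
    by simp
  also have "\<dots> = Assoc A ?I X Y \<cdot> ((RUnit A ?I \<boxtimes> Ident A X) \<boxtimes> Ident A Y)"
    by (rule Assoc_natural[symmetric]) (auto intro!: HomI)
  also have "\<dots> = Assoc A ?I X Y \<cdot> ((?i \<boxtimes> LUnit A X) \<boxtimes> Ident A Y) \<cdot> (Assoc A ?I ?I X \<boxtimes> Ident A Y)"
    by (simp add: TensorA_Comp_Arr tri)
  also have "\<dots> = (Assoc A ?I X Y \<cdot> ((?i \<boxtimes> LUnit A X) \<boxtimes> Ident A Y)) \<cdot> (Assoc A ?I ?I X \<boxtimes> Ident A Y)"
    by (simp add: Comp_assoc_Arr)
  also have "Assoc A ?I X Y \<cdot> ((?i \<boxtimes> LUnit A X) \<boxtimes> Ident A Y)
      = (?i \<boxtimes> (LUnit A X \<boxtimes> Ident A Y)) \<cdot> Assoc A ?I (?I \<otimes> X) Y"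
    by (rule Assoc_natural) (auto intro!: HomI)
  also have "\<dots> \<cdot> (Assoc A ?I ?I X \<boxtimes> Ident A Y) = (?i \<boxtimes> (LUnit A X \<boxtimes> Ident A Y)) \<cdot> u"
    by (simp add: u_def Comp_assoc_Arr)
  finally have "?i \<boxtimes> (LUnit A (X \<otimes> Y) \<cdot> Assoc A ?I X Y) = ?i \<boxtimes> (LUnit A X \<boxtimes> Ident A Y)"
    by (rule inverse_cancel_right[OF u(1) v(1) _ uv, rotated -1]) (simp_all add: u v)
  then show "Ident A (UnitO A) \<boxtimes> (LUnit A (X \<otimes> Y) \<cdot> Assoc A (UnitO A) X Y)
      = Ident A (UnitO A) \<boxtimes> (LUnit A X \<boxtimes> Ident A Y)"
    by simp
qed (use X Y in \<open>auto intro!: HomI\<close>)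

text \<open>Kelly's lemma read for the inverse unitors, in which enriched naturality and composition
  are stated.\<close>

lemma Assoc_LInv:
  assumes X: "X \<in> Obj A" and Y: "Y \<in> Obj A"
  shows "Assoc A (UnitO A) X Y \<cdot> (LInv X \<boxtimes> Ident A Y) = LInv (X \<otimes> Y)"
proof -
  note [simp] = X Y
  let ?k = "Assoc A (UnitO A) X Y \<cdot> (LInv X \<boxtimes> Ident A Y)"
  have "LUnit A (X \<otimes> Y) \<cdot> ?k = (LUnit A X \<boxtimes> Ident A Y) \<cdot> (LInv X \<boxtimes> Ident A Y)"
    by (simp add: LUnit_Assoc[symmetric] Comp_assoc_Arr)
  also have "\<dots> = Ident A (X \<otimes> Y)" by (simp add: TensorA_Comp_Arr)
  finally have "LInv (X \<otimes> Y) \<cdot> LUnit A (X \<otimes> Y) \<cdot> ?k = LInv (X \<otimes> Y)" by simp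
  moreover have "LInv (X \<otimes> Y) \<cdot> LUnit A (X \<otimes> Y) \<cdot> ?k = (LInv (X \<otimes> Y) \<cdot> LUnit A (X \<otimes> Y)) \<cdot> ?k"
    by (rule Comp_assoc_Arr[symmetric]) simp_all
  ultimately show ?thesis by simp
qed

text \<open>The triangle read for the inverse unitors. It absorbs the associator on the side of
  naturality where the transformation is applied first.\<close>

lemma Assoc_RInv:
  assumes X: "X \<in> Obj A" and Y: "Y \<in> Obj A"
  shows "Assoc A X (UnitO A) Y \<cdot> (RInv X \<boxtimes> Ident A Y) = Ident A X \<boxtimes> LInv Y"
proof -
  note [simp] = X Y
  let ?k = "Assoc A X (UnitO A) Y \<cdot> (RInv X \<boxtimes> Ident A Y)"
  have "(Ident A X \<boxtimes> LUnit A Y) \<cdot> ?k = ((Ident A X \<boxtimes> LUnit A Y) \<cdot> Assoc A X (UnitO A) Y) \<cdot> (RInv X \<boxtimes> Ident A Y)"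
    by (simp add: Comp_assoc_Arr)
  also have "\<dots> = Ident A (X \<otimes> Y)" by (simp add: triangle TensorA_Comp_Arr)
  finally have "(Ident A X \<boxtimes> LInv Y) \<cdot> (Ident A X \<boxtimes> LUnit A Y) \<cdot> ?k = Ident A X \<boxtimes> LInv Y" by simp
  moreover have "(Ident A X \<boxtimes> LInv Y) \<cdot> (Ident A X \<boxtimes> LUnit A Y) \<cdot> ?k = ?k"
    by (simp add: TensorA_Comp_Arr_left)
  ultimately show ?thesis by simp
qed

lemma LInv_natural:
  assumes "f \<in> Arr A"
  shows "LInv (Cod A f) \<cdot> f = (Ident A (UnitO A) \<boxtimes> f) \<cdot> LInv (Dom A f)"
proof -
  note [simp] = assms
  have "LInv (Cod A f) \<cdot> f = LInv (Cod A f) \<cdot> (f \<cdot> LUnit A (Dom A f)) \<cdot> LInv (Dom A f)"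
    by (simp add: Comp_assoc_Arr)
  also have "\<dots> = LInv (Cod A f) \<cdot> (LUnit A (Cod A f) \<cdot> (Ident A (UnitO A) \<boxtimes> f)) \<cdot> LInv (Dom A f)"
    by (simp add: LUnit_natural_Arr)
  also have "\<dots> = (LInv (Cod A f) \<cdot> LUnit A (Cod A f)) \<cdot> (Ident A (UnitO A) \<boxtimes> f) \<cdot> LInv (Dom A f)"
    by (simp add: Comp_assoc_Arr del: inv_simps(4,5))
  finally show ?thesis by simp
qed

end

section \<open>The inner hom, the self-enrichment and the left tensor as a left adjoint\<close>

context symmetric_closed_monoidal_category
begin

lemma IHom_Ev_simps [simp]:
  assumes "X \<in> Obj A" "Y \<in> Obj A"
  shows "IHom A X Y \<in> Obj A" "Ev A X Y \<in> Arr A" "Dom A (Ev A X Y) = IHom A X Y \<otimes> X" "Cod A (Ev A X Y) = Y"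
  using IHom_Obj[OF assms] HomD[OF Ev_Hom[OF assms]] by auto

definition uncurry_arrow :: "'a \<Rightarrow> 'a \<Rightarrow> 'b \<Rightarrow> 'b" where
  "uncurry_arrow X Y f = Ev A X Y \<cdot> (f \<boxtimes> Ident A X)"

lemma uncurry_simps [simp]:
  assumes "X \<in> Obj A" "Y \<in> Obj A" "f \<in> Arr A" "Cod A f = IHom A X Y"
  shows "uncurry_arrow X Y f \<in> Arr A" "Dom A (uncurry_arrow X Y f) = Dom A f \<otimes> X"
    "Cod A (uncurry_arrow X Y f) = Y"
  using assms by (auto simp: uncurry_arrow_def)

lemma uncurry_Comp:
  assumes "X \<in> Obj A" "Y \<in> Obj A" "f \<in> Arr A" "Cod A f = IHom A X Y" "k \<in> Arr A" "Cod A k = Dom A f"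
  shows "uncurry_arrow X Y (f \<cdot> k) = uncurry_arrow X Y f \<cdot> (k \<boxtimes> Ident A X)"
  using assms by (simp add: uncurry_arrow_def Comp_assoc_Arr TensorA_Comp_Arr)

lemma curry_arrow:
  assumes "W \<in> Obj A" "X \<in> Obj A" "Y \<in> Obj A" "f \<in> Hom A (W \<otimes> X) Y"
  shows "curry_arrow A W X Y f \<in> Hom A W (IHom A X Y)"
    "uncurry_arrow X Y (curry_arrow A W X Y f) = f"
  using theI'[OF Ev_universal[OF assms]] by (auto simp: curry_arrow_def uncurry_arrow_def)

lemma uncurry_inj:
  assumes XY: "X \<in> Obj A" "Y \<in> Obj A" and f: "f \<in> Hom A W (IHom A X Y)" and g: "g \<in> Hom A W (IHom A X Y)"
    and eq: "uncurry_arrow X Y f = uncurry_arrow X Y g"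
  shows "f = g"
proof -
  have "uncurry_arrow X Y f \<in> Hom A (W \<otimes> X) Y" using XY HomD[OF f] by (auto intro!: HomI)
  from Ev_universal[OF Hom_Obj(1)[OF f] XY this] show ?thesis
    using f g eq unfolding uncurry_arrow_def by metis
qed

abbreviation "SE \<equiv> self_enriched A"

lemma SE_simps [simp]: "EObj SE = Obj A" "EHom SE = IHom A"
  by (simp_all add: self_enriched_def)

lemma EComp_SE:
  assumes "X \<in> Obj A" "Y \<in> Obj A" "Z \<in> Obj A"
  shows "EComp SE X Y Z \<in> Hom A (IHom A Y Z \<otimes> IHom A X Y) (IHom A X Z)"
    "uncurry_arrow X Z (EComp SE X Y Z)
      = Ev A Y Z \<cdot> (Ident A (IHom A Y Z) \<boxtimes> Ev A X Y) \<cdot> Assoc A (IHom A Y Z) (IHom A X Y) X"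
  unfolding self_enriched_def ecat.simps
  by (rule curry_arrow; use assms in \<open>auto intro!: HomI\<close>)+

lemma EIdent_SE:
  assumes "X \<in> Obj A"
  shows "EIdent SE X \<in> Hom A (UnitO A) (IHom A X X)" "uncurry_arrow X X (EIdent SE X) = LUnit A X"
  unfolding self_enriched_def ecat.simps
  by (rule curry_arrow; use assms in \<open>auto intro!: HomI\<close>)+

lemma EComp_SE_simps [simp]:
  assumes "X \<in> Obj A" "Y \<in> Obj A" "Z \<in> Obj A"
  shows "EComp SE X Y Z \<in> Arr A" "Dom A (EComp SE X Y Z) = IHom A Y Z \<otimes> IHom A X Y"
    "Cod A (EComp SE X Y Z) = IHom A X Z"
  using HomD[OF EComp_SE(1)[OF assms]] by auto

text \<open>Composition of generalized elements of inner homs, with \<open>f\<close> at stage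
  \<open>P\<close> and \<open>g\<close> at stage \<open>Q\<close>: transposed, it applies first
  \<open>g\<close> and then \<open>f\<close>. All later statements about
  \<open>self_enriched\<close> go through this formula.\<close>

lemma uncurry_EComp:
  assumes X: "X \<in> Obj A" and Y: "Y \<in> Obj A" and Z: "Z \<in> Obj A"
    and f: "f \<in> Hom A P (IHom A Y Z)" and g: "g \<in> Hom A Q (IHom A X Y)"
  shows "uncurry_arrow X Z (EComp SE X Y Z \<cdot> (f \<boxtimes> g))
    = uncurry_arrow Y Z f \<cdot> (Ident A P \<boxtimes> uncurry_arrow X Y g) \<cdot> Assoc A P Q X"
proof -
  note [simp] = X Y Z HomD[OF f] HomD[OF g] Hom_Obj[OF f] Hom_Obj[OF g]
  have "uncurry_arrow X Z (EComp SE X Y Z \<cdot> (f \<boxtimes> g))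
      = Ev A Y Z \<cdot> (Ident A (IHom A Y Z) \<boxtimes> Ev A X Y) \<cdot> Assoc A (IHom A Y Z) (IHom A X Y) X \<cdot> ((f \<boxtimes> g) \<boxtimes> Ident A X)"
    using uncurry_Comp[of X Z "EComp SE X Y Z" "f \<boxtimes> g"] EComp_SE(2)[OF X Y Z] by (simp add: Comp_assoc_Arr)
  also have "Assoc A (IHom A Y Z) (IHom A X Y) X \<cdot> ((f \<boxtimes> g) \<boxtimes> Ident A X) = (f \<boxtimes> (g \<boxtimes> Ident A X)) \<cdot> Assoc A P Q X"
    by (rule Assoc_natural[OF f g Ident_Hom[OF X]])
  also have "Ev A Y Z \<cdot> (Ident A (IHom A Y Z) \<boxtimes> Ev A X Y) \<cdot> (f \<boxtimes> (g \<boxtimes> Ident A X)) \<cdot> Assoc A P Q X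
      = uncurry_arrow Y Z f \<cdot> (Ident A P \<boxtimes> uncurry_arrow X Y g) \<cdot> Assoc A P Q X"
    by (simp add: uncurry_arrow_def Comp_assoc_Arr TensorA_Comp_Arr_left)
  finally show ?thesis .
qed

text \<open>The arrow X \<rightarrow> Y whose name is the global element \<open>f\<close> of
  [X, Y].\<close>

definition component :: "'a \<Rightarrow> 'a \<Rightarrow> 'b \<Rightarrow> 'b" where
  "component X Y f = uncurry_arrow X Y f \<cdot> LInv X"

lemma component_Hom:
  "\<lbrakk>X \<in> Obj A; Y \<in> Obj A; f \<in> Hom A (UnitO A) (IHom A X Y)\<rbrakk> \<Longrightarrow> component X Y f \<in> Hom A X Y"
  by (auto simp: component_def Hom_def)

lemma component_inj:
  assumes XY: "X \<in> Obj A" "Y \<in> Obj A"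
    and f: "f \<in> Hom A (UnitO A) (IHom A X Y)" and g: "g \<in> Hom A (UnitO A) (IHom A X Y)"
    and eq: "component X Y f = component X Y g"
  shows "f = g"
proof (rule uncurry_inj[OF XY f g])
  show "uncurry_arrow X Y f = uncurry_arrow X Y g"
    by (rule inverse_cancel_right[of "LInv X" "LUnit A X"])
      (use XY HomD[OF f] HomD[OF g] eq in \<open>auto simp: component_def\<close>)
qed

lemma component_surj:
  assumes h: "h \<in> Hom A X Y"
  obtains f where "f \<in> Hom A (UnitO A) (IHom A X Y)" "component X Y f = h"
proof
  note XY [simp] = Hom_Obj[OF h] and [simp] = HomD[OF h]
  let ?f = "curry_arrow A (UnitO A) X Y (h \<cdot> LUnit A X)"
  have "h \<cdot> LUnit A X \<in> Hom A (UnitO A \<otimes> X) Y" by (auto intro!: HomI)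
  note f = curry_arrow[OF UnitO_Obj XY this]
  show "?f \<in> Hom A (UnitO A) (IHom A X Y)" by (rule f)
  show "component X Y ?f = h" by (simp add: component_def f(2) Comp_assoc_Arr)
qed

lemma component_EIdent: "X \<in> Obj A \<Longrightarrow> component X X (EIdent SE X) = Ident A X"
  by (simp add: component_def EIdent_SE)

text \<open>The inverse unitor of I \<otimes> X produced by \<open>Assoc_LInv\<close> slides past
  the transpose of \<open>g\<close> by naturality and lands where the component of \<open>f\<close>
  needs it.\<close>

lemma component_EComp:
  assumes X: "X \<in> Obj A" and Y: "Y \<in> Obj A" and Z: "Z \<in> Obj A"
    and f: "f \<in> Hom A (UnitO A) (IHom A Y Z)" and g: "g \<in> Hom A (UnitO A) (IHom A X Y)"
  shows "component X Z (EComp SE X Y Z \<cdot> (f \<boxtimes> g) \<cdot> LInv (UnitO A)) = component Y Z f \<cdot> component X Y g"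
proof -
  note [simp] = X Y Z HomD[OF f] HomD[OF g]
  let ?I = "UnitO A" and ?uf = "uncurry_arrow Y Z f" and ?ug = "uncurry_arrow X Y g"
  have "uncurry_arrow X Z (EComp SE X Y Z \<cdot> (f \<boxtimes> g) \<cdot> LInv ?I)
      = uncurry_arrow X Z (EComp SE X Y Z \<cdot> (f \<boxtimes> g)) \<cdot> (LInv ?I \<boxtimes> Ident A X)"
    using uncurry_Comp[of X Z "EComp SE X Y Z \<cdot> (f \<boxtimes> g)" "LInv ?I"] by (simp add: Comp_assoc_Arr)
  also have "\<dots> = ?uf \<cdot> (Ident A ?I \<boxtimes> ?ug) \<cdot> LInv (?I \<otimes> X)"
    using Assoc_LInv[of ?I X] uncurry_EComp[OF X Y Z f g] by (simp add: Comp_assoc_Arr)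
  also have "\<dots> = ?uf \<cdot> LInv Y \<cdot> ?ug"
    using LInv_natural[of ?ug] by simp
  finally show ?thesis by (simp add: component_def Comp_assoc_Arr)
qed

text \<open>The inner hom is right adjoint to tensoring on the right, whereas the actions have C(a,
  b) on the left; the braiding passes from one to the other. Its symmetry makes the two
  transposition conditions equivalent.\<close>

lemma tensor_adjoint:
  assumes X: "X \<in> Obj A" and Y: "Y \<in> Obj A"
  shows "\<exists>H e. H \<in> Obj A \<and> e \<in> Hom A (X \<otimes> H) Y \<and>
    (\<forall>W. \<forall>f\<in>Hom A (X \<otimes> W) Y. W \<in> Obj A \<longrightarrow> (\<exists>!g. g \<in> Hom A W H \<and> e \<cdot> (Ident A X \<boxtimes> g) = f))"
proof (intro exI conjI allI ballI impI)
  note [simp] = X Y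
  have braid [simp]: "Braid A V W \<in> Arr A" "Dom A (Braid A V W) = V \<otimes> W" "Cod A (Braid A V W) = W \<otimes> V"
    if "V \<in> Obj A" "W \<in> Obj A" for V W using HomD[OF Braid_Hom[OF that]] by auto
  let ?H = "IHom A X Y" let ?e = "Ev A X Y \<cdot> Braid A X ?H"
  show "?H \<in> Obj A" "?e \<in> Hom A (X \<otimes> ?H) Y" by (auto intro!: HomI)
  fix W f assume f: "f \<in> Hom A (X \<otimes> W) Y" and W [simp]: "W \<in> Obj A"
  note [simp] = HomD[OF f]
  have *: "?e \<cdot> (Ident A X \<boxtimes> g) = f \<longleftrightarrow> uncurry_arrow X Y g = f \<cdot> Braid A W X" if g: "g \<in> Hom A W ?H" for g
  proof -
    note [simp] = HomD[OF g]
    have e: "?e \<cdot> (Ident A X \<boxtimes> g) = uncurry_arrow X Y g \<cdot> Braid A X W"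
      using Braid_natural[OF Ident_Hom[OF X] g] by (simp add: uncurry_arrow_def Comp_assoc_Arr)
    have "(uncurry_arrow X Y g \<cdot> Braid A X W) \<cdot> Braid A W X = uncurry_arrow X Y g"
      "(f \<cdot> Braid A W X) \<cdot> Braid A X W = f"
      using Braid_symmetric[of X W] Braid_symmetric[of W X] by (simp_all add: Comp_assoc_Arr)
    then show ?thesis unfolding e by metis
  qed
  have "f \<cdot> Braid A W X \<in> Hom A (W \<otimes> X) Y" by (auto intro!: HomI)
  from Ev_universal[OF W X Y this, folded uncurry_arrow_def] *
  show "\<exists>!g. g \<in> Hom A W ?H \<and> ?e \<cdot> (Ident A X \<boxtimes> g) = f" by metis
qed

end

section \<open>Enriched functors and transformations in terms of actions\<close>

locale enriched_modules = symmetric_closed_monoidal_category A + enriched_category A C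
  for A :: "('o, 'm, 'z) moncat_scheme" (structure) and C :: "('c, 'o, 'm, 'y) ecat_scheme"
begin

abbreviation "S \<equiv> EObj C"
abbreviation "Md \<equiv> Mod_cat A C"
abbreviation "FO a b X \<equiv> EHom C a b \<otimes> X"
abbreviation "FA a b f \<equiv> Ident A (EHom C a b) \<boxtimes> f"

text \<open>Re-bracketed composition of \<open>C\<close>: the multiplication of the many-object
  monad formed by the functors C(a, b) \<otimes> -, with \<open>eta\<close> as its unit. Modules are
  the algebras of this monad.\<close>

definition mu :: "'c \<Rightarrow> 'c \<Rightarrow> 'c \<Rightarrow> 'o \<Rightarrow> 'm" where
  "mu a b c X = (EComp C a b c \<boxtimes> Ident A X) \<cdot> AInv (EHom C b c) (EHom C a b) X"

definition eta :: "'c \<Rightarrow> 'o \<Rightarrow> 'm" where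
  "eta a X = (EIdent C a \<boxtimes> Ident A X) \<cdot> LInv X"

definition act :: "('c, 'o, 'm) efunctor \<Rightarrow> 'c \<Rightarrow> 'c \<Rightarrow> 'm" where
  "act T a b = uncurry_arrow (FObj T a) (FObj T b) (FHom T a b)"

definition cpt :: "'c \<Rightarrow> ('c, 'o, 'm) efunctor \<times> ('c, 'o, 'm) efunctor \<times> ('c \<Rightarrow> 'm) \<Rightarrow> 'm" where
  "cpt a u = component (FObj (fst u) a) (FObj (fst (snd u)) a) (snd (snd u) a)"

lemma C_simps [simp]:
  assumes "a \<in> S"
  shows "b \<in> S \<Longrightarrow> EHom C a b \<in> Obj A"
    "\<lbrakk>b \<in> S; c \<in> S\<rbrakk> \<Longrightarrow> EComp C a b c \<in> Arr A"
    "\<lbrakk>b \<in> S; c \<in> S\<rbrakk> \<Longrightarrow> Dom A (EComp C a b c) = EHom C b c \<otimes> EHom C a b"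
    "\<lbrakk>b \<in> S; c \<in> S\<rbrakk> \<Longrightarrow> Cod A (EComp C a b c) = EHom C a c"
    "EIdent C a \<in> Arr A" "Dom A (EIdent C a) = UnitO A" "Cod A (EIdent C a) = EHom C a a"
  using EHom_Obj[OF assms] EComp_Hom[OF assms] EIdent_Hom[OF assms] by (auto simp: Hom_def)

lemma mu_Hom:
  assumes "a \<in> S" "b \<in> S" "c \<in> S" "X \<in> Obj A"
  shows "mu a b c X \<in> Hom A (FO b c (FO a b X)) (FO a c X)"
  using assms by (auto simp: mu_def intro!: HomI)

lemma mu_natural:
  assumes a: "a \<in> S" "b \<in> S" "c \<in> S" and f: "f \<in> Hom A X Y"
  shows "mu a b c Y \<cdot> FA b c (FA a b f) = FA a c f \<cdot> mu a b c X"
proof -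
  note [simp] = a HomD[OF f] Hom_Obj[OF f]
  let ?B = "EHom C b c" and ?A = "EHom C a b"
  have "Assoc A ?B ?A Y \<cdot> ((Ident A ?B \<boxtimes> Ident A ?A) \<boxtimes> f) = FA b c (FA a b f) \<cdot> Assoc A ?B ?A X"
    by (rule Assoc_natural[OF _ _ f]) (auto intro!: HomI)
  then have "AInv ?B ?A Y \<cdot> (Assoc A ?B ?A Y \<cdot> (Ident A (?B \<otimes> ?A) \<boxtimes> f)) \<cdot> AInv ?B ?A X
      = AInv ?B ?A Y \<cdot> (FA b c (FA a b f) \<cdot> Assoc A ?B ?A X) \<cdot> AInv ?B ?A X"
    by simp
  moreover have "AInv ?B ?A Y \<cdot> (Assoc A ?B ?A Y \<cdot> (Ident A (?B \<otimes> ?A) \<boxtimes> f)) \<cdot> AInv ?B ?A X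
      = (AInv ?B ?A Y \<cdot> Assoc A ?B ?A Y) \<cdot> (Ident A (?B \<otimes> ?A) \<boxtimes> f) \<cdot> AInv ?B ?A X"
    by (simp add: Comp_assoc_Arr del: AInv_simps(4,5))
  moreover have "AInv ?B ?A Y \<cdot> (FA b c (FA a b f) \<cdot> Assoc A ?B ?A X) \<cdot> AInv ?B ?A X
      = AInv ?B ?A Y \<cdot> FA b c (FA a b f)"
    by (simp add: Comp_assoc_Arr)
  ultimately have *: "AInv ?B ?A Y \<cdot> FA b c (FA a b f) = (Ident A (?B \<otimes> ?A) \<boxtimes> f) \<cdot> AInv ?B ?A X"
    by simp
  then show ?thesis
    by (simp add: mu_def Comp_assoc_Arr TensorA_Comp_Arr_left)
qed

lemma eta_Hom: "\<lbrakk>a \<in> S; X \<in> Obj A\<rbrakk> \<Longrightarrow> eta a X \<in> Hom A X (FO a a X)"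
  by (auto simp: eta_def intro!: HomI)

lemma eta_natural:
  assumes a: "a \<in> S" and f: "f \<in> Hom A X Y"
  shows "eta a Y \<cdot> f = FA a a f \<cdot> eta a X"
proof -
  note [simp] = a HomD[OF f] Hom_Obj[OF f]
  show ?thesis using LInv_natural[of f] by (simp add: eta_def Comp_assoc_Arr TensorA_Comp_Arr_left)
qed

text \<open>Both sides are transposed, which loses nothing by \<open>uncurry_inj\<close>. The
  associator that \<open>uncurry_EComp\<close> leaves on one side is invertible and is moved into
  \<open>mu\<close> on the other.\<close>

lemma functor_multiplicative_iff:
  assumes abc: "a \<in> S" "b \<in> S" "c \<in> S"
    and O: "FObj T a \<in> Obj A" "FObj T b \<in> Obj A" "FObj T c \<in> Obj A"
    and H: "FHom T a b \<in> Hom A (EHom C a b) (IHom A (FObj T a) (FObj T b))"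
      "FHom T b c \<in> Hom A (EHom C b c) (IHom A (FObj T b) (FObj T c))"
      "FHom T a c \<in> Hom A (EHom C a c) (IHom A (FObj T a) (FObj T c))"
  shows "FHom T a c \<cdot> EComp C a b c = EComp SE (FObj T a) (FObj T b) (FObj T c) \<cdot> (FHom T b c \<boxtimes> FHom T a b)
    \<longleftrightarrow> act T a c \<cdot> mu a b c (FObj T a) = act T b c \<cdot> FA b c (act T a b)" (is "?l = ?r \<longleftrightarrow> _")
proof -
  note [simp] = abc O HomD[OF H(1)] HomD[OF H(2)] HomD[OF H(3)]
  let ?u = "uncurry_arrow (FObj T a) (FObj T c)"
  let ?B = "EHom C b c" and ?A = "EHom C a b"
  have lr: "?l \<in> Hom A (?B \<otimes> ?A) (IHom A (FObj T a) (FObj T c))" "?r \<in> Hom A (?B \<otimes> ?A) (IHom A (FObj T a) (FObj T c))"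
    by (auto intro!: HomI)
  have "?l = ?r \<longleftrightarrow> ?u ?l = ?u ?r"
    by (rule iffI, erule arg_cong, rule uncurry_inj[OF O(1,3) lr])
  also have "\<dots> \<longleftrightarrow> act T a c \<cdot> (EComp C a b c \<boxtimes> Ident A (FObj T a))
      = act T b c \<cdot> FA b c (act T a b) \<cdot> Assoc A ?B ?A (FObj T a)" (is "_ \<longleftrightarrow> ?l' = ?r'")
    using uncurry_EComp[OF O H(2,1)] uncurry_Comp[of "FObj T a" "FObj T c" "FHom T a c" "EComp C a b c"]
    by (simp add: act_def)
  also have "\<dots> \<longleftrightarrow> act T a c \<cdot> mu a b c (FObj T a) = act T b c \<cdot> FA b c (act T a b)"
  proof
    assume "?l' = ?r'"
    then have "?l' \<cdot> AInv ?B ?A (FObj T a) = ?r' \<cdot> AInv ?B ?A (FObj T a)" by simp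
    then show "act T a c \<cdot> mu a b c (FObj T a) = act T b c \<cdot> FA b c (act T a b)"
      by (simp add: act_def mu_def Comp_assoc_Arr)
  next
    assume "act T a c \<cdot> mu a b c (FObj T a) = act T b c \<cdot> FA b c (act T a b)"
    then have "(act T a c \<cdot> mu a b c (FObj T a)) \<cdot> Assoc A ?B ?A (FObj T a)
        = (act T b c \<cdot> FA b c (act T a b)) \<cdot> Assoc A ?B ?A (FObj T a)" by simp
    then show "?l' = ?r'"
      by (simp add: act_def mu_def Comp_assoc_Arr)
  qed
  finally show ?thesis .
qed

text \<open>Both sides are global elements of an inner hom, so they may be compared by the arrows
  they name.\<close>

lemma functor_unital_iff:
  assumes a: "a \<in> S" and O: "FObj T a \<in> Obj A"
    and H: "FHom T a a \<in> Hom A (EHom C a a) (IHom A (FObj T a) (FObj T a))"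
  shows "FHom T a a \<cdot> EIdent C a = EIdent SE (FObj T a)
    \<longleftrightarrow> act T a a \<cdot> eta a (FObj T a) = Ident A (FObj T a)" (is "?l = ?r \<longleftrightarrow> _")
proof -
  note [simp] = a O HomD[OF H]
  have l: "?l \<in> Hom A (UnitO A) (IHom A (FObj T a) (FObj T a))" by (auto intro!: HomI)
  let ?k = "component (FObj T a) (FObj T a)"
  have "?l = ?r \<longleftrightarrow> ?k ?l = ?k ?r"
    by (rule iffI, erule arg_cong, rule component_inj[OF O O l EIdent_SE(1)[OF O]])
  also have "?k ?l = act T a a \<cdot> eta a (FObj T a)"
    using uncurry_Comp[of "FObj T a" "FObj T a" "FHom T a a" "EIdent C a"]
    by (simp add: component_def act_def eta_def Comp_assoc_Arr)
  finally show ?thesis by (simp add: component_EIdent)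
qed

text \<open>The two sides of enriched naturality carry the inverse left and right unitors of C(a,
  b). After transposition these combine with the associators of \<open>uncurry_EComp\<close>, by
  \<open>Assoc_LInv\<close> and \<open>Assoc_RInv\<close> respectively, into inverse left unitors
  that turn the components of \<alpha> into ordinary arrows.\<close>

lemma transformation_natural_iff:
  assumes ab: "a \<in> S" "b \<in> S"
    and O: "FObj T a \<in> Obj A" "FObj T b \<in> Obj A" "FObj R a \<in> Obj A" "FObj R b \<in> Obj A"
    and H: "FHom T a b \<in> Hom A (EHom C a b) (IHom A (FObj T a) (FObj T b))"
      "FHom R a b \<in> Hom A (EHom C a b) (IHom A (FObj R a) (FObj R b))"
    and al: "\<alpha> a \<in> Hom A (UnitO A) (IHom A (FObj T a) (FObj R a))"
      "\<alpha> b \<in> Hom A (UnitO A) (IHom A (FObj T b) (FObj R b))"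
  shows "EComp SE (FObj T a) (FObj T b) (FObj R b) \<cdot> (\<alpha> b \<boxtimes> FHom T a b) \<cdot> LInv (EHom C a b)
      = EComp SE (FObj T a) (FObj R a) (FObj R b) \<cdot> (FHom R a b \<boxtimes> \<alpha> a) \<cdot> RInv (EHom C a b)
    \<longleftrightarrow> cpt b (T, R, \<alpha>) \<cdot> act T a b = act R a b \<cdot> FA a b (cpt a (T, R, \<alpha>))" (is "?l = ?r \<longleftrightarrow> _")
proof -
  note [simp] = ab O HomD[OF H(1)] HomD[OF H(2)] HomD[OF al(1)] HomD[OF al(2)]
  let ?u = "uncurry_arrow (FObj T a) (FObj R b)" and ?A = "EHom C a b"
  have lr: "?l \<in> Hom A ?A (IHom A (FObj T a) (FObj R b))" "?r \<in> Hom A ?A (IHom A (FObj T a) (FObj R b))"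
    by (auto intro!: HomI)
  have "?u ?l = ?u (EComp SE (FObj T a) (FObj T b) (FObj R b) \<cdot> (\<alpha> b \<boxtimes> FHom T a b)) \<cdot> (LInv ?A \<boxtimes> Ident A (FObj T a))"
    using uncurry_Comp[of "FObj T a" "FObj R b" "EComp SE (FObj T a) (FObj T b) (FObj R b) \<cdot> (\<alpha> b \<boxtimes> FHom T a b)" "LInv ?A"]
    by (simp add: Comp_assoc_Arr)
  also have "\<dots> = uncurry_arrow (FObj T b) (FObj R b) (\<alpha> b) \<cdot> (Ident A (UnitO A) \<boxtimes> act T a b) \<cdot> LInv (?A \<otimes> FObj T a)"
    using uncurry_EComp[OF O(1,2,4) al(2) H(1)] Assoc_LInv[of ?A "FObj T a"] by (simp add: act_def Comp_assoc_Arr)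
  also have "\<dots> = cpt b (T, R, \<alpha>) \<cdot> act T a b"
    using LInv_natural[of "act T a b"] by (simp add: act_def cpt_def component_def Comp_assoc_Arr)
  finally have l: "?u ?l = cpt b (T, R, \<alpha>) \<cdot> act T a b" .
  have "?u ?r = ?u (EComp SE (FObj T a) (FObj R a) (FObj R b) \<cdot> (FHom R a b \<boxtimes> \<alpha> a)) \<cdot> (RInv ?A \<boxtimes> Ident A (FObj T a))"
    using uncurry_Comp[of "FObj T a" "FObj R b" "EComp SE (FObj T a) (FObj R a) (FObj R b) \<cdot> (FHom R a b \<boxtimes> \<alpha> a)" "RInv ?A"]
    by (simp add: Comp_assoc_Arr)
  also have "\<dots> = act R a b \<cdot> FA a b (uncurry_arrow (FObj T a) (FObj R a) (\<alpha> a)) \<cdot> FA a b (LInv (FObj T a))"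
    using uncurry_EComp[OF O(1,3,4) H(2) al(1)] Assoc_RInv[of ?A "FObj T a"] by (simp add: act_def Comp_assoc_Arr)
  also have "\<dots> = act R a b \<cdot> FA a b (cpt a (T, R, \<alpha>))"
    by (simp add: cpt_def component_def TensorA_Comp_Arr)
  finally have r: "?u ?r = act R a b \<cdot> FA a b (cpt a (T, R, \<alpha>))" .
  show ?thesis
    unfolding l[symmetric] r[symmetric] by (rule iffI, erule arg_cong, rule uncurry_inj[OF O(1,4) lr])
qed

lemma Mod_simps:
  "Obj Md = {F. enriched_functor A C SE F}"
  "Arr Md = {(T, R, \<alpha>). enriched_functor A C SE T \<and> enriched_functor A C SE R \<and> enriched_transformation A C SE T R \<alpha>}"
  "Dom Md (T, R, \<alpha>) = T" "Cod Md (T, R, \<alpha>) = R"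
  "Ident Md T = (T, T, restrict (\<lambda>a. EIdent SE (FObj T a)) S)"
  "(R, Q, \<beta>) \<cdot>\<^bsub>Md\<^esub> (T, R', \<alpha>) = (T, Q,
      restrict (\<lambda>a. EComp SE (FObj T a) (FObj R a) (FObj Q a) \<cdot> (\<beta> a \<boxtimes> \<alpha> a) \<cdot> LInv (UnitO A)) S)"
  by (simp_all add: Mod_cat_def enriched_functor_category_def)

lemma Obj_Mod_D:
  assumes "T \<in> Obj Md" "a \<in> S"
  shows "FObj T a \<in> Obj A" "b \<in> S \<Longrightarrow> FHom T a b \<in> Hom A (EHom C a b) (IHom A (FObj T a) (FObj T b))"
  using assms by (auto simp: Mod_simps enriched_functor_def)

lemma Hom_Mod_iff:
  "u \<in> Hom Md T R \<longleftrightarrow> (\<exists>\<alpha>. u = (T, R, \<alpha>) \<and> T \<in> Obj Md \<and> R \<in> Obj Md \<and> \<alpha> \<in> extensional S \<and>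
    (\<forall>a\<in>S. \<alpha> a \<in> Hom A (UnitO A) (IHom A (FObj T a) (FObj R a))) \<and>
    (\<forall>a\<in>S. \<forall>b\<in>S. cpt b u \<cdot> act T a b = act R a b \<cdot> FA a b (cpt a u)))"
proof -
  have "u \<in> Hom Md T R \<longleftrightarrow> (\<exists>\<alpha>. u = (T, R, \<alpha>) \<and> T \<in> Obj Md \<and> R \<in> Obj Md \<and> enriched_transformation A C SE T R \<alpha>)"
    by (cases u) (auto simp: Hom_def Mod_simps)
  moreover have "enriched_transformation A C SE T R \<alpha> \<longleftrightarrow> \<alpha> \<in> extensional S \<and>
      (\<forall>a\<in>S. \<alpha> a \<in> Hom A (UnitO A) (IHom A (FObj T a) (FObj R a))) \<and>
      (\<forall>a\<in>S. \<forall>b\<in>S. cpt b (T, R, \<alpha>) \<cdot> act T a b = act R a b \<cdot> FA a b (cpt a (T, R, \<alpha>)))"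
    if T: "T \<in> Obj Md" and R: "R \<in> Obj Md" for \<alpha>
  proof -
    have "EComp SE (FObj T a) (FObj T b) (FObj R b) \<cdot> (\<alpha> b \<boxtimes> FHom T a b) \<cdot> LInv (EHom C a b)
        = EComp SE (FObj T a) (FObj R a) (FObj R b) \<cdot> (FHom R a b \<boxtimes> \<alpha> a) \<cdot> RInv (EHom C a b)
      \<longleftrightarrow> cpt b (T, R, \<alpha>) \<cdot> act T a b = act R a b \<cdot> FA a b (cpt a (T, R, \<alpha>))"
      if "\<forall>a\<in>S. \<alpha> a \<in> Hom A (UnitO A) (IHom A (FObj T a) (FObj R a))" "a \<in> S" "b \<in> S" for a b
      by (rule transformation_natural_iff) (use that Obj_Mod_D[OF T] Obj_Mod_D[OF R] in auto)
    then show ?thesis unfolding enriched_transformation_def SE_simps by metis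
  qed
  ultimately show ?thesis by blast
qed

lemma act_Hom:
  assumes "a \<in> S" "b \<in> S" "T \<in> Obj Md"
  shows "act T a b \<in> Hom A (FO a b (FObj T a)) (FObj T b)"
  using Obj_Mod_D[OF assms(3)] assms(1,2) by (auto simp: act_def Hom_def)

lemma act_mu:
  assumes "a \<in> S" "b \<in> S" "c \<in> S" "T \<in> Obj Md"
  shows "act T a c \<cdot> mu a b c (FObj T a) = act T b c \<cdot> FA b c (act T a b)"
proof -
  have "FHom T a c \<cdot> EComp C a b c = EComp SE (FObj T a) (FObj T b) (FObj T c) \<cdot> (FHom T b c \<boxtimes> FHom T a b)"
    using assms by (simp add: Mod_simps enriched_functor_def)
  then show ?thesis using functor_multiplicative_iff[of a b c T] Obj_Mod_D[OF assms(4)] assms by blast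
qed

lemma act_eta:
  assumes "a \<in> S" "T \<in> Obj Md"
  shows "act T a a \<cdot> eta a (FObj T a) = Ident A (FObj T a)"
proof -
  have "FHom T a a \<cdot> EIdent C a = EIdent SE (FObj T a)"
    using assms by (simp add: Mod_simps enriched_functor_def)
  then show ?thesis using functor_unital_iff[of a T] Obj_Mod_D[OF assms(2)] assms by blast
qed

lemma ex_object:
  assumes P: "\<And>a. a \<in> S \<Longrightarrow> P a \<in> Obj A"
    and pi: "\<And>a b. \<lbrakk>a \<in> S; b \<in> S\<rbrakk> \<Longrightarrow> pi a b \<in> Hom A (FO a b (P a)) (P b)"
    and mult: "\<And>a b c. \<lbrakk>a \<in> S; b \<in> S; c \<in> S\<rbrakk> \<Longrightarrow> pi a c \<cdot> mu a b c (P a) = pi b c \<cdot> FA b c (pi a b)"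
    and unit: "\<And>a. a \<in> S \<Longrightarrow> pi a a \<cdot> eta a (P a) = Ident A (P a)"
  shows "\<exists>T\<in>Obj Md. (\<forall>a\<in>S. FObj T a = P a) \<and> (\<forall>a\<in>S. \<forall>b\<in>S. act T a b = pi a b)"
proof -
  \<comment> \<open>Both fields are cut down to \<open>S\<close> since
    \<open>enriched_functor\<close> prescribes the junk values. The two-argument field is restricted
    in paired form, the form in which its extensionality is stated.\<close>
  define T where "T = \<lparr>FObj = restrict P S,
    FHom = curry (restrict (\<lambda>(a, b). curry_arrow A (EHom C a b) (P a) (P b) (pi a b)) (S \<times> S))\<rparr>"
  have O: "FObj T a = P a" if "a \<in> S" for a using that by (simp add: T_def)
  have H: "FHom T a b = curry_arrow A (EHom C a b) (P a) (P b) (pi a b)" if "a \<in> S" "b \<in> S" for a b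
    using that by (simp add: T_def)
  have HH: "FHom T a b \<in> Hom A (EHom C a b) (IHom A (FObj T a) (FObj T b))" if "a \<in> S" "b \<in> S" for a b
    using curry_arrow(1)[OF EHom_Obj P P pi] that by (simp add: H O)
  have act: "act T a b = pi a b" if "a \<in> S" "b \<in> S" for a b
    using curry_arrow(2)[OF EHom_Obj P P pi] that by (simp add: act_def H O)
  have FO: "FObj T a \<in> Obj A" if "a \<in> S" for a using P O that by simp
  have "enriched_functor A C SE T"
    unfolding enriched_functor_def SE_simps
  proof (intro conjI ballI)
    fix a assume a: "a \<in> S"
    show "FHom T a a \<cdot> EIdent C a = EIdent SE (FObj T a)"
      using functor_unital_iff[OF a FO HH] unit a by (simp add: act O)
    fix b c assume bc: "b \<in> S" "c \<in> S"
    show "FHom T a c \<cdot> EComp C a b c = EComp SE (FObj T a) (FObj T b) (FObj T c) \<cdot> (FHom T b c \<boxtimes> FHom T a b)"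
      using functor_multiplicative_iff[OF a bc FO FO FO HH HH HH] mult a bc by (simp add: act O)
  qed (use FO HH in \<open>auto simp: T_def\<close>)
  then show ?thesis using O act by (intro bexI[of _ T]) (auto simp: Mod_simps)
qed

lemma cpt_Hom: "\<lbrakk>a \<in> S; u \<in> Hom Md T R\<rbrakk> \<Longrightarrow> cpt a u \<in> Hom A (FObj T a) (FObj R a)"
  using component_Hom Obj_Mod_D by (auto simp: Hom_Mod_iff cpt_def)

lemma cpt_act: "\<lbrakk>a \<in> S; b \<in> S; u \<in> Hom Md T R\<rbrakk> \<Longrightarrow> cpt b u \<cdot> act T a b = act R a b \<cdot> FA a b (cpt a u)"
  by (auto simp: Hom_Mod_iff)

lemma ex_arrow:
  assumes T: "T \<in> Obj Md" and R: "R \<in> Obj Md"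
    and h: "\<And>a. a \<in> S \<Longrightarrow> h a \<in> Hom A (FObj T a) (FObj R a)"
    and hact: "\<And>a b. \<lbrakk>a \<in> S; b \<in> S\<rbrakk> \<Longrightarrow> h b \<cdot> act T a b = act R a b \<cdot> FA a b (h a)"
  shows "\<exists>u\<in>Hom Md T R. \<forall>a\<in>S. cpt a u = h a"
proof -
  have "\<exists>f. f \<in> Hom A (UnitO A) (IHom A (FObj T a) (FObj R a)) \<and> component (FObj T a) (FObj R a) f = h a"
    if "a \<in> S" for a
    using component_surj[OF h[OF that]] by metis
  then obtain f where f: "\<And>a. a \<in> S \<Longrightarrow> f a \<in> Hom A (UnitO A) (IHom A (FObj T a) (FObj R a))"
    "\<And>a. a \<in> S \<Longrightarrow> component (FObj T a) (FObj R a) (f a) = h a" by metis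
  have c: "cpt a (T, R, restrict f S) = h a" if "a \<in> S" for a
    using that f by (simp add: cpt_def)
  have "(T, R, restrict f S) \<in> Hom Md T R"
    using T R f(1) hact by (simp add: Hom_Mod_iff c)
  with c show ?thesis by blast
qed

lemma faithful:
  assumes u: "u \<in> Hom Md T R" and v: "v \<in> Hom Md T R" and eq: "\<And>a. a \<in> S \<Longrightarrow> cpt a u = cpt a v"
  shows "u = v"
proof -
  from u v obtain \<alpha> \<beta> where *: "u = (T, R, \<alpha>)" "v = (T, R, \<beta>)" "\<alpha> \<in> extensional S" "\<beta> \<in> extensional S"
    "T \<in> Obj Md" "R \<in> Obj Md"
    "\<And>a. a \<in> S \<Longrightarrow> \<alpha> a \<in> Hom A (UnitO A) (IHom A (FObj T a) (FObj R a))"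
    "\<And>a. a \<in> S \<Longrightarrow> \<beta> a \<in> Hom A (UnitO A) (IHom A (FObj T a) (FObj R a))"
    by (auto simp: Hom_Mod_iff)
  have "\<alpha> = \<beta>"
  proof (rule extensionalityI[OF *(3,4)])
    fix a assume a: "a \<in> S"
    show "\<alpha> a = \<beta> a"
      by (rule component_inj[OF Obj_Mod_D(1)[OF *(5) a] Obj_Mod_D(1)[OF *(6) a] *(7,8)[OF a]])
        (use eq[OF a] * in \<open>simp add: cpt_def\<close>)
  qed
  then show ?thesis using * by simp
qed

lemma cpt_Ident: "\<lbrakk>a \<in> S; T \<in> Obj Md\<rbrakk> \<Longrightarrow> cpt a (Ident Md T) = Ident A (FObj T a)"
  using component_EIdent Obj_Mod_D by (simp add: Mod_simps(5) cpt_def)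

lemma cpt_Comp:
  assumes "a \<in> S" "u \<in> Hom Md T R" "v \<in> Hom Md R Q"
  shows "cpt a (v \<cdot>\<^bsub>Md\<^esub> u) = cpt a v \<cdot> cpt a u"
  using assms component_EComp Obj_Mod_D by (auto simp: Hom_Mod_iff cpt_def Mod_simps(6))

lemma FA_Comp:
  assumes "a \<in> S" "b \<in> S" "f \<in> Hom A X Y" "g \<in> Hom A Y Z"
  shows "FA a b (g \<cdot> f) = FA a b g \<cdot> FA a b f"
  using assms by (simp add: TensorA_Comp_Arr Hom_def)

section \<open>Modules form a category, and its arrows are equivariant families\<close>

lemma Ident_Mod: "T \<in> Obj Md \<Longrightarrow> Ident Md T \<in> Hom Md T T"
proof -
  assume T: "T \<in> Obj Md"
  have "cpt b (Ident Md T) \<cdot> act T a b = act T a b \<cdot> FA a b (cpt a (Ident Md T))" if "a \<in> S" "b \<in> S" for a b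
    using cpt_Ident[OF _ T] that Ident_Comp[OF act_Hom[OF that T]] Comp_Ident[OF act_Hom[OF that T]]
      Obj_Mod_D[OF T] by simp
  then show ?thesis
    using T EIdent_SE(1)[OF Obj_Mod_D(1)[OF T]] unfolding Hom_Mod_iff by (auto simp: Mod_simps(5))
qed

lemma Comp_Mod:
  assumes u: "u \<in> Hom Md T R" and v: "v \<in> Hom Md R Q"
  shows "v \<cdot>\<^bsub>Md\<^esub> u \<in> Hom Md T Q"
proof -
  have TRQ: "T \<in> Obj Md" "R \<in> Obj Md" "Q \<in> Obj Md" using u v by (auto simp: Hom_Mod_iff)
  have "cpt b (v \<cdot>\<^bsub>Md\<^esub> u) \<cdot> act T a b = act Q a b \<cdot> FA a b (cpt a (v \<cdot>\<^bsub>Md\<^esub> u))" if ab: "a \<in> S" "b \<in> S" for a b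
  proof -
    note ua = cpt_Hom[OF ab(1) u] and ub = cpt_Hom[OF ab(2) u] and va = cpt_Hom[OF ab(1) v] and vb = cpt_Hom[OF ab(2) v]
    note TA = TensorA_Hom[OF Ident_Hom[OF EHom_Obj[OF ab]]]
    show ?thesis
      using cpt_Comp[OF ab(1) u v] cpt_Comp[OF ab(2) u v] FA_Comp[OF ab ua va]
        Comp_assoc[OF act_Hom[OF ab TRQ(1)] ub vb] cpt_act[OF ab u] cpt_act[OF ab v]
        Comp_assoc[OF TA[OF ua] act_Hom[OF ab TRQ(2)] vb] Comp_assoc[OF TA[OF ua] TA[OF va] act_Hom[OF ab TRQ(3)]]
      by simp
  qed
  moreover from u v obtain \<alpha> \<beta> where *: "u = (T, R, \<alpha>)" "v = (R, Q, \<beta>)"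
    "\<And>a. a \<in> S \<Longrightarrow> \<alpha> a \<in> Hom A (UnitO A) (IHom A (FObj T a) (FObj R a))"
    "\<And>a. a \<in> S \<Longrightarrow> \<beta> a \<in> Hom A (UnitO A) (IHom A (FObj R a) (FObj Q a))"
    by (auto simp: Hom_Mod_iff)
  moreover have "EComp SE (FObj T a) (FObj R a) (FObj Q a) \<cdot> (\<beta> a \<boxtimes> \<alpha> a) \<cdot> LInv (UnitO A)
      \<in> Hom A (UnitO A) (IHom A (FObj T a) (FObj Q a))" if a: "a \<in> S" for a
    using Obj_Mod_D(1)[OF _ a] TRQ HomD[OF *(3)[OF a]] HomD[OF *(4)[OF a]] by (auto intro!: HomI)
  ultimately show ?thesis using TRQ unfolding Hom_Mod_iff by (auto simp: Mod_simps(6))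
qed

text \<open>The laws are equations between parallel arrows, so \<open>faithful\<close> reduces them
  to components, where \<open>cpt_Ident\<close> and \<open>cpt_Comp\<close> make them the laws of
  \<open>A\<close>.\<close>

lemma category_Mod: "category Md"
proof
  show "f \<in> Arr Md \<Longrightarrow> Dom Md f \<in> Obj Md" "f \<in> Arr Md \<Longrightarrow> Cod Md f \<in> Obj Md" for f
    by (auto simp: Mod_simps)
  show "T \<in> Obj Md \<Longrightarrow> Ident Md T \<in> Hom Md T T" for T by (rule Ident_Mod)
  show "\<lbrakk>u \<in> Hom Md T R; v \<in> Hom Md R Q\<rbrakk> \<Longrightarrow> v \<cdot>\<^bsub>Md\<^esub> u \<in> Hom Md T Q" for u v T R Q by (rule Comp_Mod)
  fix u T R assume u: "u \<in> Hom Md T R"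
  then have TR: "T \<in> Obj Md" "R \<in> Obj Md" by (auto simp: Hom_Mod_iff)
  note iT = Ident_Mod[OF TR(1)] and iR = Ident_Mod[OF TR(2)]
  show "u \<cdot>\<^bsub>Md\<^esub> Ident Md T = u"
    by (rule faithful[OF Comp_Mod[OF iT u] u])
      (simp add: cpt_Comp[OF _ iT u] cpt_Ident[OF _ TR(1)] Comp_Ident[OF cpt_Hom[OF _ u]])
  show "Ident Md R \<cdot>\<^bsub>Md\<^esub> u = u"
    by (rule faithful[OF Comp_Mod[OF u iR] u])
      (simp add: cpt_Comp[OF _ u iR] cpt_Ident[OF _ TR(2)] Ident_Comp[OF cpt_Hom[OF _ u]])
  fix v w Q P assume v: "v \<in> Hom Md R Q" and w: "w \<in> Hom Md Q P"
  show "(w \<cdot>\<^bsub>Md\<^esub> v) \<cdot>\<^bsub>Md\<^esub> u = w \<cdot>\<^bsub>Md\<^esub> v \<cdot>\<^bsub>Md\<^esub> u"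
  proof (rule faithful[OF Comp_Mod[OF u Comp_Mod[OF v w]] Comp_Mod[OF Comp_Mod[OF u v] w]])
    fix a assume a: "a \<in> S"
    show "cpt a ((w \<cdot>\<^bsub>Md\<^esub> v) \<cdot>\<^bsub>Md\<^esub> u) = cpt a (w \<cdot>\<^bsub>Md\<^esub> v \<cdot>\<^bsub>Md\<^esub> u)"
      using cpt_Comp[OF a u Comp_Mod[OF v w]] cpt_Comp[OF a Comp_Mod[OF u v] w] cpt_Comp[OF a u v] cpt_Comp[OF a v w]
        Comp_assoc[OF cpt_Hom[OF a u] cpt_Hom[OF a v] cpt_Hom[OF a w]] by simp
  qed
qed

lemma graded_algebras_Mod:
  fixes plus :: "'m \<Rightarrow> 'm \<Rightarrow> 'm" and zero :: "'o \<Rightarrow> 'o \<Rightarrow> 'm"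
  assumes "abelian_category A" "additive_structure A plus zero"
  shows "graded_algebras A plus zero Md S (\<lambda>a b X. FO a b X) (\<lambda>a b f. FA a b f) mu eta (\<lambda>a T. FObj T a) cpt act"
proof (intro graded_algebras.intro graded_algebras_axioms.intro assms(2) category_Mod)
  interpret abelian_category A by fact
  show "\<exists>T\<in>Obj Md. (\<forall>a\<in>S. FObj T a = P a) \<and> (\<forall>a\<in>S. \<forall>b\<in>S. act T a b = pi a b)"
    if "\<And>a. a \<in> S \<Longrightarrow> P a \<in> Obj A" "\<And>a b. \<lbrakk>a \<in> S; b \<in> S\<rbrakk> \<Longrightarrow> pi a b \<in> Hom A (FO a b (P a)) (P b)"
      "\<And>a b c. \<lbrakk>a \<in> S; b \<in> S; c \<in> S\<rbrakk> \<Longrightarrow> pi a c \<cdot> mu a b c (P a) = pi b c \<cdot> FA b c (pi a b)"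
      "\<And>a. a \<in> S \<Longrightarrow> pi a a \<cdot> eta a (P a) = Ident A (P a)" for P pi
    using ex_object[OF that] .
  show "\<exists>u\<in>Hom Md T R. \<forall>a\<in>S. cpt a u = h a"
    if "T \<in> Obj Md" "R \<in> Obj Md" "\<And>a. a \<in> S \<Longrightarrow> h a \<in> Hom A (FObj T a) (FObj R a)"
    "\<And>a b. \<lbrakk>a \<in> S; b \<in> S\<rbrakk> \<Longrightarrow> h b \<cdot> act T a b = act R a b \<cdot> FA a b (h a)" for T R h
    using ex_arrow[OF that] .
  show "u = v" if "u \<in> Hom Md T R" "v \<in> Hom Md T R" "\<And>a. a \<in> S \<Longrightarrow> cpt a u = cpt a v" for u v T R
    using faithful[OF that] .
  show "FA a b f \<in> Hom A (FO a b X) (FO a b Y)" if "a \<in> S" "b \<in> S" "f \<in> Hom A X Y" for a b f X Y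
    using TensorA_Hom[OF Ident_Hom[OF EHom_Obj] that(3)] that by simp
  show "\<exists>P p. is_product A (UNIV :: bool set) (case_bool X Y) P p" if "X \<in> Obj A" "Y \<in> Obj A" for X Y
    using ex_binary_product that .
qed (rule abelian_category.ex_kernel[OF assms(1)] abelian_category.ex_cokernel[OF assms(1)]
    abelian_category.mono_normal[OF assms(1)] abelian_category.epi_normal[OF assms(1)]
    TensorO_Obj EHom_Obj FA_Comp tensor_adjoint mu_Hom mu_natural eta_Hom eta_natural Obj_Mod_D(1) act_Hom act_mu act_eta
    cpt_Hom cpt_act cpt_Ident cpt_Comp TensorA_Ident; (assumption | rule EHom_Obj; assumption)?)+

end

section \<open>Smallness\<close>

lemma small_inj:
  assumes "inj_on f X" "f ` X \<subseteq> Y" "small U Y"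
  shows "small U X"
  using assms card_of_ordLeq[of X Y] ordLeq_ordLess_trans unfolding small_def by blast

text \<open>The strong limit condition in \<open>universe\<close> speaks of subsets of
  \<open>'u\<close>; a small set of another type is first moved into \<open>'u\<close> by an
  injection, available because its cardinality is smaller.\<close>

lemma small_Pow:
  fixes U :: "'u itself"
  assumes "universe U" "small U X"
  shows "small U (Pow X)"
proof -
  obtain f :: "_ \<Rightarrow> 'u" where f: "inj_on f X"
    using assms(2) card_of_ordLeq[of X "UNIV :: 'u set"] ordLess_imp_ordLeq unfolding small_def by blast
  have "small U (f ` X)"
    by (rule small_inj[OF inj_on_inv_into[OF order_refl] _ assms(2)]) (auto simp: inv_into_into)
  then have "small U (Pow (f ` X))" using assms(1) unfolding universe_def by blast
  then show ?thesis by (rule small_inj[OF inj_on_image_Pow[OF f], rotated]) auto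
qed

text \<open>Regularity of the cardinal of \<open>'u\<close>, in the form that a small union of small
  sets is small. Tagging the fibres with their index makes the union the dependent sum.\<close>

lemma small_Sigma:
  fixes U :: "'u itself"
  assumes U: "universe U" and I: "small U I" and B: "\<And>i. i \<in> I \<Longrightarrow> small U (B i)"
  shows "small U (Sigma I B)"
proof -
  have "small U ({i} \<times> B i)" if "i \<in> I" for i
    by (rule small_inj[of snd, OF _ _ B[OF that]]) (auto simp: inj_on_def)
  then have "\<forall>i\<in>I. (card_of ({i} \<times> B i), card_of (UNIV :: 'u set)) \<in> ordLess"
    by (simp add: small_def)
  moreover have "BNF_Cardinal_Arithmetic.cinfinite (card_of (UNIV :: 'u set)) \<and> Card_order (card_of (UNIV :: 'u set))"
    using U card_of_Card_order[of "UNIV :: 'u set"] unfolding universe_def BNF_Cardinal_Arithmetic.cinfinite_def Field_card_of by blast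
  ultimately have "small U (\<Union>i\<in>I. {i} \<times> B i)"
    using card_of_UNION_ordLess_infinite_Field_regularCard[of "card_of (UNIV :: 'u set)" I
        "\<lambda>i. {i} \<times> B i"] U I
    unfolding small_def universe_def by blast
  moreover have "(\<Union>i\<in>I. {i} \<times> B i) = Sigma I B" by auto
  ultimately show ?thesis by simp
qed

text \<open>A function is determined by its graph over \<open>I\<close>, so the product embeds into
  the power set of the dependent sum, which is small by the strong limit condition.\<close>

lemma small_PiE:
  assumes U: "universe U" and I: "small U I" and B: "\<And>i. i \<in> I \<Longrightarrow> small U (B i)"
  shows "small U (PiE I B)"
proof (rule small_inj[of "\<lambda>f. (\<lambda>i. (i, f i)) ` I"])
  show "small U (Pow (Sigma I B))" by (rule small_Pow[OF U small_Sigma[OF U I B]])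
  show "inj_on (\<lambda>f. (\<lambda>i. (i, f i)) ` I) (PiE I B)"
    by (rule inj_onI, rule PiE_ext) auto
qed auto

context enriched_modules
begin

text \<open>By \<open>faithful\<close> a transformation is determined by its components, so a
  hom-set embeds into a product, over the small set \<open>S\<close>, of small hom-sets of
  \<open>A\<close>.\<close>

lemma locally_small_Mod:
  assumes U: "universe U" and A: "locally_small U A" and S: "small U S"
  shows "locally_small U Md"
  unfolding locally_small_def
proof (intro ballI)
  fix T R assume T: "T \<in> Obj Md" and R: "R \<in> Obj Md"
  show "small U (Hom Md T R)"
  proof (rule small_inj[of "\<lambda>u. restrict (\<lambda>a. cpt a u) S"])
    show "small U (PiE S (\<lambda>a. Hom A (FObj T a) (FObj R a)))"
      using A Obj_Mod_D(1)[OF T] Obj_Mod_D(1)[OF R] by (intro small_PiE[OF U S]) (simp add: locally_small_def)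
    show "inj_on (\<lambda>u. restrict (\<lambda>a. cpt a u) S) (Hom Md T R)"
      by (rule inj_onI, erule (1) faithful) (metis restrict_apply')
    show "(\<lambda>u. restrict (\<lambda>a. cpt a u) S) ` Hom Md T R \<subseteq> PiE S (\<lambda>a. Hom A (FObj T a) (FObj R a))"
      using cpt_Hom by auto
  qed
qed

end

text \<open>Local smallness is included so that the module category meets the size condition that
  \<open>benabou_cosmos\<close> imposes on \<open>A\<close>.\<close>

theorem theorem3p3:
  fixes A :: "('o, 'm) moncat"
    and C :: "('c, 'o, 'm) ecat"
  assumes "universe TYPE('u)"
    and "abelian_benabou_cosmos TYPE('u) A"
    and "small_enriched_category TYPE('u) A C"
  shows "locally_small TYPE('u) (Mod_cat A C) \<and> abelian_category (Mod_cat A C) \<and>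
    AB4 TYPE('u) (Mod_cat A C) \<and> AB4_star TYPE('u) (Mod_cat A C)"
proof -
  have A: "symmetric_closed_monoidal_category A" "locally_small TYPE('u) A" "abelian_category A"
    "AB4 TYPE('u) A" "AB4_star TYPE('u) A"
    using assms(2) by (auto simp: abelian_benabou_cosmos_def benabou_cosmos_def)
  have C: "enriched_category A C" "small TYPE('u) (EObj C)"
    using assms(3) by (auto simp: small_enriched_category_def)
  interpret enriched_modules A C
    by (intro enriched_modules.intro A C)
  \<comment> \<open>\<open>preadditive\<close> asserts only the existence of an additive structure;
    one witness is fixed for the interpretation, and the conclusion does not mention it.\<close>
  obtain plus zero where pz: "additive_structure A plus zero"
    using preadditive_iff abelian_category.preadditive[OF A(3)] abelian_category.ex_zero_object[OF A(3)] by blast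
  interpret graded_algebras A plus zero "Mod_cat A C" S "\<lambda>a b X. FO a b X" "\<lambda>a b f. FA a b f" mu eta
      "\<lambda>a T. FObj T a" cpt act
    by (rule graded_algebras_Mod[OF A(3) pz])
  show ?thesis
    using locally_small_Mod[OF assms(1) A(2) C(2)] algebras_abelian A(4,5) by blast
qed

end
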